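(* Let $G=\sum_kg_kP_k$ be a Hermitian operator with a discrete spectrum and $|\psi\rangle$ a unit vector. Then for all $\alpha,\beta\ge\frac12$ with $\frac1\alpha+\frac1\beta=2$, the Rényi asymmetry of the pure state $|\psi\rangle\langle\psi|$ satisfies the duality property $$A^G_\alpha(|\psi\rangle\langle\psi|)=H_\beta\big(|\psi\rangle\langle\psi|_G\big),\qquad |\psi\rangle\langle\psi|_G:=\sum_kP_k|\psi\rangle\langle\psi|P_k .$$
   Context: $g_k$ are the distinct eigenvalues of $G$ and $P_k$ the projectors onto the corresponding eigenspaces. $H_\beta(\rho)=\frac1{1-\beta}\log\mathrm{tr}[\rho^\beta]$ is the quantum Rényi entropy ($\beta=1$: von Neumann entropy, and $\beta=\infty$, by limits). Rényi asymmetry: $A^G_\alpha(\rho)=\inf_{\sigma:[\sigma,G]=0}D_\alpha(\rho\|\sigma)$, infimum over density operators $\sigma$ commuting with $G$, where $D_\alpha(\rho\|\sigma)=\frac1{\alpha-1}\log\mathrm{tr}\big[(\sigma^{\frac{1-\alpha}{2\alpha}}\rho\,\sigma^{\frac{1-\alpha}{2\alpha}})^\alpha\big]$ is the sandwiched Rényi relative entropy (infinite if $\alpha\ge1$ and the support of $\rho$ is not in that of $\sigma$; $\alpha=1,\infty$ by limits). The logarithm base is an arbitrary fixed number $>1$. *)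

theory Defs
  imports "HOL-Analysis.Analysis"
begin

text \<open>Complex Hilbert spaces of arbitrary (in particular infinite) dimension. The inner
  product is conjugate-linear in its first argument.\<close>

class complex_hilbert_space = banach +
  fixes scaleC :: "complex \<Rightarrow> 'a \<Rightarrow> 'a"  (infixr "*\<^sub>C" 75)
    and cinner :: "'a \<Rightarrow> 'a \<Rightarrow> complex"
  assumes scaleC_add_right: "c *\<^sub>C (x + y) = c *\<^sub>C x + c *\<^sub>C y"
    and scaleC_add_left: "(c + d) *\<^sub>C x = c *\<^sub>C x + d *\<^sub>C x"
    and scaleC_scaleC: "c *\<^sub>C d *\<^sub>C x = (c * d) *\<^sub>C x"
    and scaleR_scaleC: "r *\<^sub>R x = complex_of_real r *\<^sub>C x"
    and cinner_commute: "cinner x y = cnj (cinner y x)"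
    and cinner_add_right: "cinner x (y + z) = cinner x y + cinner x z"
    and cinner_scaleC_right: "cinner x (c *\<^sub>C y) = c * cinner x y"
    and cinner_self_nonneg: "cinner x x \<in> \<real>\<^sub>\<ge>\<^sub>0"
    and norm_eq_sqrt_cinner: "norm x = sqrt (Re (cinner x x))"

instantiation complex :: complex_hilbert_space
begin

definition scaleC_complex :: "complex \<Rightarrow> complex \<Rightarrow> complex"
  where "scaleC_complex c x = c * x"

definition cinner_complex :: "complex \<Rightarrow> complex \<Rightarrow> complex"
  where "cinner_complex x y = cnj x * y"

instance
  by standard
    (auto simp: scaleC_complex_def cinner_complex_def algebra_simps scaleR_conv_of_real
      complex_nonneg_Reals_iff cmod_def power2_eq_square)

end

text \<open>A possibly unbounded operator is a pair of its domain \<open>D\<close> and a function \<open>A\<close> whose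
  values outside \<open>D\<close> are irrelevant; bounded operators have domain \<open>UNIV\<close>.\<close>

definition bounded_op :: "('a::complex_hilbert_space \<Rightarrow> 'a) \<Rightarrow> bool"
  where "bounded_op A \<longleftrightarrow> bounded_linear A \<and> (\<forall>c x. A (c *\<^sub>C x) = c *\<^sub>C A x)"

text \<open>The last conjunct says that the graph of the adjoint is the graph of \<open>A\<close>.\<close>

definition self_adjoint :: "'a::complex_hilbert_space set \<Rightarrow> ('a \<Rightarrow> 'a) \<Rightarrow> bool"
  where "self_adjoint D A \<longleftrightarrow>
    closure D = UNIV \<and>
    (\<forall>x\<in>D. \<forall>y\<in>D. x + y \<in> D \<and> A (x + y) = A x + A y) \<and>
    (\<forall>c. \<forall>x\<in>D. c *\<^sub>C x \<in> D \<and> A (c *\<^sub>C x) = c *\<^sub>C A x) \<and>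
    (\<forall>y z. (\<forall>x\<in>D. cinner (A x) y = cinner x z) \<longleftrightarrow> y \<in> D \<and> z = A y)"

definition orth_proj :: "'a::complex_hilbert_space set \<Rightarrow> 'a \<Rightarrow> 'a"
  where "orth_proj M x = (THE y. y \<in> M \<and> (\<forall>z\<in>M. cinner z (x - y) = 0))"

definition eigenspace :: "'a::complex_hilbert_space set \<Rightarrow> ('a \<Rightarrow> 'a) \<Rightarrow> complex \<Rightarrow> 'a set"
  where "eigenspace D A g = {x \<in> D. A x = g *\<^sub>C x}"

definition eigenvalues :: "'a::complex_hilbert_space set \<Rightarrow> ('a \<Rightarrow> 'a) \<Rightarrow> complex set"
  where "eigenvalues D A = {g. \<exists>x\<in>eigenspace D A g. x \<noteq> 0}"

definition eigenproj :: "'a::complex_hilbert_space set \<Rightarrow> ('a \<Rightarrow> 'a) \<Rightarrow> complex \<Rightarrow> 'a \<Rightarrow> 'a"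
  where "eigenproj D A g = orth_proj (eigenspace D A g)"

text \<open>\<open>A = (\<Sum>g. g P\<^sub>g)\<close> and \<open>1 = (\<Sum>g. P\<^sub>g)\<close> over the distinct eigenvalues, in the strong sense.
  Finite multiplicity or isolation of the eigenvalues is not required.\<close>

definition discrete_spectrum :: "'a::complex_hilbert_space set \<Rightarrow> ('a \<Rightarrow> 'a) \<Rightarrow> bool"
  where "discrete_spectrum D A \<longleftrightarrow>
    (\<forall>x\<in>D. ((\<lambda>g. g *\<^sub>C eigenproj D A g x) has_sum A x) (eigenvalues D A)) \<and>
    (\<forall>x. ((\<lambda>g. eigenproj D A g x) has_sum x) (eigenvalues D A))"

text \<open>Functional calculus for a bounded self-adjoint operator with discrete spectrum. The
  result may be unbounded, hence the separate domain.\<close>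

definition op_fun :: "(real \<Rightarrow> real) \<Rightarrow> ('a::complex_hilbert_space \<Rightarrow> 'a) \<Rightarrow> 'a \<Rightarrow> 'a"
  where "op_fun f A x =
    (\<Sum>\<^sub>\<infinity>g\<in>eigenvalues UNIV A. f (Re g) *\<^sub>R eigenproj UNIV A g x)"

definition op_fun_dom :: "(real \<Rightarrow> real) \<Rightarrow> ('a::complex_hilbert_space \<Rightarrow> 'a) \<Rightarrow> 'a set"
  where "op_fun_dom f A =
    {x. (\<lambda>g. f (Re g) *\<^sub>R eigenproj UNIV A g x) summable_on eigenvalues UNIV A}"

text \<open>Since \<open>0 powr s = 0\<close> for every \<open>s\<close>, powers (also negative ones) are taken on the support.\<close>

definition op_powr :: "('a::complex_hilbert_space \<Rightarrow> 'a) \<Rightarrow> real \<Rightarrow> 'a \<Rightarrow> 'a"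
  where "op_powr A s = op_fun (\<lambda>t. t powr s) A"

definition op_powr_dom :: "('a::complex_hilbert_space \<Rightarrow> 'a) \<Rightarrow> real \<Rightarrow> 'a set"
  where "op_powr_dom A s = op_fun_dom (\<lambda>t. t powr s) A"

definition orthonormal_basis :: "'a::complex_hilbert_space set \<Rightarrow> bool"
  where "orthonormal_basis B \<longleftrightarrow>
    (\<forall>e\<in>B. norm e = 1) \<and>
    (\<forall>e\<in>B. \<forall>f\<in>B. e \<noteq> f \<longrightarrow> cinner e f = 0) \<and>
    (\<forall>x. (\<forall>e\<in>B. cinner e x = 0) \<longrightarrow> x = 0)"

text \<open>The trace of a positive operator, possibly infinite; it does not depend on the chosen basis.\<close>

definition op_trace :: "('a::complex_hilbert_space \<Rightarrow> 'a) \<Rightarrow> ennreal"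
  where "op_trace A =
    (\<Sum>\<^sub>\<infinity>e\<in>(SOME B. orthonormal_basis B). ennreal (Re (cinner e (A e))))"

definition density_op :: "('a::complex_hilbert_space \<Rightarrow> 'a) \<Rightarrow> bool"
  where "density_op \<rho> \<longleftrightarrow>
    bounded_op \<rho> \<and> (\<forall>x. cinner x (\<rho> x) \<in> \<real>\<^sub>\<ge>\<^sub>0) \<and> op_trace \<rho> = 1"

definition ketbra :: "'a::complex_hilbert_space \<Rightarrow> 'a \<Rightarrow> 'a \<Rightarrow> 'a"
  where "ketbra \<psi> \<phi> x = cinner \<phi> x *\<^sub>C \<psi>"

definition support :: "('a::complex_hilbert_space \<Rightarrow> 'a) \<Rightarrow> 'a set"
  where "support A = {x. \<forall>y. A y = 0 \<longrightarrow> cinner y x = 0}"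

text \<open>For a bounded operator \<open>\<sigma>\<close> and a possibly unbounded operator \<open>G\<close>, \<open>[\<sigma>, G] = 0\<close> means
  that \<open>G \<sigma>\<close> extends \<open>\<sigma> G\<close>.\<close>

definition commutes :: "('a::complex_hilbert_space \<Rightarrow> 'a) \<Rightarrow> 'a set \<Rightarrow> ('a \<Rightarrow> 'a) \<Rightarrow> bool"
  where "commutes \<sigma> D G \<longleftrightarrow> (\<forall>x\<in>D. \<sigma> x \<in> D \<and> G (\<sigma> x) = \<sigma> (G x))"

definition pinching ::
    "'a::complex_hilbert_space set \<Rightarrow> ('a \<Rightarrow> 'a) \<Rightarrow> ('a \<Rightarrow> 'a) \<Rightarrow> 'a \<Rightarrow> 'a"
  where "pinching D G \<rho> x =
    (\<Sum>\<^sub>\<infinity>g\<in>eigenvalues D G. eigenproj D G g (\<rho> (eigenproj D G g x)))"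

definition elog :: "real \<Rightarrow> ennreal \<Rightarrow> ereal"
  where "elog b x =
    (if x = 0 then - \<infinity> else if x = \<infinity> then \<infinity> else ereal (log b (enn2real x)))"

text \<open>Orders range over the extended reals. For \<open>\<beta> = 1\<close> the entropy is \<open>- tr (\<rho> log \<rho>)\<close>.\<close>

definition renyi_entropy_real ::
    "real \<Rightarrow> real \<Rightarrow> ('a::complex_hilbert_space \<Rightarrow> 'a) \<Rightarrow> ereal"
  where "renyi_entropy_real b \<beta> \<rho> = ereal (1 / (1 - \<beta>)) * elog b (op_trace (op_powr \<rho> \<beta>))"

definition von_neumann_entropy :: "real \<Rightarrow> ('a::complex_hilbert_space \<Rightarrow> 'a) \<Rightarrow> ereal"
  where "von_neumann_entropy b \<rho> = enn2ereal (op_trace (op_fun (\<lambda>t. - (t * log b t)) \<rho>))"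

definition renyi_entropy ::
    "real \<Rightarrow> ereal \<Rightarrow> ('a::complex_hilbert_space \<Rightarrow> 'a) \<Rightarrow> ereal"
  where "renyi_entropy b \<beta> \<rho> =
    (if \<beta> = 1 then von_neumann_entropy b \<rho>
     else if \<beta> = \<infinity> then Lim at_top (\<lambda>t. renyi_entropy_real b t \<rho>)
     else renyi_entropy_real b (real_of_ereal \<beta>) \<rho>)"

text \<open>\<open>X\<close> is the bounded operator \<open>\<sigma>\<^sup>s \<rho> \<sigma>\<^sup>s\<close>. For negative \<open>s\<close> the power \<open>\<sigma>\<^sup>s\<close> can be
  unbounded; \<open>X\<close> is then the bounded extension of the product from its dense domain, which need
  not exist.\<close>

definition is_sandwich ::
    "real \<Rightarrow> ('a::complex_hilbert_space \<Rightarrow> 'a) \<Rightarrow> ('a \<Rightarrow> 'a) \<Rightarrow> ('a \<Rightarrow> 'a) \<Rightarrow> bool"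
  where "is_sandwich s \<rho> \<sigma> X \<longleftrightarrow>
    bounded_op X \<and>
    (\<forall>x\<in>op_powr_dom \<sigma> s.
      \<rho> (op_powr \<sigma> s x) \<in> op_powr_dom \<sigma> s \<and>
      op_powr \<sigma> s (\<rho> (op_powr \<sigma> s x)) = X x)"

text \<open>The trace of the \<open>\<alpha>\<close>-th power of \<open>\<sigma>\<^sup>s \<rho> \<sigma>\<^sup>s\<close> for \<open>s = (1 - \<alpha>) / (2 \<alpha>)\<close>. An operator with
  finite trace of its \<open>\<alpha>\<close>-th power is compact and therefore has discrete spectrum, so the trace
  is infinite in the remaining cases. These only arise for \<open>\<alpha> > 1\<close> in infinite dimension.\<close>

definition sandwiched_trace ::
    "real \<Rightarrow> ('a::complex_hilbert_space \<Rightarrow> 'a) \<Rightarrow> ('a \<Rightarrow> 'a) \<Rightarrow> ennreal"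
  where "sandwiched_trace \<alpha> \<rho> \<sigma> =
    (let s = (1 - \<alpha>) / (2 * \<alpha>) in
     if \<exists>X. is_sandwich s \<rho> \<sigma> X \<and> discrete_spectrum UNIV X
     then op_trace (op_powr (THE X. is_sandwich s \<rho> \<sigma> X) \<alpha>)
     else \<infinity>)"

definition renyi_divergence_real ::
    "real \<Rightarrow> real \<Rightarrow> ('a::complex_hilbert_space \<Rightarrow> 'a) \<Rightarrow> ('a \<Rightarrow> 'a) \<Rightarrow> ereal"
  where "renyi_divergence_real b \<alpha> \<rho> \<sigma> =
    (if \<alpha> \<ge> 1 \<and> \<not> support \<rho> \<subseteq> support \<sigma> then \<infinity>
     else ereal (1 / (\<alpha> - 1)) * elog b (sandwiched_trace \<alpha> \<rho> \<sigma>))"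

text \<open>For \<open>\<alpha> = 1\<close> the limit is taken from below. In infinite dimension the limit from above can
  differ: the divergence may be infinite for all \<open>\<alpha> > 1\<close> although the relative entropy
  \<open>tr (\<rho> (log \<rho> - log \<sigma>))\<close>, which is the limit from below, is finite.\<close>

definition renyi_divergence ::
    "real \<Rightarrow> ereal \<Rightarrow> ('a::complex_hilbert_space \<Rightarrow> 'a) \<Rightarrow> ('a \<Rightarrow> 'a) \<Rightarrow> ereal"
  where "renyi_divergence b \<alpha> \<rho> \<sigma> =
    (if \<alpha> = 1 then Lim (at_left 1) (\<lambda>t. renyi_divergence_real b t \<rho> \<sigma>)
     else if \<alpha> = \<infinity> then Lim at_top (\<lambda>t. renyi_divergence_real b t \<rho> \<sigma>)
     else renyi_divergence_real b (real_of_ereal \<alpha>) \<rho> \<sigma>)"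

definition renyi_asymmetry ::
    "real \<Rightarrow> ereal \<Rightarrow> 'a::complex_hilbert_space set \<Rightarrow> ('a \<Rightarrow> 'a) \<Rightarrow> ('a \<Rightarrow> 'a) \<Rightarrow> ereal"
  where "renyi_asymmetry b \<alpha> D G \<rho> =
    (INF \<sigma>\<in>{\<sigma>. density_op \<sigma> \<and> commutes \<sigma> D G}. renyi_divergence b \<alpha> \<rho> \<sigma>)"

end

(* Put t = (1 - alpha) / alpha = 1 - 1 / beta. For a pure state, sigma^s rho sigma^s with
   s = t / 2 has rank one, so the divergence is - (1 / t) log <psi, sigma^t psi>, where the moment is
   the sum over the eigenvalues g of sigma of g^t |P_g psi|^2. A sigma commuting with G respects the
   components psi_k of psi in the eigenspaces of G. With p_k = |psi_k|^2 and Z = sum p_k^beta, the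
   tangent line of x^t at r_k = p_k^beta / Z, applied on each psi_k, gives the bound Z^(1 / beta) on
   the moment (from above for t > 0, from below for t < 0): the coefficients p_k r_k^(t - 1) do not
   depend on k and the diagonal entries of sigma sum to at most 1. Equality holds for
   sigma = sum r_k |u_k><u_k|. Tangent lines also show that the divergence decreases in t, which
   turns the limits for alpha = 1 and alpha = infinity into suprema.

   For t < 0 the eigenvectors of sigma have to be complete on the support, which is the spectral
   theorem for positive operators with finite trace. *)

theory Submission
  imports Defs
begin

subsection \<open>Complex Hilbert spaces\<close>

text \<open>The arbitrary dimension shapes the proof. For \<beta> < 1 the sum Z can be infinite, and
  for t < 0 so can the moment, because \<sigma>^t can be unbounded. Moments and traces are therefore
  sums in \<open>ennreal\<close>, where every sum exists and iterated sums can be interchanged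
  freely. For t < 0 the lower bound is proved for the components in a finite set F, with weights
  normalised on F, and the entropy is recovered by exhausting all components. An optimal state is
  required only when the entropy is finite. Three orders escape the generic weights. For \<alpha> =
  1/2 (t = 1, \<beta> = \<infinity>) the optimum concentrates on a largest component. For \<alpha> =
  \<infinity> the exponents (1 - \<alpha>) / \<alpha> only approach -1, so the bound is carried to
  \<beta> = 1/2 by continuity of finite sums. For \<alpha> = 1 the exponent tends to 0 and the lower
  bound becomes a difference quotient in \<beta> at 1. \<open>op_trace\<close> is computed in one
  fixed basis, while the vectors u_k come from G; comparing the two needs an inequality for
  arbitrary orthonormal systems.\<close>

lemma scaleC_one [simp]: "1 *\<^sub>C x = (x::'a::complex_hilbert_space)"
  using scaleR_scaleC[of 1 x] by simp

lemma scaleC_zero_left [simp]: "0 *\<^sub>C x = (0::'a::complex_hilbert_space)"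
  using scaleR_scaleC[of 0 x] by simp

lemma scaleC_zero_right [simp]: "c *\<^sub>C (0::'a::complex_hilbert_space) = 0"
  by (metis mult_zero_right scaleC_scaleC scaleC_zero_left)

lemma scaleC_minus_one: "(-1) *\<^sub>C x = - (x::'a::complex_hilbert_space)"
  using scaleR_scaleC[of "-1" x] by simp

lemma cinner_add_left: "cinner (x + y) z = cinner x z + cinner y (z::'a::complex_hilbert_space)"
  by (metis cinner_add_right cinner_commute complex_cnj_add)

lemma cinner_scaleC_left: "cinner (c *\<^sub>C x) y = cnj c * cinner x (y::'a::complex_hilbert_space)"
  by (metis cinner_commute cinner_scaleC_right complex_cnj_mult)

lemma cinner_zero_right [simp]: "cinner x (0::'a::complex_hilbert_space) = 0"
  using cinner_scaleC_right[of x 0 0] by simp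

lemma cinner_zero_left [simp]: "cinner (0::'a::complex_hilbert_space) x = 0"
  using cinner_scaleC_left[of 0 0 x] by simp

lemma cinner_minus_right: "cinner x (- y) = - cinner x (y::'a::complex_hilbert_space)"
  by (metis scaleC_minus_one cinner_scaleC_right mult_minus1)

lemma cinner_minus_left: "cinner (- x) y = - cinner x (y::'a::complex_hilbert_space)"
  by (metis cinner_commute cinner_minus_right complex_cnj_minus)

lemma cinner_diff_right: "cinner x (y - z) = cinner x y - cinner x (z::'a::complex_hilbert_space)"
  using cinner_add_right[of x y "- z"] by (simp add: cinner_minus_right)

lemma cinner_diff_left: "cinner (x - y) z = cinner x z - cinner y (z::'a::complex_hilbert_space)"
  using cinner_add_left[of x "- y" z] by (simp add: cinner_minus_left)

lemma cinner_scaleR_right: "cinner x (r *\<^sub>R y) = of_real r * cinner x (y::'a::complex_hilbert_space)"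
  by (simp add: scaleR_scaleC cinner_scaleC_right)

lemma cinner_scaleR_left: "cinner (r *\<^sub>R x) y = of_real r * cinner x (y::'a::complex_hilbert_space)"
  by (simp add: scaleR_scaleC cinner_scaleC_left)

lemma cinner_self: "cinner x x = of_real ((norm (x::'a::complex_hilbert_space))\<^sup>2)"
  using cinner_self_nonneg[of x] by (simp add: norm_eq_sqrt_cinner complex_nonneg_Reals_iff complex_eq_iff)

lemma Re_cinner_self: "Re (cinner x x) = (norm (x::'a::complex_hilbert_space))\<^sup>2"
  by (simp add: cinner_self)

lemma cinner_self_eq_0 [simp]: "cinner x x = 0 \<longleftrightarrow> x = (0::'a::complex_hilbert_space)"
  by (simp add: cinner_self)

lemma norm_scaleC: "norm (c *\<^sub>C x) = cmod c * norm (x::'a::complex_hilbert_space)"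
proof -
  have "of_real ((norm (c *\<^sub>C x))\<^sup>2) = (of_real ((cmod c * norm x)\<^sup>2) :: complex)"
    unfolding cinner_self[symmetric] cinner_scaleC_left cinner_scaleC_right
    using complex_norm_square[of c] by (simp add: cinner_self power_mult_distrib algebra_simps)
  then show ?thesis
    by (simp add: of_real_eq_iff del: of_real_power)
qed

lemma cinner_cnj_mult: "cinner x y * cinner y x = of_real ((cmod (cinner x (y::'a::complex_hilbert_space)))\<^sup>2)"
  by (metis cinner_commute complex_norm_square)

lemma cmod_cinner_commute: "cmod (cinner x y) = cmod (cinner y (x::'a::complex_hilbert_space))"
  by (metis cinner_commute complex_mod_cnj)

lemma norm_diff_sq:
  "(norm (x - y))\<^sup>2 = (norm x)\<^sup>2 - 2 * Re (cinner x y) + (norm (y::'a::complex_hilbert_space))\<^sup>2"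
  unfolding Re_cinner_self[symmetric] cinner_diff_left cinner_diff_right
  using cinner_commute[of x y] by simp

lemma norm_add_sq_orth:
  assumes "cinner x y = 0"
  shows "(norm (x + y))\<^sup>2 = (norm x)\<^sup>2 + (norm (y::'a::complex_hilbert_space))\<^sup>2"
  unfolding Re_cinner_self[symmetric] cinner_add_left cinner_add_right
  using assms cinner_commute[of y x] by simp

section \<open>Positive operators: symmetry and Cauchy-Schwarz\<close>

definition positive_op :: "('a::complex_hilbert_space \<Rightarrow> 'a) \<Rightarrow> bool"
  where "positive_op A \<longleftrightarrow> bounded_op A \<and> (\<forall>x. cinner x (A x) \<in> \<real>\<^sub>\<ge>\<^sub>0)"

lemma bounded_opD:
  assumes "bounded_op A"
  shows "bounded_linear A" "A (x + y) = A x + A y" "A (x - y) = A x - A y"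
    "A (c *\<^sub>C x) = c *\<^sub>C A x" "A (r *\<^sub>R x) = r *\<^sub>R A x" "A 0 = 0"
  using assms unfolding bounded_op_def
  by (auto simp: bounded_linear.linear linear_add linear_diff linear_0 linear_scale)

lemma positive_opD:
  assumes "positive_op A"
  shows "bounded_op A" "0 \<le> Re (cinner x (A x))" "Im (cinner x (A x)) = 0"
    "cinner x (A x) = of_real (Re (cinner x (A x)))"
  using assms unfolding positive_op_def by (auto simp: complex_nonneg_Reals_iff complex_eq_iff)

text \<open>Polarization: the quadratic form is real at \<open>x + y\<close> and at
  \<open>x + \<i> *\<^sub>C y\<close>; the first gives the imaginary part of the symmetry, the
  second the real part.\<close>

lemma positive_op_symmetric:
  assumes "positive_op A"
  shows "cinner (A x) y = cinner x (A y)"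
proof -
  note b = bounded_opD[OF positive_opD(1)[OF assms]]
  have im: "Im (cinner z (A z)) = 0" for z
    by (rule positive_opD(3)[OF assms])
  have "Im (cinner x (A y)) + Im (cinner y (A x)) = 0"
    using im[of "x + y"] im[of x] im[of y]
    by (simp add: b(2) cinner_add_left cinner_add_right)
  moreover have "Re (cinner x (A y)) - Re (cinner y (A x)) = 0"
    using im[of "x + \<i> *\<^sub>C y"] im[of x] im[of y]
    by (simp add: b(2,4) cinner_add_left cinner_add_right cinner_scaleC_left cinner_scaleC_right)
  ultimately have "cinner x (A y) = cnj (cinner y (A x))"
    by (simp add: complex_eq_iff)
  then show ?thesis
    by (metis cinner_commute)
qed

text \<open>Nonnegativity of the form at x - t c y with c = <y, A x> and t real: the factor c aligns
  the phase, so that a real quadratic in t remains. It is used at t = 1 / q; for q = 0 it is linear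
  and fails for large t unless c = 0.\<close>

lemma positive_op_cauchy_schwarz:
  assumes "positive_op A"
  shows "(cmod (cinner y (A x)))\<^sup>2 \<le> Re (cinner x (A x)) * Re (cinner y (A y))"
proof -
  note b = bounded_opD[OF positive_opD(1)[OF assms]]
  define p q c where "p = Re (cinner x (A x))" "q = Re (cinner y (A y))" "c = cinner y (A x)"
  have pq: "p \<ge> 0" "q \<ge> 0"
    using positive_opD(2)[OF assms] by (auto simp: p_q_c_def)
  have cx: "cinner x (A y) = cnj c"
    unfolding p_q_c_def by (metis assms cinner_commute positive_op_symmetric)
  have key: "2 * t * (cmod c)\<^sup>2 \<le> p + t\<^sup>2 * (cmod c)\<^sup>2 * q" for t :: real
  proof -
    define d where "d = of_real t * c"
    have d1: "d * cnj c = of_real (t * (cmod c)\<^sup>2)"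
      using complex_norm_square[of c] by (simp add: d_def)
    have d2: "cnj d * c = of_real (t * (cmod c)\<^sup>2)"
      using complex_norm_square[of c] by (simp add: d_def mult.commute)
    have d3: "cnj d * d = of_real (t\<^sup>2 * (cmod c)\<^sup>2)"
      using complex_norm_square[of c] by (simp add: d_def mult.commute power2_eq_square)
    have "0 \<le> Re (cinner (x - d *\<^sub>C y) (A (x - d *\<^sub>C y)))"
      by (rule positive_opD(2)[OF assms])
    also have "cinner (x - d *\<^sub>C y) (A (x - d *\<^sub>C y)) =
        cinner x (A x) - d * cnj c - cnj d * c + cnj d * d * cinner y (A y)"
      by (simp add: b(3,4) cinner_diff_left cinner_diff_right cinner_scaleC_left
          cinner_scaleC_right cx p_q_c_def(3)[symmetric] algebra_simps)
    also have "Re \<dots> = p - 2 * t * (cmod c)\<^sup>2 + t\<^sup>2 * (cmod c)\<^sup>2 * q"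
      unfolding d1 d2 d3 by (simp add: p_q_c_def)
    finally show ?thesis by simp
  qed
  have "(cmod c)\<^sup>2 \<le> p * q"
  proof (cases "q = 0")
    case True
    have "(cmod c)\<^sup>2 \<le> 0"
    proof (rule ccontr)
      assume "\<not> (cmod c)\<^sup>2 \<le> 0"
      then have "c \<noteq> 0" by auto
      then have "2 * ((p + 1) / (cmod c)\<^sup>2) * (cmod c)\<^sup>2 = 2 * (p + 1)" by simp
      with key[of "(p + 1) / (cmod c)\<^sup>2"] True pq show False by simp
    qed
    then show ?thesis using pq True by simp
  next
    case False
    then have "q > 0" using pq by simp
    with key[of "1 / q"] have "2 * (cmod c)\<^sup>2 / q \<le> p + (cmod c)\<^sup>2 / q"
      by (simp add: power2_eq_square)
    then show ?thesis using \<open>q > 0\<close> by (simp add: field_simps)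
  qed
  then show ?thesis by (simp add: p_q_c_def)
qed

lemma positive_op_id: "positive_op (\<lambda>x::'a::complex_hilbert_space. x)"
  by (simp add: positive_op_def bounded_op_def cinner_self_nonneg)

lemma cinner_bound: "cmod (cinner x y) \<le> norm x * norm (y::'a::complex_hilbert_space)"
proof -
  have "(cmod (cinner x y))\<^sup>2 \<le> (norm x * norm y)\<^sup>2"
    using positive_op_cauchy_schwarz[OF positive_op_id, of x y]
    by (simp add: Re_cinner_self power_mult_distrib mult.commute)
  then show ?thesis
    by (simp add: power2_le_iff_abs_le)
qed

lemma bounded_linear_cinner_right: "bounded_linear (cinner (x::'a::complex_hilbert_space))"
proof (rule bounded_linear_intro[where K = "norm x"])
  show "cinner x (r *\<^sub>R y) = r *\<^sub>R cinner x y" for r y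
    by (simp add: cinner_scaleR_right scaleR_conv_of_real)
  show "cmod (cinner x y) \<le> norm y * norm x" for y
    using cinner_bound[of x y] by (simp add: mult.commute)
qed (rule cinner_add_right)

lemma bounded_linear_cinner_left: "bounded_linear (\<lambda>x. cinner x (y::'a::complex_hilbert_space))"
proof (rule bounded_linear_intro[where K = "norm y"])
  show "cinner (r *\<^sub>R x) y = r *\<^sub>R cinner x y" for r x
    by (simp add: cinner_scaleR_left scaleR_conv_of_real)
qed (auto simp: cinner_add_left cinner_bound)

lemma bounded_linear_scaleC_right: "bounded_linear (\<lambda>x::'a::complex_hilbert_space. c *\<^sub>C x)"
proof (rule bounded_linear_intro[where K = "cmod c"])
  show "c *\<^sub>C (r *\<^sub>R x) = r *\<^sub>R (c *\<^sub>C x)" for r and x :: 'a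
    by (simp add: scaleR_scaleC scaleC_scaleC mult.commute)
qed (auto simp: scaleC_add_right norm_scaleC mult.commute)

lemma scaleC_diff_right: "c *\<^sub>C (x - y) = c *\<^sub>C x - c *\<^sub>C (y::'a::complex_hilbert_space)"
  by (rule linear_diff[OF bounded_linear.linear[OF bounded_linear_scaleC_right]])

lemmas has_sum_cinner_right = has_sum_bounded_linear[OF bounded_linear_cinner_right]
lemmas has_sum_cinner_left = has_sum_bounded_linear[OF bounded_linear_cinner_left]
lemmas has_sum_scaleC = has_sum_bounded_linear[OF bounded_linear_scaleC_right]
lemmas tendsto_cinner_right = bounded_linear.tendsto[OF bounded_linear_cinner_right]

lemma cinner_sum_right: "cinner x (sum f F) = (\<Sum>i\<in>F. cinner x (f i :: 'a::complex_hilbert_space))"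
  by (rule linear_sum[OF bounded_linear.linear[OF bounded_linear_cinner_right]])

lemma cinner_sum_left: "cinner (sum f F) x = (\<Sum>i\<in>F. cinner (f i :: 'a::complex_hilbert_space) x)"
  by (rule linear_sum[OF bounded_linear.linear[OF bounded_linear_cinner_left]])

subsection \<open>Orthogonal families\<close>

definition orth_family :: "('i \<Rightarrow> 'a::complex_hilbert_space) \<Rightarrow> 'i set \<Rightarrow> bool"
  where "orth_family y I \<longleftrightarrow> (\<forall>i\<in>I. \<forall>j\<in>I. i \<noteq> j \<longrightarrow> cinner (y i) (y j) = 0)"

lemma orth_family_subset: "orth_family y I \<Longrightarrow> J \<subseteq> I \<Longrightarrow> orth_family y J"
  by (auto simp: orth_family_def)

lemma norm_sum_orth_family:
  assumes "orth_family y F" "finite F"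
  shows "(norm (sum y F))\<^sup>2 = (\<Sum>i\<in>F. (norm (y i))\<^sup>2)"
  using assms(2,1)
proof (induction F)
  case (insert i F)
  have "cinner (y i) (sum y F) = (\<Sum>j\<in>F. 0)"
    unfolding cinner_sum_right using insert by (intro sum.cong) (auto simp: orth_family_def)
  with insert show ?case
    by (simp add: norm_add_sq_orth orth_family_def)
qed simp

lemma has_sum_norm_orth_family:
  assumes "orth_family y I" "(y has_sum Y) I"
  shows "((\<lambda>i. (norm (y i))\<^sup>2) has_sum (norm Y)\<^sup>2) I"
proof -
  have "((\<lambda>F. (norm (sum y F))\<^sup>2) \<longlongrightarrow> (norm Y)\<^sup>2) (finite_subsets_at_top I)"
    using assms(2) unfolding has_sum_def by (intro tendsto_intros)
  moreover have "\<forall>\<^sub>F F in finite_subsets_at_top I. (norm (sum y F))\<^sup>2 = (\<Sum>i\<in>F. (norm (y i))\<^sup>2)"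
    by (rule eventually_finite_subsets_at_top_weakI)
      (auto intro!: norm_sum_orth_family orth_family_subset[OF assms(1)])
  ultimately show ?thesis
    unfolding has_sum_def using tendsto_cong by fastforce
qed

text \<open>Completeness of the space: by Pythagoras the difference of two partial sums is
  controlled by the tail of the squared norms.\<close>

lemma summable_on_orth_family:
  assumes "orth_family y I" "(\<lambda>i. (norm (y i))\<^sup>2) summable_on I"
  shows "y summable_on I"
proof -
  obtain L where L: "(sum (\<lambda>i. (norm (y i))\<^sup>2) \<longlongrightarrow> L) (finite_subsets_at_top I)"
    using assms(2) unfolding has_sum_def summable_on_def by blast
  have "\<exists>P. eventually P (finite_subsets_at_top I) \<and>
      (\<forall>F F'. P F \<and> P F' \<longrightarrow> dist (sum y F) (sum y F') < e)" if "e > 0" for e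
  proof -
    \<comment> \<open>Two deviations below \<open>e\<^sup>2 / 8\<close> from L bound a tail by
      \<open>e\<^sup>2 / 4\<close>, the square of e / 2.\<close>
    have "\<forall>\<^sub>F F in finite_subsets_at_top I. dist (\<Sum>i\<in>F. (norm (y i))\<^sup>2) L < e\<^sup>2 / 8"
      using L that by (intro tendstoD) auto
    then obtain F0 where F0: "finite F0" "F0 \<subseteq> I"
      and F0': "\<And>F. finite F \<Longrightarrow> F0 \<subseteq> F \<Longrightarrow> F \<subseteq> I \<Longrightarrow> dist (\<Sum>i\<in>F. (norm (y i))\<^sup>2) L < e\<^sup>2 / 8"
      unfolding eventually_finite_subsets_at_top by metis
    have close: "dist (sum y F) (sum y F0) < e / 2" if F: "finite F" "F0 \<subseteq> F" "F \<subseteq> I" for F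
    proof -
      have "(dist (sum y F) (sum y F0))\<^sup>2 = (\<Sum>i\<in>F - F0. (norm (y i))\<^sup>2)"
        unfolding dist_norm sum_diff[OF F(1,2), of y, symmetric]
        by (rule norm_sum_orth_family) (use F in \<open>auto intro: orth_family_subset[OF assms(1)]\<close>)
      also have "\<dots> = (\<Sum>i\<in>F. (norm (y i))\<^sup>2) - (\<Sum>i\<in>F0. (norm (y i))\<^sup>2)"
        by (rule sum_diff[OF F(1,2)])
      also have "\<dots> < e\<^sup>2 / 4"
        using F0'[OF F] F0'[OF F0(1) order_refl F0(2)] unfolding dist_real_def by argo
      also have "\<dots> = (e / 2)\<^sup>2" by (simp add: power2_eq_square)
      finally show ?thesis
        by (rule power_less_imp_less_base) (use \<open>e > 0\<close> in simp)
    qed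
    show ?thesis
    proof (intro exI conjI allI impI)
      show "\<forall>\<^sub>F F in finite_subsets_at_top I. finite F \<and> F0 \<subseteq> F \<and> F \<subseteq> I"
        unfolding eventually_finite_subsets_at_top using F0 by blast
      show "dist (sum y F) (sum y F') < e"
        if "(finite F \<and> F0 \<subseteq> F \<and> F \<subseteq> I) \<and> finite F' \<and> F0 \<subseteq> F' \<and> F' \<subseteq> I" for F F'
        using close[of F] close[of F'] that dist_triangle_half_l by blast
    qed
  qed
  then have "cauchy_filter (filtermap (sum y) (finite_subsets_at_top I))"
    by (simp add: cauchy_filter_metric_filtermap)
  moreover have "complete (UNIV::'b set)"
    by (rule complete_UNIV)
  ultimately obtain L' where "(sum y \<longlongrightarrow> L') (finite_subsets_at_top I)"
    using complete_uniform[where S = UNIV] by (force simp add: filterlim_def)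
  then show ?thesis
    using summable_on_def has_sum_def by blast
qed

text \<open>The second hypothesis makes \<open>y i\<close> the projection of x onto the line through
  \<open>y i\<close>. In this form Bessel's inequality serves both Fourier terms and projections
  onto orthogonal eigenspaces.\<close>

lemma orth_family_bessel_finite:
  assumes "orth_family y F" "\<And>i. i \<in> F \<Longrightarrow> cinner (y i) (x - y i) = 0" "finite F"
  shows "(\<Sum>i\<in>F. (norm (y i))\<^sup>2) \<le> (norm x)\<^sup>2"
proof -
  have "cinner (sum y F) x = of_real (\<Sum>i\<in>F. (norm (y i))\<^sup>2)"
    unfolding cinner_sum_left of_real_sum
    using assms(2) by (intro sum.cong) (auto simp: cinner_diff_right cinner_self)
  then have "cinner (sum y F) (x - sum y F) = 0"
    using norm_sum_orth_family[OF assms(1,3)] by (simp add: cinner_diff_right cinner_self del: of_real_sum)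
  then have "(norm (sum y F + (x - sum y F)))\<^sup>2 = (norm (sum y F))\<^sup>2 + (norm (x - sum y F))\<^sup>2"
    by (rule norm_add_sq_orth)
  then show ?thesis
    using norm_sum_orth_family[OF assms(1,3)] by simp
qed

lemma orth_family_bessel:
  assumes "orth_family y I" "\<And>i. i \<in> I \<Longrightarrow> cinner (y i) (x - y i) = 0"
  shows "(\<lambda>i. (norm (y i))\<^sup>2) summable_on I" "y summable_on I"
    "(\<Sum>\<^sub>\<infinity>i\<in>I. (norm (y i))\<^sup>2) \<le> (norm x)\<^sup>2"
proof -
  have fin: "(\<Sum>i\<in>F. (norm (y i))\<^sup>2) \<le> (norm x)\<^sup>2" if "finite F" "F \<subseteq> I" for F
    by (rule orth_family_bessel_finite) (use that assms in \<open>auto intro: orth_family_subset[OF assms(1)]\<close>)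
  show s: "(\<lambda>i. (norm (y i))\<^sup>2) summable_on I"
    by (rule nonneg_bdd_above_summable_on) (use fin in \<open>auto intro!: bdd_aboveI\<close>)
  show "(\<Sum>\<^sub>\<infinity>i\<in>I. (norm (y i))\<^sup>2) \<le> (norm x)\<^sup>2"
    by (rule infsum_le_finite_sums[OF s fin])
  show "y summable_on I"
    by (rule summable_on_orth_family[OF assms(1) s])
qed

section \<open>Orthonormal families and Fourier expansions\<close>

definition orthonormal :: "('i \<Rightarrow> 'a::complex_hilbert_space) \<Rightarrow> 'i set \<Rightarrow> bool"
  where "orthonormal u K \<longleftrightarrow> (\<forall>k\<in>K. \<forall>l\<in>K. cinner (u k) (u l) = (if k = l then 1 else 0))"

lemma orthonormal_norm:
  assumes "orthonormal u K" "k \<in> K"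
  shows "norm (u k) = 1"
proof -
  have "of_real ((norm (u k))\<^sup>2) = (1::complex)"
    unfolding cinner_self[symmetric] using assms by (simp add: orthonormal_def)
  then have "(norm (u k))\<^sup>2 = 1"
    by (simp only: of_real_eq_1_iff)
  then show ?thesis
    using norm_ge_zero[of "u k"] by (simp only: power2_eq_1_iff) linarith
qed

lemma orthonormal_subset: "orthonormal u K \<Longrightarrow> L \<subseteq> K \<Longrightarrow> orthonormal u L"
  unfolding orthonormal_def by blast

lemma orthonormal_orth_family:
  assumes "orthonormal u K"
  shows "orth_family (\<lambda>k. c k *\<^sub>C u k) K"
  using assms by (auto simp: orth_family_def orthonormal_def cinner_scaleC_left cinner_scaleC_right)

lemma orthonormal_bessel:
  assumes "orthonormal u K"
  shows "(\<lambda>k. (cmod (cinner (u k) x))\<^sup>2) summable_on K"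
    "(\<lambda>k. cinner (u k) x *\<^sub>C u k) summable_on K"
    "(\<Sum>\<^sub>\<infinity>k\<in>K. (cmod (cinner (u k) x))\<^sup>2) \<le> (norm x)\<^sup>2"
proof -
  have n: "(\<Sum>\<^sub>\<infinity>k\<in>K. (norm (cinner (u k) x *\<^sub>C u k))\<^sup>2) = (\<Sum>\<^sub>\<infinity>k\<in>K. (cmod (cinner (u k) x))\<^sup>2)"
    by (rule infsum_cong) (simp add: norm_scaleC orthonormal_norm[OF assms])
  have n': "(\<lambda>k. (norm (cinner (u k) x *\<^sub>C u k))\<^sup>2) summable_on K \<longleftrightarrow> (\<lambda>k. (cmod (cinner (u k) x))\<^sup>2) summable_on K"
    by (rule summable_on_cong) (simp add: norm_scaleC orthonormal_norm[OF assms])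
  have o: "cinner (cinner (u k) x *\<^sub>C u k) (x - cinner (u k) x *\<^sub>C u k) = 0" if "k \<in> K" for k
    using assms that by (simp add: cinner_scaleC_left cinner_diff_right cinner_scaleC_right orthonormal_def)
  note b = orth_family_bessel[OF orthonormal_orth_family[OF assms], of "\<lambda>k. cinner (u k) x" x, OF o]
  show "(\<lambda>k. (cmod (cinner (u k) x))\<^sup>2) summable_on K"
    using b(1) by (simp only: n')
  show "(\<lambda>k. cinner (u k) x *\<^sub>C u k) summable_on K"
    by (rule b(2))
  show "(\<Sum>\<^sub>\<infinity>k\<in>K. (cmod (cinner (u k) x))\<^sup>2) \<le> (norm x)\<^sup>2"
    using b(3) by (simp only: n)
qed

lemma has_sum_cinner_orthonormal:
  assumes "orthonormal u K" "((\<lambda>k. c k *\<^sub>C u k) has_sum y) K" "l \<in> K"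
  shows "cinner (u l) y = c l"
proof -
  have "((\<lambda>k. cinner (u l) (c k *\<^sub>C u k)) has_sum cinner (u l) y) K"
    by (rule has_sum_cinner_right[OF assms(2)])
  also have "?this \<longleftrightarrow> ((\<lambda>k. if k = l then c l else 0) has_sum cinner (u l) y) K"
    by (rule has_sum_cong) (use assms in \<open>auto simp: cinner_scaleC_right orthonormal_def\<close>)
  finally have 1: "((\<lambda>k. if k = l then c l else 0) has_sum cinner (u l) y) K" .
  have "((\<lambda>k. if k = l then c l else 0) has_sum c l) K"
    by (rule has_sum_finite_neutralI[of "{l}"]) (use assms(3) in auto)
  with 1 show ?thesis by (rule has_sum_unique)
qed

text \<open>For orthonormal u this is the orthogonal projection of x onto the closed span.\<close>

definition orthonormal_expansion :: "('i \<Rightarrow> 'a::complex_hilbert_space) \<Rightarrow> 'i set \<Rightarrow> 'a \<Rightarrow> 'a"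
  where "orthonormal_expansion u K x = (\<Sum>\<^sub>\<infinity>k\<in>K. cinner (u k) x *\<^sub>C u k)"

lemma has_sum_orthonormal_expansion:
  assumes "orthonormal u K"
  shows "((\<lambda>k. cinner (u k) x *\<^sub>C u k) has_sum orthonormal_expansion u K x) K"
  unfolding orthonormal_expansion_def by (rule has_sum_infsum[OF orthonormal_bessel(2)[OF assms]])

lemma cinner_orthonormal_expansion:
  assumes "orthonormal u K" "l \<in> K"
  shows "cinner (u l) (x - orthonormal_expansion u K x) = 0"
  using has_sum_cinner_orthonormal[OF assms(1) has_sum_orthonormal_expansion[OF assms(1)] assms(2)]
  by (simp add: cinner_diff_right)

subsection \<open>Closed subspaces and orthogonal projections\<close>

definition closed_csubspace :: "'a::complex_hilbert_space set \<Rightarrow> bool"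
  where "closed_csubspace M \<longleftrightarrow> closed M \<and> 0 \<in> M \<and> (\<forall>x\<in>M. \<forall>y\<in>M. x + y \<in> M) \<and> (\<forall>c. \<forall>x\<in>M. c *\<^sub>C x \<in> M)"

lemma closed_csubspaceD:
  assumes "closed_csubspace M"
  shows "closed M" "0 \<in> M" "x \<in> M \<Longrightarrow> y \<in> M \<Longrightarrow> x + y \<in> M" "x \<in> M \<Longrightarrow> c *\<^sub>C x \<in> M"
    "x \<in> M \<Longrightarrow> y \<in> M \<Longrightarrow> x - y \<in> M" "x \<in> M \<Longrightarrow> r *\<^sub>R x \<in> M"
proof -
  show "closed M" "0 \<in> M" "x \<in> M \<Longrightarrow> y \<in> M \<Longrightarrow> x + y \<in> M" "x \<in> M \<Longrightarrow> c *\<^sub>C x \<in> M"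
    using assms by (auto simp: closed_csubspace_def)
  show "x \<in> M \<Longrightarrow> r *\<^sub>R x \<in> M"
    using assms by (auto simp: closed_csubspace_def scaleR_scaleC)
  show "x - y \<in> M" if "x \<in> M" "y \<in> M"
  proof -
    have "x + (-1) *\<^sub>C y \<in> M"
      using assms that by (auto simp: closed_csubspace_def)
    then show ?thesis by (simp add: scaleC_minus_one)
  qed
qed

lemma closed_csubspace_has_sum:
  assumes "closed_csubspace M" "(f has_sum x) I" "\<And>i. i \<in> I \<Longrightarrow> f i \<in> M"
  shows "x \<in> M"
proof -
  have fin: "sum f F \<in> M" if "finite F" "F \<subseteq> I" for F
    using that by (induction F) (simp_all add: closed_csubspaceD(2,3)[OF assms(1)] assms(3))
  show ?thesis
    by (rule Lim_in_closed_set[OF closed_csubspaceD(1)[OF assms(1)] _ _ assms(2)[unfolded has_sum_def]])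
      (auto intro!: eventually_finite_subsets_at_top_weakI fin)
qed

text \<open>Zorn's lemma for the orthonormal subsets of M. A nonzero vector of M orthogonal to a
  maximal one could be normalised and added to it.\<close>

lemma closed_csubspace_orthonormal_exists:
  assumes "closed_csubspace M"
  obtains B where "B \<subseteq> M" "orthonormal (\<lambda>e. e) B" "\<And>x. x \<in> M \<Longrightarrow> (\<And>e. e \<in> B \<Longrightarrow> cinner e x = 0) \<Longrightarrow> x = 0"
proof -
  define S where "S = {B. B \<subseteq> M \<and> orthonormal (\<lambda>e. e) B}"
  have "\<exists>B\<in>S. \<forall>X\<in>S. B \<subseteq> X \<longrightarrow> X = B"
  proof (rule subset_Zorn)
    fix C assume C: "subset.chain S C"
    have "orthonormal (\<lambda>e. e) (\<Union>C)"
      unfolding orthonormal_def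
    proof (intro ballI)
      fix e f assume "e \<in> \<Union>C" "f \<in> \<Union>C"
      then obtain X Y where XY: "X \<in> C" "e \<in> X" "Y \<in> C" "f \<in> Y" by blast
      then have "X \<subseteq> Y \<or> Y \<subseteq> X" "X \<in> S" "Y \<in> S"
        using C unfolding subset.chain_def by auto
      then show "cinner e f = (if e = f then 1 else 0)"
        using XY unfolding S_def orthonormal_def by blast
    qed
    moreover have "\<Union>C \<subseteq> M"
      using C unfolding subset.chain_def S_def by blast
    ultimately show "\<exists>U\<in>S. \<forall>X\<in>C. X \<subseteq> U"
      unfolding S_def by blast
  qed
  then obtain B where B: "B \<subseteq> M" "orthonormal (\<lambda>e. e) B"
    and max: "\<And>X. X \<subseteq> M \<Longrightarrow> orthonormal (\<lambda>e. e) X \<Longrightarrow> B \<subseteq> X \<Longrightarrow> X = B"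
    unfolding S_def by auto
  have "x = 0" if x: "x \<in> M" "\<And>e. e \<in> B \<Longrightarrow> cinner e x = 0" for x
  proof (rule ccontr)
    assume "x \<noteq> 0"
    define y where "y = (1 / norm x) *\<^sub>R x"
    have "y \<in> M"
      unfolding y_def by (rule closed_csubspaceD(6)[OF assms x(1)])
    have yy: "cinner y y = 1"
      unfolding cinner_self using \<open>x \<noteq> 0\<close> by (simp add: y_def)
    have ey: "cinner e y = 0" if "e \<in> B" for e
      using x(2)[OF that] by (simp add: y_def cinner_scaleR_right)
    then have "cinner y e = 0" if "e \<in> B" for e
      using that by (metis cinner_commute complex_cnj_zero)
    then have "orthonormal (\<lambda>e. e) (insert y B)"
      using B(2) yy ey unfolding orthonormal_def by auto
    then have "y \<in> B"
      using max[of "insert y B"] B(1) \<open>y \<in> M\<close> by blast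
    then show False using ey[of y] yy by simp
  qed
  then show ?thesis using that B by blast
qed

text \<open>The projection is the Fourier expansion in a maximal orthonormal subset of M. Every z in
  M has such an expansion itself, so orthogonality to the basis vectors passes to z.\<close>

lemma orth_proj_exists:
  assumes "closed_csubspace M"
  shows "\<exists>y. y \<in> M \<and> (\<forall>z\<in>M. cinner z (x - y) = 0)"
proof -
  obtain B where B: "B \<subseteq> M" "orthonormal (\<lambda>e. e) B"
    "\<And>x. x \<in> M \<Longrightarrow> (\<And>e. e \<in> B \<Longrightarrow> cinner e x = 0) \<Longrightarrow> x = 0"
    using closed_csubspace_orthonormal_exists[OF assms] by metis
  define y where "y = orthonormal_expansion (\<lambda>e. e) B x"
  have expM: "orthonormal_expansion (\<lambda>e. e) B w \<in> M" for w
    by (rule closed_csubspace_has_sum[OF assms has_sum_orthonormal_expansion[OF B(2)]])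
      (use B(1) closed_csubspaceD(4)[OF assms] in auto)
  have "cinner z (x - y) = 0" if "z \<in> M" for z
  proof -
    have "z - orthonormal_expansion (\<lambda>e. e) B z = 0"
      by (rule B(3)) (use closed_csubspaceD(5)[OF assms that expM]
          cinner_orthonormal_expansion[OF B(2)] in auto)
    then have "((\<lambda>e. cinner e z *\<^sub>C e) has_sum z) B"
      using has_sum_orthonormal_expansion[OF B(2), of z] by simp
    then have "((\<lambda>e. cinner (cinner e z *\<^sub>C e) (x - y)) has_sum cinner z (x - y)) B"
      by (rule has_sum_cinner_left)
    moreover have "((\<lambda>e. cinner (cinner e z *\<^sub>C e) (x - y)) has_sum 0) B"
      unfolding y_def using cinner_orthonormal_expansion[OF B(2)]
      by (intro has_sum_0) (simp add: cinner_scaleC_left)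
    ultimately show ?thesis by (rule has_sum_unique)
  qed
  then show ?thesis using expM[of x] y_def by blast
qed

lemma orth_proj_unique:
  assumes "closed_csubspace M" "y \<in> M" "\<And>z. z \<in> M \<Longrightarrow> cinner z (x - y) = 0"
  shows "orth_proj M x = y"
  unfolding orth_proj_def
proof (rule the_equality)
  fix w assume w: "w \<in> M \<and> (\<forall>z\<in>M. cinner z (x - w) = 0)"
  then have "w - y \<in> M" using closed_csubspaceD(5)[OF assms(1)] assms(2) by blast
  then have "cinner (w - y) (x - y) - cinner (w - y) (x - w) = 0"
    using assms(3) w by simp
  then have "cinner (w - y) (w - y) = 0"
    by (simp add: cinner_diff_right)
  then show "w = y" by simp
qed (use assms in auto)

lemma orth_proj:
  assumes "closed_csubspace M"
  shows orth_proj_in: "orth_proj M x \<in> M"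
    and cinner_orth_proj: "z \<in> M \<Longrightarrow> cinner z (x - orth_proj M x) = 0"
  using orth_proj_exists[OF assms, of x] orth_proj_unique[OF assms] by metis+

lemma cinner_orth_proj_left:
  assumes "closed_csubspace M" "z \<in> M"
  shows "cinner z (orth_proj M x) = cinner z x" "cinner (orth_proj M x) z = cinner x z"
proof -
  show "cinner z (orth_proj M x) = cinner z x"
    using cinner_orth_proj[OF assms, of x] by (simp add: cinner_diff_right)
  then show "cinner (orth_proj M x) z = cinner x z"
    by (metis cinner_commute)
qed

lemma orth_proj_symmetric:
  assumes "closed_csubspace M"
  shows "cinner (orth_proj M x) y = cinner x (orth_proj M y)"
  using cinner_orth_proj_left[OF assms orth_proj_in[OF assms]] by metis

lemma cinner_orth_proj_self:
  assumes "closed_csubspace M"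
  shows "cinner x (orth_proj M x) = of_real ((norm (orth_proj M x))\<^sup>2)"
    "cinner (orth_proj M x) x = of_real ((norm (orth_proj M x))\<^sup>2)"
  using cinner_orth_proj_left[OF assms orth_proj_in[OF assms], of x x] by (auto simp: cinner_self)

lemma orth_proj_add:
  assumes "closed_csubspace M"
  shows "orth_proj M (x + y) = orth_proj M x + orth_proj M y"
proof (rule orth_proj_unique[OF assms])
  fix z assume "z \<in> M"
  then show "cinner z (x + y - (orth_proj M x + orth_proj M y)) = 0"
    by (simp add: cinner_diff_right cinner_add_right cinner_orth_proj_left[OF assms])
qed (simp add: closed_csubspaceD[OF assms] orth_proj_in[OF assms])

lemma orth_proj_scaleC:
  assumes "closed_csubspace M"
  shows "orth_proj M (c *\<^sub>C x) = c *\<^sub>C orth_proj M x"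
proof (rule orth_proj_unique[OF assms])
  fix z assume "z \<in> M"
  then show "cinner z (c *\<^sub>C x - c *\<^sub>C orth_proj M x) = 0"
    by (simp add: cinner_diff_right cinner_scaleC_right cinner_orth_proj_left[OF assms])
qed (simp add: closed_csubspaceD[OF assms] orth_proj_in[OF assms])

lemma closed_csubspace_UNIV: "closed_csubspace (UNIV :: 'a::complex_hilbert_space set)"
  by (simp add: closed_csubspace_def)

section \<open>Orthonormal bases and Parseval's identity\<close>

lemma orthonormal_basis_iff:
  "orthonormal_basis B \<longleftrightarrow> orthonormal (\<lambda>e. e) B \<and> (\<forall>x. (\<forall>e\<in>B. cinner e x = 0) \<longrightarrow> x = 0)"
proof -
  have "norm e = 1 \<longleftrightarrow> cinner e e = 1" for e :: 'a
    unfolding cinner_self of_real_eq_1_iff power2_eq_1_iff using norm_ge_zero[of e] by linarith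
  then show ?thesis
    unfolding orthonormal_basis_def orthonormal_def by auto
qed

lemma orthonormal_basis_exists: "\<exists>B. orthonormal_basis (B :: 'a::complex_hilbert_space set)"
  using closed_csubspace_orthonormal_exists[OF closed_csubspace_UNIV] orthonormal_basis_iff
  by (metis UNIV_I)

lemma orthonormal_basis_some: "orthonormal_basis (SOME B. orthonormal_basis (B :: 'a::complex_hilbert_space set))"
  by (rule someI_ex[OF orthonormal_basis_exists])

lemma orthonormal_basis_expansion:
  assumes "orthonormal_basis B"
  shows "((\<lambda>e. cinner e x *\<^sub>C e) has_sum x) B"
proof -
  have o: "orthonormal (\<lambda>e. e) B" using assms orthonormal_basis_iff by blast
  have "x - orthonormal_expansion (\<lambda>e. e) B x = 0"
    using assms cinner_orthonormal_expansion[OF o] unfolding orthonormal_basis_iff by blast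
  then show ?thesis using has_sum_orthonormal_expansion[OF o, of x] by simp
qed

lemma parseval:
  assumes "orthonormal_basis B"
  shows "((\<lambda>e. (cmod (cinner e x))\<^sup>2) has_sum (norm x)\<^sup>2) B"
proof -
  have o: "orthonormal (\<lambda>e. e) B" using assms orthonormal_basis_iff by blast
  have "((\<lambda>e. (norm (cinner e x *\<^sub>C e))\<^sup>2) has_sum (norm x)\<^sup>2) B"
    by (rule has_sum_norm_orth_family[OF orthonormal_orth_family[OF o] orthonormal_basis_expansion[OF assms]])
  also have "?this \<longleftrightarrow> ?thesis"
    by (rule has_sum_cong) (simp add: norm_scaleC orthonormal_norm[OF o])
  finally show ?thesis .
qed

subsection \<open>Sums of extended nonnegative reals\<close>

text \<open>Sums in \<open>ennreal\<close> are suprema of finite partial sums; for this reason the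
  rules below, in particular the interchange of iterated sums, carry no summability
  conditions.\<close>

lemma infsum_ennreal_SUP:
  "infsum f A = (SUP F\<in>{F. finite F \<and> F \<subseteq> A}. sum f F)" for f :: "'i \<Rightarrow> ennreal"
  by (rule nonneg_infsum_complete) simp

lemma sum_le_infsum_ennreal:
  fixes f :: "'i \<Rightarrow> ennreal"
  shows "finite F \<Longrightarrow> F \<subseteq> A \<Longrightarrow> sum f F \<le> infsum f A"
  unfolding infsum_ennreal_SUP by (rule SUP_upper) simp

lemma infsum_ennreal_le:
  fixes f :: "'i \<Rightarrow> ennreal"
  assumes "\<And>F. finite F \<Longrightarrow> F \<subseteq> A \<Longrightarrow> sum f F \<le> c"
  shows "infsum f A \<le> c"
  unfolding infsum_ennreal_SUP by (rule SUP_least) (use assms in simp)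

lemma infsum_mono_ennreal:
  fixes f g :: "'i \<Rightarrow> ennreal"
  assumes "\<And>i. i \<in> A \<Longrightarrow> f i \<le> g i"
  shows "infsum f A \<le> infsum g A"
  by (rule infsum_mono) (use assms in \<open>auto intro: nonneg_summable_on_complete\<close>)

lemma infsum_add_ennreal: "(\<Sum>\<^sub>\<infinity>i\<in>A. f i + g i) = infsum f A + infsum g A" for f :: "'i \<Rightarrow> ennreal"
  by (rule infsum_add) (auto intro: nonneg_summable_on_complete)

lemma infsum_sum_ennreal:
  fixes f :: "'i \<Rightarrow> 'j \<Rightarrow> ennreal"
  assumes "finite F"
  shows "(\<Sum>i\<in>F. \<Sum>\<^sub>\<infinity>j\<in>B. f i j) = (\<Sum>\<^sub>\<infinity>j\<in>B. \<Sum>i\<in>F. f i j)"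
  using assms by induction (simp_all add: infsum_add_ennreal)

lemma infsum_swap_ennreal:
  fixes f :: "'i \<Rightarrow> 'j \<Rightarrow> ennreal"
  shows "(\<Sum>\<^sub>\<infinity>i\<in>A. \<Sum>\<^sub>\<infinity>j\<in>B. f i j) = (\<Sum>\<^sub>\<infinity>j\<in>B. \<Sum>\<^sub>\<infinity>i\<in>A. f i j)"
proof -
  have *: "(\<Sum>\<^sub>\<infinity>i\<in>A. \<Sum>\<^sub>\<infinity>j\<in>B. f i j) \<le> (\<Sum>\<^sub>\<infinity>j\<in>B. \<Sum>\<^sub>\<infinity>i\<in>A. f i j)"
    for A :: "'k set" and B :: "'l set" and f :: "'k \<Rightarrow> 'l \<Rightarrow> ennreal"
    by (rule infsum_ennreal_le) (auto simp: infsum_sum_ennreal intro!: infsum_mono_ennreal sum_le_infsum_ennreal)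
  show ?thesis by (intro antisym *)
qed

lemma infsum_cmult_ennreal: "(\<Sum>\<^sub>\<infinity>i\<in>A. c * f i) = c * infsum f A" for f :: "'i \<Rightarrow> ennreal"
  unfolding infsum_ennreal_SUP sum_distrib_left[symmetric] by (rule SUP_mult_left_ennreal[symmetric])

lemma infsum_single_ennreal:
  fixes v :: ennreal
  assumes "a \<in> A"
  shows "(\<Sum>\<^sub>\<infinity>i\<in>A. if i = a then v else 0) = v"
  by (rule infsumI, rule has_sum_finite_neutralI[of "{a}"]) (use assms in auto)

lemma has_sum_ennreal:
  assumes "(f has_sum S) A" "\<And>i. i \<in> A \<Longrightarrow> f i \<ge> 0"
  shows "(\<Sum>\<^sub>\<infinity>i\<in>A. ennreal (f i)) = ennreal S"
proof (rule infsumI)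
  have "((\<lambda>F. ennreal (sum f F)) \<longlongrightarrow> ennreal S) (finite_subsets_at_top A)"
    using assms(1) unfolding has_sum_def by (rule tendsto_ennrealI)
  moreover have "\<forall>\<^sub>F F in finite_subsets_at_top A. ennreal (sum f F) = (\<Sum>i\<in>F. ennreal (f i))"
    by (rule eventually_finite_subsets_at_top_weakI) (use assms(2) in \<open>auto simp: subset_iff\<close>)
  ultimately show "((\<lambda>i. ennreal (f i)) has_sum ennreal S) A"
    unfolding has_sum_def using tendsto_cong by fastforce
qed

lemma summable_on_infsum_ennreal_finite:
  fixes f :: "'i \<Rightarrow> real"
  assumes "(\<Sum>\<^sub>\<infinity>i\<in>A. ennreal (f i)) < \<infinity>" "\<And>i. i \<in> A \<Longrightarrow> f i \<ge> 0"
  shows "f summable_on A"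
proof -
  obtain r where r: "r \<ge> 0" "(\<Sum>\<^sub>\<infinity>i\<in>A. ennreal (f i)) = ennreal r"
    using assms(1) by (cases "\<Sum>\<^sub>\<infinity>i\<in>A. ennreal (f i)") auto
  have "sum f F \<le> r" if "finite F" "F \<subseteq> A" for F
  proof -
    have "ennreal (sum f F) = (\<Sum>i\<in>F. ennreal (f i))"
      by (rule sum_ennreal[symmetric]) (use that assms(2) in auto)
    also have "\<dots> \<le> ennreal r"
      unfolding r(2)[symmetric] by (rule sum_le_infsum_ennreal[OF that])
    finally show ?thesis using r(1) by simp
  qed
  then show ?thesis
    by (intro nonneg_bdd_above_summable_on) (use assms(2) in \<open>auto intro!: bdd_aboveI\<close>)
qed

subsection \<open>The trace of a positive operator\<close>

text \<open>Parseval's identity in the basis fixed by \<open>op_trace\<close> evaluates the rank-one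
  contribution. The hypotheses speak of quadratic forms, the only data on which the trace
  depends.\<close>

lemma op_trace_ketbra_add:
  assumes "\<And>x. Re (cinner x (A x)) = Re (cinner x (A' x)) + (cmod (cinner v x))\<^sup>2"
    and "\<And>x. Re (cinner x (A' x)) \<ge> 0"
  shows "op_trace A = op_trace A' + ennreal ((norm v)\<^sup>2)"
proof -
  let ?B = "SOME B. orthonormal_basis (B :: 'a set)"
  have "(\<Sum>\<^sub>\<infinity>e\<in>?B. ennreal ((cmod (cinner v e))\<^sup>2)) = ennreal ((norm v)\<^sup>2)"
    unfolding cmod_cinner_commute[of v] by (rule has_sum_ennreal[OF parseval[OF orthonormal_basis_some]]) simp
  then show ?thesis
    unfolding op_trace_def using assms by (simp add: ennreal_plus infsum_add_ennreal)
qed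

text \<open>Subtracting rank-one parts one at a time makes the square root of \<open>A\<close> unnecessary in the
  comparison of diagonal sums with the trace.\<close>

lemma positive_op_deflate:
  assumes "positive_op A"
  obtains v where "positive_op (\<lambda>x. A x - cinner v x *\<^sub>C v)" "A u = cinner v u *\<^sub>C v"
proof -
  note b = bounded_opD[OF positive_opD(1)[OF assms]]
  define p where "p = Re (cinner u (A u))"
  have p: "p \<ge> 0" "cinner u (A u) = of_real p"
    using positive_opD(2,4)[OF assms, of u] by (auto simp: p_def)
  \<comment> \<open>The rank-one part of A that reproduces \<open>A u\<close>. If p = 0, then
    \<open>1 / sqrt p = 0\<close> gives v = 0, which fits because Cauchy-Schwarz forces
    \<open>A u = 0\<close>.\<close>
  define v where "v = (1 / sqrt p) *\<^sub>R A u"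
  have cs: "(cmod (cinner y (A u)))\<^sup>2 \<le> p * Re (cinner y (A y))" for y
    using positive_op_cauchy_schwarz[OF assms, of y u] by (simp add: p_def)
  have vx: "(cmod (cinner v x))\<^sup>2 \<le> Re (cinner x (A x))" for x
  proof (cases "p = 0")
    case True then show ?thesis using positive_opD(2)[OF assms] by (simp add: v_def)
  next
    case False
    have "(cmod (cinner v x))\<^sup>2 = (cmod (cinner x (A u)))\<^sup>2 / p"
      unfolding v_def cinner_scaleR_left using p(1) cmod_cinner_commute[of x "A u"]
      by (simp add: norm_mult power_mult_distrib power_divide norm_divide)
    also have "\<dots> \<le> p * Re (cinner x (A x)) / p"
      by (intro divide_right_mono cs p)
    finally show ?thesis using False by simp
  qed
  have "positive_op (\<lambda>x. A x - cinner v x *\<^sub>C v)"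
    unfolding positive_op_def
  proof (intro conjI allI)
    have "bounded_linear (\<lambda>x. cinner v x *\<^sub>C v)"
    proof (rule bounded_linear_intro[where K = "norm v * norm v"])
      show "norm (cinner v x *\<^sub>C v) \<le> norm x * (norm v * norm v)" for x
        using mult_right_mono[OF cinner_bound[of v x] norm_ge_zero[of v]] by (simp add: norm_scaleC algebra_simps)
    qed (auto simp: cinner_add_right scaleC_add_left cinner_scaleC_right scaleR_scaleC scaleC_scaleC)
    then have "bounded_linear (\<lambda>x. A x - cinner v x *\<^sub>C v)"
      by (rule bounded_linear_sub[OF b(1)])
    moreover have "A (c *\<^sub>C x) - cinner v (c *\<^sub>C x) *\<^sub>C v = c *\<^sub>C (A x - cinner v x *\<^sub>C v)" for c x
      by (simp add: b(4) cinner_scaleC_right scaleC_scaleC scaleC_diff_right)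
    ultimately show "bounded_op (\<lambda>x. A x - cinner v x *\<^sub>C v)"
      by (simp add: bounded_op_def)
    fix x
    have "cinner x (A x - cinner v x *\<^sub>C v) = of_real (Re (cinner x (A x)) - (cmod (cinner v x))\<^sup>2)"
      using positive_opD(4)[OF assms, of x] cinner_cnj_mult[of v x]
      by (simp add: cinner_diff_right cinner_scaleC_right)
    then show "cinner x (A x - cinner v x *\<^sub>C v) \<in> \<real>\<^sub>\<ge>\<^sub>0"
      using vx[of x] by (simp add: complex_nonneg_Reals_iff)
  qed
  moreover have "A u = cinner v u *\<^sub>C v"
  proof (cases "p = 0")
    case True
    then have "A u = 0"
      using cs[of "A u"] by (simp add: cinner_self)
    then show ?thesis by (simp add: v_def)
  next
    case False
    have "cinner v u = of_real (1 / sqrt p * p)"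
      unfolding v_def cinner_scaleR_left using positive_op_symmetric[OF assms, of u u] p by simp
    also have "1 / sqrt p * p = sqrt p"
      using p(1) by (simp add: real_div_sqrt)
    finally have "cinner v u = of_real (sqrt p)" .
    then have "cinner v u *\<^sub>C v = sqrt p *\<^sub>R v"
      by (simp add: scaleR_scaleC)
    then show ?thesis
      using False p(1) by (simp add: v_def)
  qed
  ultimately show ?thesis using that by blast
qed

text \<open>Induction on F for all A. Deflating at \<open>u l\<close> makes the entry at l vanish,
  and the other entries fall under the induction hypothesis for the deflated operator. The removed
  part contributes at most \<open>(norm v)\<^sup>2\<close> to the diagonal, by Bessel, but exactly
  that much to the trace.\<close>

lemma sum_le_op_trace:
  assumes "positive_op A" "orthonormal u F" "finite F"
  shows "ennreal (\<Sum>k\<in>F. Re (cinner (u k) (A (u k)))) \<le> op_trace A"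
  using assms(3,1,2)
proof (induction F arbitrary: A)
  case (insert l F)
  obtain v where v: "positive_op (\<lambda>x. A x - cinner v x *\<^sub>C v)" "A (u l) = cinner v (u l) *\<^sub>C v"
    using positive_op_deflate[OF insert.prems(1)] by metis
  let ?A = "\<lambda>x. A x - cinner v x *\<^sub>C v"
  have split: "Re (cinner x (A x)) = Re (cinner x (?A x)) + (cmod (cinner v x))\<^sup>2" for x
    using cinner_cnj_mult[of v x] by (simp add: cinner_diff_right cinner_scaleC_right)
  have "(\<Sum>k\<in>insert l F. Re (cinner (u k) (A (u k)))) =
      (\<Sum>k\<in>insert l F. Re (cinner (u k) (?A (u k)))) + (\<Sum>k\<in>insert l F. (cmod (cinner v (u k)))\<^sup>2)"
    unfolding sum.distrib[symmetric] by (rule sum.cong[OF refl split])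
  also have "(\<Sum>k\<in>insert l F. Re (cinner (u k) (?A (u k)))) = (\<Sum>k\<in>F. Re (cinner (u k) (?A (u k))))"
    using insert.hyps v(2) by simp
  also have "(\<Sum>k\<in>insert l F. (cmod (cinner v (u k)))\<^sup>2) \<le> (norm v)\<^sup>2"
    using orthonormal_bessel(3)[OF insert.prems(2), of v] insert.hyps
    by (simp add: cmod_cinner_commute[of v])
  finally have "ennreal (\<Sum>k\<in>insert l F. Re (cinner (u k) (A (u k)))) \<le>
      ennreal ((\<Sum>k\<in>F. Re (cinner (u k) (?A (u k)))) + (norm v)\<^sup>2)"
    by (simp add: ennreal_leI)
  also have "\<dots> = ennreal (\<Sum>k\<in>F. Re (cinner (u k) (?A (u k)))) + ennreal ((norm v)\<^sup>2)"
    by (intro ennreal_plus sum_nonneg positive_opD(2)[OF v(1)]) simp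
  also have "\<dots> \<le> op_trace ?A + ennreal ((norm v)\<^sup>2)"
    by (intro add_right_mono insert.IH v(1) orthonormal_subset[OF insert.prems(2)]) auto
  also have "\<dots> = op_trace A"
    by (rule op_trace_ketbra_add[symmetric, OF split positive_opD(2)[OF v(1)]])
  finally show ?case .
qed simp

subsection \<open>Eigenspaces of self-adjoint operators\<close>

lemma self_adjointD:
  assumes "self_adjoint D A"
  shows "closure D = UNIV" "x \<in> D \<Longrightarrow> y \<in> D \<Longrightarrow> x + y \<in> D" "x \<in> D \<Longrightarrow> c *\<^sub>C x \<in> D"
    "x \<in> D \<Longrightarrow> y \<in> D \<Longrightarrow> A (x + y) = A x + A y" "x \<in> D \<Longrightarrow> A (c *\<^sub>C x) = c *\<^sub>C A x"
    "(\<forall>x\<in>D. cinner (A x) y = cinner x z) \<longleftrightarrow> y \<in> D \<and> z = A y"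
  using assms unfolding self_adjoint_def by blast+

lemma self_adjoint_symmetric:
  assumes "self_adjoint D A" "x \<in> D" "y \<in> D"
  shows "cinner (A x) y = cinner x (A y)"
  using self_adjointD(6)[OF assms(1)] assms by blast

lemma self_adjoint_zero:
  assumes "self_adjoint D A"
  shows "0 \<in> D" "A 0 = 0"
  using self_adjointD(6)[OF assms, of 0 0] by simp_all

lemma self_adjoint_positive_op:
  assumes "positive_op A"
  shows "self_adjoint UNIV A"
proof -
  have "z = A y" if "\<And>x. cinner (A x) y = cinner x z" for y z
  proof -
    have "cinner (A y - z) (A y - z) = 0"
      using that[of "A y - z"] positive_op_symmetric[OF assms] by (simp add: cinner_diff_right)
    then show ?thesis by simp
  qed
  then show ?thesis
    unfolding self_adjoint_def
    using positive_op_symmetric[OF assms] bounded_opD[OF positive_opD(1)[OF assms]] by auto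
qed

lemma eigenspace_iff: "x \<in> eigenspace D A g \<longleftrightarrow> x \<in> D \<and> A x = g *\<^sub>C x"
  by (simp add: eigenspace_def)

text \<open>A is possibly unbounded, so limits cannot be taken through A itself. They are taken
  through inner products with vectors of D, and the adjoint condition in \<open>self_adjoint\<close>
  puts the limit into D.\<close>

lemma closed_csubspace_eigenspace:
  assumes "self_adjoint D A"
  shows "closed_csubspace (eigenspace D A g)"
  unfolding closed_csubspace_def
proof (intro conjI ballI allI)
  show "closed (eigenspace D A g)"
    unfolding closed_sequential_limits
  proof (intro allI impI)
    fix s l assume s: "(\<forall>n. s n \<in> eigenspace D A g) \<and> s \<longlonglongrightarrow> l"
    have "cinner (A x) l = cinner x (g *\<^sub>C l)" if "x \<in> D" for x
    proof (rule LIMSEQ_unique)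
      show "(\<lambda>n. cinner (A x) (s n)) \<longlonglongrightarrow> cinner (A x) l"
        using s by (intro tendsto_cinner_right) simp
      have "cinner (A x) (s n) = cinner x (g *\<^sub>C s n)" for n
        using s self_adjoint_symmetric[OF assms that, of "s n"] by (simp add: eigenspace_iff)
      moreover have "(\<lambda>n. cinner x (g *\<^sub>C s n)) \<longlonglongrightarrow> cinner x (g *\<^sub>C l)"
        using s by (intro tendsto_cinner_right bounded_linear.tendsto[OF bounded_linear_scaleC_right]) simp
      ultimately show "(\<lambda>n. cinner (A x) (s n)) \<longlonglongrightarrow> cinner x (g *\<^sub>C l)"
        by simp
    qed
    then show "l \<in> eigenspace D A g"
      using self_adjointD(6)[OF assms, of l "g *\<^sub>C l"] by (simp add: eigenspace_iff)
  qed
qed (use assms in \<open>auto simp: eigenspace_iff self_adjoint_zero self_adjointD(2-5) scaleC_add_right scaleC_scaleC mult.commute\<close>)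

lemma eigenvalue_real:
  assumes "self_adjoint D A" "g \<in> eigenvalues D A"
  shows "Im g = 0" "cnj g = g" "of_real (Re g) = g"
proof -
  obtain x where x: "x \<in> D" "A x = g *\<^sub>C x" "x \<noteq> 0"
    using assms(2) by (auto simp: eigenvalues_def eigenspace_iff)
  then have "cnj g * cinner x x = g * cinner x x"
    using self_adjoint_symmetric[OF assms(1) x(1) x(1)] by (simp add: cinner_scaleC_left cinner_scaleC_right)
  then show "cnj g = g" using x(3) by simp
  then show "Im g = 0" "of_real (Re g) = g" by (auto simp: complex_eq_iff)
qed

lemma eigenspace_orthogonal:
  assumes "self_adjoint D A" "x \<in> eigenspace D A g" "y \<in> eigenspace D A h" "g \<noteq> h"
  shows "cinner x y = 0"
proof (cases "x = 0")
  case False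
  then have "cnj g = g"
    using eigenvalue_real[OF assms(1), of g] assms(2) by (auto simp: eigenvalues_def)
  then have "g * cinner x y = h * cinner x y"
    using self_adjoint_symmetric[OF assms(1), of x y] assms(2,3)
    by (simp add: eigenspace_iff cinner_scaleC_left cinner_scaleC_right)
  then show ?thesis using assms(4) by simp
qed simp

lemma eigenproj_in:
  assumes "self_adjoint D A"
  shows "eigenproj D A g x \<in> eigenspace D A g"
  unfolding eigenproj_def by (rule orth_proj_in[OF closed_csubspace_eigenspace[OF assms]])

lemma eigenproj_eigenspace:
  assumes "self_adjoint D A" "x \<in> eigenspace D A h"
  shows "eigenproj D A g x = (if g = h then x else 0)"
  unfolding eigenproj_def
proof (rule orth_proj_unique[OF closed_csubspace_eigenspace[OF assms(1)]])
  show "(if g = h then x else 0) \<in> eigenspace D A g"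
    using assms closed_csubspaceD(2)[OF closed_csubspace_eigenspace[OF assms(1)]] by auto
  show "cinner z (x - (if g = h then x else 0)) = 0" if "z \<in> eigenspace D A g" for z
    using eigenspace_orthogonal[OF assms(1) that assms(2)] by auto
qed

lemma orth_family_eigenproj:
  assumes "self_adjoint D A"
  shows "orth_family (\<lambda>g. f g *\<^sub>R eigenproj D A g x) I"
  unfolding orth_family_def
  using eigenspace_orthogonal[OF assms eigenproj_in[OF assms] eigenproj_in[OF assms]]
  by (simp add: cinner_scaleR_left cinner_scaleR_right)

lemma summable_on_norm_eigenproj:
  assumes "self_adjoint D A"
  shows "(\<lambda>g. (norm (eigenproj D A g x))\<^sup>2) summable_on I"
    "(\<Sum>\<^sub>\<infinity>g\<in>I. (norm (eigenproj D A g x))\<^sup>2) \<le> (norm x)\<^sup>2"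
proof -
  have o: "orth_family (\<lambda>g. eigenproj D A g x) I"
    using orth_family_eigenproj[OF assms, of "\<lambda>_. 1"] by simp
  have c: "cinner (eigenproj D A g x) (x - eigenproj D A g x) = 0" for g
    unfolding eigenproj_def
    by (intro cinner_orth_proj closed_csubspace_eigenspace[OF assms] orth_proj_in)
  show "(\<lambda>g. (norm (eigenproj D A g x))\<^sup>2) summable_on I"
    "(\<Sum>\<^sub>\<infinity>g\<in>I. (norm (eigenproj D A g x))\<^sup>2) \<le> (norm x)\<^sup>2"
    using orth_family_bessel[OF o, of x] c by auto
qed

lemma eigenvalue_nonneg:
  assumes "positive_op A" "g \<in> eigenvalues UNIV A"
  shows "Re g \<ge> 0"
proof -
  obtain x where x: "A x = g *\<^sub>C x" "x \<noteq> 0"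
    using assms(2) by (auto simp: eigenvalues_def eigenspace_iff)
  then have "0 \<le> Re g * (norm x)\<^sup>2"
    using positive_opD(2)[OF assms(1), of x] by (simp add: cinner_scaleC_right cinner_self)
  then show ?thesis using x(2) by (simp add: zero_le_mult_iff)
qed

subsection \<open>Positive operators with finite trace have discrete spectrum\<close>

text \<open>A Minkowski sum of compact discs, built one dimension at a time. It supplies the finite
  nets for the total boundedness argument below.\<close>

lemma compact_coordinate_box:
  fixes F :: "'a::complex_hilbert_space set"
  assumes "finite F"
  shows "compact {(\<Sum>e\<in>F. c e *\<^sub>C e) |c. \<forall>e. cmod (c e) \<le> R}"
  using assms
proof induction
  case empty
  have "{(\<Sum>e\<in>{}. c e *\<^sub>C e) |c. \<forall>e. cmod (c e) \<le> R} \<subseteq> {0::'a}" by auto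
  then show ?case by (meson finite.emptyI finite_insert finite_imp_compact finite_subset)
next
  case (insert f F)
  let ?S = "{(\<Sum>e\<in>F. c e *\<^sub>C e) |c. \<forall>e. cmod (c e) \<le> R}"
  let ?T = "(\<lambda>z. z *\<^sub>C f) ` cball 0 R"
  have bl: "bounded_linear (\<lambda>z. z *\<^sub>C f)"
    by (rule bounded_linear_intro[where K = "norm f"])
      (auto simp: scaleC_add_left norm_scaleC scaleR_scaleC scaleC_scaleC scaleR_conv_of_real scaleC_complex_def)
  have "compact ?T"
    by (intro compact_continuous_image linear_continuous_on bl compact_cball)
  from compact_sums[OF this insert.IH]
  have c: "compact {x + y |x y. x \<in> ?T \<and> y \<in> ?S}" .
  have "{(\<Sum>e\<in>insert f F. c e *\<^sub>C e) |c. \<forall>e. cmod (c e) \<le> R} = {x + y |x y. x \<in> ?T \<and> y \<in> ?S}"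
  proof (intro equalityI subsetI)
    fix x assume "x \<in> {(\<Sum>e\<in>insert f F. c e *\<^sub>C e) |c. \<forall>e. cmod (c e) \<le> R}"
    then obtain c where "x = c f *\<^sub>C f + (\<Sum>e\<in>F. c e *\<^sub>C e)" "\<forall>e. cmod (c e) \<le> R"
      using insert.hyps by auto
    then show "x \<in> {x + y |x y. x \<in> ?T \<and> y \<in> ?S}"
      by (intro CollectI exI[of _ "c f *\<^sub>C f"] exI[of _ "\<Sum>e\<in>F. c e *\<^sub>C e"]) auto
  next
    fix x assume "x \<in> {x + y |x y. x \<in> ?T \<and> y \<in> ?S}"
    then obtain z c where zc: "x = z *\<^sub>C f + (\<Sum>e\<in>F. c e *\<^sub>C e)" "cmod z \<le> R" "\<forall>e. cmod (c e) \<le> R"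
      by auto
    have "(\<Sum>e\<in>F. (c(f := z)) e *\<^sub>C e) = (\<Sum>e\<in>F. c e *\<^sub>C e)"
      by (rule sum.cong) (use insert.hyps in auto)
    then have "x = (\<Sum>e\<in>insert f F. (c(f := z)) e *\<^sub>C e)"
      using zc insert.hyps by simp
    then show "x \<in> {(\<Sum>e\<in>insert f F. c e *\<^sub>C e) |c. \<forall>e. cmod (c e) \<le> R}"
      using zc by (intro CollectI exI[of _ "c(f := z)"]) auto
  qed
  then show ?case using c by simp
qed

text \<open>Cauchy-Schwarz for the form of \<open>A\<close> gives \<open>\<bar>\<langle>e, A x\<rangle>\<bar>\<^sup>2 \<le> \<langle>e, A e\<rangle> \<langle>x, A x\<rangle>\<close>, so the image of the
  unit ball lies in a Hilbert cube with summable squared side lengths.\<close>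

lemma positive_op_trace_compact:
  fixes A :: "'a::complex_hilbert_space \<Rightarrow> 'a"
  assumes "positive_op A" "op_trace A < \<infinity>"
  shows "compact (closure (A ` cball 0 1))"
proof -
  note b = bounded_opD[OF positive_opD(1)[OF assms(1)]]
  define B :: "'a set" where "B = (SOME B. orthonormal_basis B)"
  have B: "orthonormal_basis B" unfolding B_def by (rule orthonormal_basis_some)
  then have oB: "orthonormal (\<lambda>e. e) B" using orthonormal_basis_iff by blast
  define a where "a e = Re (cinner e (A e))" for e
  have a0: "a e \<ge> 0" for e unfolding a_def by (rule positive_opD(2)[OF assms(1)])
  have "a summable_on B"
    by (rule summable_on_infsum_ennreal_finite)
      (use assms(2) a0 in \<open>auto simp: op_trace_def B_def a_def\<close>)
  obtain K where K: "K > 0" "\<And>x. norm (A x) \<le> norm x * K"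
    using bounded_linear.pos_bounded[OF b(1)] by blast
  have quad: "a x \<le> K" if "norm x \<le> 1" for x
  proof -
    have "a x \<le> cmod (cinner x (A x))" unfolding a_def by (rule complex_Re_le_cmod)
    also have "\<dots> \<le> norm x * norm (A x)" by (rule cinner_bound)
    also have "\<dots> \<le> 1 * (1 * K)"
      using K(2)[of x] that K(1) by (intro mult_mono order_trans[OF K(2)]) auto
    finally show ?thesis by simp
  qed
  have "\<exists>k. finite k \<and> A ` cball 0 1 \<subseteq> (\<Union>x\<in>k. ball x \<epsilon>)" if "\<epsilon> > 0" for \<epsilon>
  proof -
    \<comment> \<open>Chosen so that \<open>K * \<delta>\<close> is half of
      \<open>(\<epsilon> / 2)\<^sup>2\<close>: dropping the coordinates outside F then moves
      \<open>A x\<close> by less than \<open>\<epsilon> / 2\<close>.\<close>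
    define \<delta> where "\<delta> = (\<epsilon> / 2)\<^sup>2 / (2 * K)"
    have "\<delta> > 0" using K(1) that by (simp add: \<delta>_def)
    then obtain F where F: "finite F" "F \<subseteq> B" "dist (sum a F) (infsum a B) \<le> \<delta>"
      using infsum_finite_approximation[OF \<open>a summable_on B\<close>] by blast
    have tail: "infsum a (B - F) \<le> \<delta>"
    proof -
      have "infsum a (B - F) = infsum a B - infsum a F"
        by (rule infsum_Diff[OF \<open>a summable_on B\<close>]) (use F in auto)
      then show ?thesis using F by (simp add: dist_real_def)
    qed
    let ?S = "{(\<Sum>e\<in>F. c e *\<^sub>C e) |c. \<forall>e. cmod (c e) \<le> K}"
    obtain k where k: "finite k" "?S \<subseteq> (\<Union>x\<in>k. ball x (\<epsilon> / 2))"
      using compact_coordinate_box[OF F(1), of K, unfolded compact_eq_totally_bounded] half_gt_zero[OF \<open>\<epsilon> > 0\<close>] by blast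
    have "A x \<in> (\<Union>z\<in>k. ball z \<epsilon>)" if x: "norm x \<le> 1" for x
    proof -
      define y where "y = A x"
      \<comment> \<open>The box bounds the coefficients at all e, also outside F, hence the value 0
        there.\<close>
      define c where "c e = (if e \<in> F then cinner e y else 0)" for e
      have "cmod (c e) \<le> K" for e
      proof (cases "e \<in> F")
        case True
        have "cmod (cinner e y) \<le> norm e * norm y" by (rule cinner_bound)
        also have "\<dots> = norm y"
          using orthonormal_norm[OF oB, of e] True F(2) by auto
        also have "\<dots> \<le> 1 * K"
          unfolding y_def by (rule order_trans[OF K(2)], rule mult_right_mono) (use x K(1) in auto)
        finally show ?thesis using True by (simp add: c_def)
      qed (use K(1) in \<open>simp add: c_def\<close>)
      then have "(\<Sum>e\<in>F. c e *\<^sub>C e) \<in> ?S" by blast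
      then obtain z where z: "z \<in> k" "dist z (\<Sum>e\<in>F. c e *\<^sub>C e) < \<epsilon> / 2"
        using k(2) by force
      have "((\<lambda>e. cinner e y *\<^sub>C e) has_sum (y - (\<Sum>e\<in>F. cinner e y *\<^sub>C e))) (B - F)"
        by (rule has_sum_Diff[OF orthonormal_basis_expansion[OF B]]) (use F in auto)
      from has_sum_norm_orth_family[OF orthonormal_orth_family[OF orthonormal_subset[OF oB]] this]
      have "((\<lambda>e. (norm (cinner e y *\<^sub>C e))\<^sup>2) has_sum (norm (y - (\<Sum>e\<in>F. cinner e y *\<^sub>C e)))\<^sup>2) (B - F)"
        by blast
      moreover have "((\<lambda>e. K * a e) has_sum K * infsum a (B - F)) (B - F)"
        by (intro has_sum_cmult_right has_sum_infsum summable_on_subset_banach[OF \<open>a summable_on B\<close>]) auto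
      moreover have "(norm (cinner e y *\<^sub>C e))\<^sup>2 \<le> K * a e" if "e \<in> B - F" for e
      proof -
        have "(norm (cinner e y *\<^sub>C e))\<^sup>2 = (cmod (cinner e (A x)))\<^sup>2"
          using orthonormal_norm[OF oB, of e] that by (simp add: norm_scaleC y_def)
        also have "\<dots> \<le> a x * a e"
          unfolding a_def by (rule positive_op_cauchy_schwarz[OF assms(1)])
        also have "\<dots> \<le> K * a e"
          by (intro mult_right_mono quad x a0)
        finally show ?thesis .
      qed
      ultimately have "(norm (y - (\<Sum>e\<in>F. cinner e y *\<^sub>C e)))\<^sup>2 \<le> K * infsum a (B - F)"
        by (rule has_sum_mono)
      also have "\<dots> \<le> K * \<delta>" using tail K(1) by simp
      also have "\<dots> < (\<epsilon> / 2)\<^sup>2"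
        using K(1) \<open>\<epsilon> > 0\<close> by (simp add: \<delta>_def)
      finally have "norm (y - (\<Sum>e\<in>F. cinner e y *\<^sub>C e)) < \<epsilon> / 2"
        by (rule power_less_imp_less_base) (use \<open>\<epsilon> > 0\<close> in simp)
      moreover have "(\<Sum>e\<in>F. cinner e y *\<^sub>C e) = (\<Sum>e\<in>F. c e *\<^sub>C e)"
        by (rule sum.cong) (auto simp: c_def)
      ultimately have "dist z y < \<epsilon>"
        using z(2) dist_triangle_half_l[of z "\<Sum>e\<in>F. c e *\<^sub>C e" \<epsilon> y] by (simp add: dist_norm norm_minus_commute)
      then show ?thesis using z(1) by (auto simp: y_def)
    qed
    then show ?thesis using k(1) by auto
  qed
  note tb = this
  have "\<exists>k. finite k \<and> closure (A ` cball 0 1) \<subseteq> (\<Union>x\<in>k. ball x \<epsilon>)" if e: "\<epsilon> > 0" for \<epsilon>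
  proof -
    obtain k where k: "finite k" "A ` cball 0 1 \<subseteq> (\<Union>x\<in>k. ball x (\<epsilon> / 2))"
      using tb[OF half_gt_zero[OF e]] by blast
    have "closure (A ` cball 0 1) \<subseteq> (\<Union>x\<in>k. cball x (\<epsilon> / 2))"
    proof (rule closure_minimal)
      have "(\<Union>x\<in>k. ball x (\<epsilon> / 2)) \<subseteq> (\<Union>x\<in>k. cball x (\<epsilon> / 2))"
        by (intro UN_mono order_refl ball_subset_cball)
      with k(2) show "A ` cball 0 1 \<subseteq> (\<Union>x\<in>k. cball x (\<epsilon> / 2))" by (rule order_trans)
      show "closed (\<Union>x\<in>k. cball x (\<epsilon> / 2))" using k(1) by (intro closed_UN) auto
    qed
    also have "\<dots> \<subseteq> (\<Union>x\<in>k. ball x \<epsilon>)" using e by (intro UN_mono) auto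
    finally show ?thesis using k(1) by blast
  qed
  then show ?thesis
    unfolding compact_eq_totally_bounded by (auto simp: complete_eq_closed)
qed

text \<open>The supremum m of the quadratic form on the unit sphere of M is attained: almost maximal
  vectors are almost eigenvectors for m, and compactness of A supplies a convergent subsequence. If
  \<open>A w = 0\<close>, then w itself serves; otherwise m > 0.\<close>

lemma positive_op_eigenvector_exists:
  fixes A :: "'a::complex_hilbert_space \<Rightarrow> 'a"
  assumes "positive_op A" "op_trace A < \<infinity>" "closed_csubspace M" "\<And>x. x \<in> M \<Longrightarrow> A x \<in> M"
    "w \<in> M" "w \<noteq> 0"
  obtains c x where "x \<in> M" "x \<noteq> 0" "A x = c *\<^sub>C x"
proof (cases "A w = 0")
  case True
  then show ?thesis using that[of w 0] assms by simp
next
  case False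
  note b = bounded_opD[OF positive_opD(1)[OF assms(1)]]
  define q where "q x = Re (cinner x (A x))" for x
  have q0: "q x \<ge> 0" for x unfolding q_def by (rule positive_opD(2)[OF assms(1)])
  have q_scale: "q (r *\<^sub>R x) = r\<^sup>2 * q x" for r x
    by (simp add: q_def b(5) cinner_scaleR_left cinner_scaleR_right power2_eq_square)
  obtain K where K: "K > 0" "\<And>x. norm (A x) \<le> norm x * K"
    using bounded_linear.pos_bounded[OF b(1)] by blast
  define S where "S = {x \<in> M. norm x = 1}"
  have qK: "q x \<le> K" if "x \<in> S" for x
  proof -
    have "q x \<le> cmod (cinner x (A x))" unfolding q_def by (rule complex_Re_le_cmod)
    also have "\<dots> \<le> norm x * norm (A x)" by (rule cinner_bound)
    also have "\<dots> \<le> K" using K(2)[of x] that by (simp add: S_def)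
    finally show ?thesis .
  qed
  then have bdd: "bdd_above (q ` S)" by (auto intro!: bdd_aboveI)
  define m where "m = (SUP x\<in>S. q x)"
  have q_le: "q x \<le> m * (norm x)\<^sup>2" if "x \<in> M" for x
  proof (cases "x = 0")
    case False
    have "(1 / norm x) *\<^sub>R x \<in> S"
      using False closed_csubspaceD(6)[OF assms(3) that] by (simp add: S_def)
    then have "q ((1 / norm x) *\<^sub>R x) \<le> m"
      unfolding m_def by (rule cSUP_upper[OF _ bdd])
    then show ?thesis using False by (simp add: q_scale field_simps)
  qed (simp add: q_def)
  have "q w > 0"
  proof -
    have "(cmod (cinner (A w) (A w)))\<^sup>2 \<le> q w * q (A w)"
      unfolding q_def by (rule positive_op_cauchy_schwarz[OF assms(1)])
    moreover have "cmod (cinner (A w) (A w)) > 0" using False by simp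
    ultimately have "q w \<noteq> 0" by auto
    then show ?thesis using q0[of w] by simp
  qed
  then have "m > 0"
    using q_le[OF assms(5)] by (metis less_le_trans zero_less_mult_pos2 assms(6) zero_less_norm_iff zero_less_power)
  have "S \<noteq> {}"
    using assms(5,6) closed_csubspaceD(6)[OF assms(3,5), of "1 / norm w"] by (auto simp: S_def)
  have "\<exists>x\<in>S. m - 1 / real (Suc n) < q x" for n
    using less_cSUP_iff[OF \<open>S \<noteq> {}\<close> bdd, of "m - 1 / real (Suc n)"] by (simp add: m_def)
  then obtain s where s: "\<And>n. s n \<in> S" "\<And>n. m - 1 / real (Suc n) < q (s n)" by metis
  \<comment> \<open>Cauchy-Schwarz for the form, applied to x and \<open>A x\<close>, gives
    \<open>(norm (A x))\<^sup>2 \<le> m * q x\<close>; the rest is the expansion of the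
    square.\<close>
  have est: "(norm (A x - m *\<^sub>R x))\<^sup>2 \<le> m * (m - q x)" if "x \<in> S" for x
  proof -
    have xM: "x \<in> M" "norm x = 1" using that by (auto simp: S_def)
    have "(norm (A x))\<^sup>2 \<le> m * q x"
    proof (cases "A x = 0")
      case False
      have "cmod (cinner (A x) (A x)) = (norm (A x))\<^sup>2"
        unfolding cinner_self norm_of_real by simp
      then have "((norm (A x))\<^sup>2)\<^sup>2 \<le> q x * q (A x)"
        using positive_op_cauchy_schwarz[OF assms(1), of "A x" x] unfolding q_def by (simp only:)
      also have "\<dots> \<le> q x * (m * (norm (A x))\<^sup>2)"
        by (intro mult_left_mono q_le assms(4) xM q0)
      finally have "(norm (A x))\<^sup>2 * (norm (A x))\<^sup>2 \<le> (m * q x) * (norm (A x))\<^sup>2"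
        by (simp add: power2_eq_square mult_ac)
      then show ?thesis
        by (rule mult_right_le_imp_le) (use False in simp)
    qed (use \<open>m > 0\<close> q0 in simp)
    then have "(norm (A x))\<^sup>2 - 2 * (m * q x) + m\<^sup>2 \<le> m * (m - q x)"
      by (simp add: power2_eq_square algebra_simps)
    moreover have "(norm (A x - m *\<^sub>R x))\<^sup>2 = (norm (A x))\<^sup>2 - 2 * (m * q x) + m\<^sup>2"
      unfolding norm_diff_sq using xM positive_op_symmetric[OF assms(1), of x x]
      by (simp add: cinner_scaleR_right q_def power_mult_distrib)
    ultimately show ?thesis by simp
  qed
  have lim0: "(\<lambda>n. A (s n) - m *\<^sub>R s n) \<longlonglongrightarrow> 0"
  proof (rule tendsto_norm_zero_cancel, rule tendsto_sandwich[OF _ _ tendsto_const])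
    show "\<forall>\<^sub>F n in sequentially. norm (A (s n) - m *\<^sub>R s n) \<le> sqrt (m * (1 / real (Suc n)))"
    proof (intro always_eventually allI real_le_rsqrt)
      fix n
      have "m * (m - q (s n)) \<le> m * (1 / real (Suc n))"
        using s(2)[of n] \<open>m > 0\<close> by (intro mult_left_mono) auto
      with est[OF s(1), of n] show "(norm (A (s n) - m *\<^sub>R s n))\<^sup>2 \<le> m * (1 / real (Suc n))" by linarith
    qed
    have "(\<lambda>n. sqrt (m * (1 / real (Suc n)))) \<longlonglongrightarrow> sqrt (m * 0)"
      by (intro tendsto_intros lim_1_over_n[THEN LIMSEQ_Suc])
    then show "(\<lambda>n. sqrt (m * (1 / real (Suc n)))) \<longlonglongrightarrow> 0" by simp
  qed (auto intro!: always_eventually)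
  \<comment> \<open>Compactness only makes \<open>A (s (r n))\<close> converge. Since
    \<open>A (s n) - m *\<^sub>R s n\<close> tends to 0 and m > 0, the vectors
    \<open>s (r n)\<close> then converge too.\<close>
  have "A (s n) \<in> closure (A ` cball 0 1)" for n
    using s(1)[of n] closure_subset by (force simp: S_def)
  then obtain z r where "strict_mono r" "((\<lambda>n. A (s n)) \<circ> r) \<longlonglongrightarrow> z"
    by (rule seq_compactE[OF compact_imp_seq_compact[OF positive_op_trace_compact[OF assms(1,2)]], rule_format])
  then have zr: "strict_mono r" "(\<lambda>n. A (s (r n))) \<longlonglongrightarrow> z" by (simp_all add: o_def)
  define x where "x = (1 / m) *\<^sub>R z"
  have "(\<lambda>n. (1 / m) *\<^sub>R (A (s (r n)) - (A (s (r n)) - m *\<^sub>R s (r n)))) \<longlonglongrightarrow> (1 / m) *\<^sub>R (z - 0)"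
    using LIMSEQ_subseq_LIMSEQ[OF lim0 zr(1)] zr(2) by (intro tendsto_intros) (auto simp: o_def)
  then have sx: "(\<lambda>n. s (r n)) \<longlonglongrightarrow> x"
    using \<open>m > 0\<close> by (simp add: x_def)
  have "x \<in> M"
    by (rule closed_sequentially[OF closed_csubspaceD(1)[OF assms(3)] _ sx]) (use s(1) S_def in auto)
  moreover have "norm x = 1"
  proof (rule LIMSEQ_unique[OF tendsto_norm[OF sx]])
    show "(\<lambda>n. norm (s (r n))) \<longlonglongrightarrow> 1" using s(1) by (simp add: S_def)
  qed
  moreover have "A x = z"
    by (rule LIMSEQ_unique[OF bounded_linear.tendsto[OF b(1) sx] zr(2)])
  then have "A x = of_real m *\<^sub>C x"
    using \<open>m > 0\<close> by (simp add: x_def scaleR_scaleC[symmetric])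
  ultimately show ?thesis using that[of x "of_real m"] by (metis norm_zero zero_neq_one)
qed

text \<open>The orthogonal complement M of all eigenvectors is closed and invariant. A nonzero
  vector in M would yield an eigenvector inside M, which is orthogonal to itself.\<close>

theorem positive_op_discrete_spectrum:
  fixes A :: "'a::complex_hilbert_space \<Rightarrow> 'a"
  assumes "positive_op A" "op_trace A < \<infinity>"
  shows "discrete_spectrum UNIV A"
proof -
  note b = bounded_opD[OF positive_opD(1)[OF assms(1)]]
  note sa = self_adjoint_positive_op[OF assms(1)]
  let ?E = "eigenvalues UNIV A" and ?P = "eigenproj UNIV A"
  define M where "M = {x. \<forall>g. \<forall>z\<in>eigenspace UNIV A g. cinner z x = 0}"
  have "closed_csubspace M"
    unfolding closed_csubspace_def
  proof (intro conjI)
    have "M = (\<Inter>g. \<Inter>z\<in>eigenspace UNIV A g. {x. cinner z x = 0})" by (auto simp: M_def)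
    moreover have "closed {x. cinner z x = 0}" for z :: 'a
      by (intro closed_Collect_eq linear_continuous_on bounded_linear_cinner_right continuous_on_const)
    ultimately show "closed M" by (simp add: closed_INT)
  qed (auto simp: M_def cinner_add_right cinner_scaleC_right)
  have AM: "A x \<in> M" if "x \<in> M" for x
  proof -
    have "cinner z (A x) = 0" if "A z = g *\<^sub>C z" for z g
    proof -
      have "cinner z (A x) = cnj g * cinner z x"
        using positive_op_symmetric[OF assms(1), of z x] that by (simp add: cinner_scaleC_left)
      moreover have "cinner z x = 0"
        using \<open>x \<in> M\<close> that by (auto simp: M_def eigenspace_iff)
      ultimately show ?thesis by simp
    qed
    then show ?thesis by (simp add: M_def eigenspace_iff)
  qed
  have "x = 0" if xM: "x \<in> M" for x
  proof (rule ccontr)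
    assume "x \<noteq> 0"
    obtain c y where "y \<in> M" "y \<noteq> 0" "A y = c *\<^sub>C y"
      by (rule positive_op_eigenvector_exists[OF assms \<open>closed_csubspace M\<close> AM xM \<open>x \<noteq> 0\<close>])
    then show False by (metis (mono_tags, lifting) M_def UNIV_I cinner_self_eq_0 eigenspace_iff mem_Collect_eq)
  qed
  \<comment> \<open>Bessel makes the projections summable to some y; x - y is orthogonal to every
    eigenvector, so it lies in M and vanishes.\<close>
  have sum: "((\<lambda>g. ?P g x) has_sum x) ?E" for x
  proof -
    have o: "orth_family (\<lambda>g. ?P g x) ?E"
      using orth_family_eigenproj[OF sa, of "\<lambda>_. 1"] by simp
    then have "(\<lambda>g. ?P g x) summable_on ?E"
      using summable_on_orth_family summable_on_norm_eigenproj(1)[OF sa] by blast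
    then obtain y where y: "((\<lambda>g. ?P g x) has_sum y) ?E"
      by (auto simp: summable_on_def)
    have "cinner z (x - y) = 0" if z: "z \<in> eigenspace UNIV A g" for z g
    proof (cases "z = 0")
      case False
      then have g: "g \<in> ?E" using z by (auto simp: eigenvalues_def)
      have "((\<lambda>h. cinner z (?P h x)) has_sum cinner z y) ?E"
        by (rule has_sum_cinner_right[OF y])
      moreover have "((\<lambda>h. cinner z (?P h x)) has_sum cinner z (?P g x)) ?E"
      proof (rule has_sum_finite_neutralI[of "{g}"])
        show "cinner z (?P h x) = 0" if "h \<in> ?E - {g}" for h
          by (rule eigenspace_orthogonal[OF sa z eigenproj_in[OF sa]]) (use that in auto)
      qed (use g in auto)
      ultimately have "cinner z y = cinner z (?P g x)" by (rule has_sum_unique)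
      also have "\<dots> = cinner z x"
        unfolding eigenproj_def by (rule cinner_orth_proj_left[OF closed_csubspace_eigenspace[OF sa] z])
      finally show ?thesis by (simp add: cinner_diff_right)
    qed simp
    then have "x - y \<in> M" by (simp add: M_def)
    then have "x = y" using \<open>\<And>x. x \<in> M \<Longrightarrow> x = 0\<close> by (metis right_minus_eq)
    then show ?thesis using y by simp
  qed
  have "((\<lambda>g. g *\<^sub>C ?P g x) has_sum A x) ?E" for x
  proof -
    have "((\<lambda>g. A (?P g x)) has_sum A x) ?E"
      by (rule has_sum_bounded_linear[OF b(1) sum])
    moreover have "A (?P g x) = g *\<^sub>C ?P g x" for g
      using eigenproj_in[OF sa, of g x] by (simp add: eigenspace_iff)
    ultimately show ?thesis by simp
  qed
  with sum show ?thesis unfolding discrete_spectrum_def by blast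
qed

subsection \<open>Functional calculus\<close>

text \<open>The terms are pairwise orthogonal, so their summability is equivalent to that of the
  squared norms.\<close>

lemma op_fun_dom_iff:
  assumes "positive_op A"
  shows "x \<in> op_fun_dom f A \<longleftrightarrow>
    (\<lambda>g. (f (Re g))\<^sup>2 * (norm (eigenproj UNIV A g x))\<^sup>2) summable_on eigenvalues UNIV A"
proof -
  note o = orth_family_eigenproj[OF self_adjoint_positive_op[OF assms], of "\<lambda>g. f (Re g)" x "eigenvalues UNIV A"]
  have "(\<lambda>g. (norm (f (Re g) *\<^sub>R eigenproj UNIV A g x))\<^sup>2) summable_on eigenvalues UNIV A \<longleftrightarrow>
    (\<lambda>g. f (Re g) *\<^sub>R eigenproj UNIV A g x) summable_on eigenvalues UNIV A"
    using summable_on_orth_family[OF o] has_sum_norm_orth_family[OF o] unfolding summable_on_def by blast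
  then show ?thesis
    by (simp add: op_fun_dom_def power_mult_distrib)
qed

lemma op_fun_dom_bounded:
  assumes "positive_op A" "\<And>g. g \<in> eigenvalues UNIV A \<Longrightarrow> \<bar>f (Re g)\<bar> \<le> C"
  shows "x \<in> op_fun_dom f A"
  unfolding op_fun_dom_iff[OF assms(1)]
proof (rule summable_on_comparison_test)
  show "(\<lambda>g. C\<^sup>2 * (norm (eigenproj UNIV A g x))\<^sup>2) summable_on eigenvalues UNIV A"
    by (intro summable_on_cmult_right summable_on_norm_eigenproj self_adjoint_positive_op assms)
  show "(f (Re g))\<^sup>2 * (norm (eigenproj UNIV A g x))\<^sup>2 \<le> C\<^sup>2 * (norm (eigenproj UNIV A g x))\<^sup>2"
    if "g \<in> eigenvalues UNIV A" for g
    using power_mono[OF assms(2)[OF that] abs_ge_zero, of 2] by (intro mult_right_mono) simp_all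
qed auto

lemma has_sum_op_fun:
  assumes "x \<in> op_fun_dom f A"
  shows "((\<lambda>g. f (Re g) *\<^sub>R eigenproj UNIV A g x) has_sum op_fun f A x) (eigenvalues UNIV A)"
  using assms unfolding op_fun_dom_def op_fun_def by simp

lemma has_sum_norm_op_fun:
  assumes "positive_op A" "x \<in> op_fun_dom f A"
  shows "((\<lambda>g. (f (Re g))\<^sup>2 * (norm (eigenproj UNIV A g x))\<^sup>2) has_sum (norm (op_fun f A x))\<^sup>2)
    (eigenvalues UNIV A)"
  using has_sum_norm_orth_family[OF orth_family_eigenproj[OF self_adjoint_positive_op[OF assms(1)]] has_sum_op_fun[OF assms(2)]]
  by (simp add: power_mult_distrib)

lemma has_sum_cinner_op_fun:
  assumes "positive_op A" "x \<in> op_fun_dom f A"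
  shows "((\<lambda>g. f (Re g) * (norm (eigenproj UNIV A g x))\<^sup>2) has_sum Re (cinner x (op_fun f A x)))
    (eigenvalues UNIV A)"
proof -
  have "((\<lambda>g. cinner x (f (Re g) *\<^sub>R eigenproj UNIV A g x)) has_sum cinner x (op_fun f A x)) (eigenvalues UNIV A)"
    by (rule has_sum_cinner_right[OF has_sum_op_fun[OF assms(2)]])
  then show ?thesis
    using has_sum_Re cinner_orth_proj_self[OF closed_csubspace_eigenspace[OF self_adjoint_positive_op[OF assms(1)]]]
    by (fastforce simp: cinner_scaleR_right eigenproj_def)
qed

lemma op_fun_symmetric:
  assumes "positive_op A" "x \<in> op_fun_dom f A" "y \<in> op_fun_dom f A"
  shows "cinner (op_fun f A x) y = cinner x (op_fun f A y)"
proof -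
  have "((\<lambda>g. cinner (f (Re g) *\<^sub>R eigenproj UNIV A g x) y) has_sum cinner (op_fun f A x) y) (eigenvalues UNIV A)"
    by (rule has_sum_cinner_left[OF has_sum_op_fun[OF assms(2)]])
  moreover have "((\<lambda>g. cinner x (f (Re g) *\<^sub>R eigenproj UNIV A g y)) has_sum cinner x (op_fun f A y)) (eigenvalues UNIV A)"
    by (rule has_sum_cinner_right[OF has_sum_op_fun[OF assms(3)]])
  moreover have "cinner (f (Re g) *\<^sub>R eigenproj UNIV A g x) y = cinner x (f (Re g) *\<^sub>R eigenproj UNIV A g y)" for g
    using orth_proj_symmetric[OF closed_csubspace_eigenspace[OF self_adjoint_positive_op[OF assms(1)]]]
    by (simp add: cinner_scaleR_right cinner_scaleR_left eigenproj_def)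
  ultimately show ?thesis
    using has_sum_unique by simp
qed

lemma op_fun_eigenvector:
  assumes "positive_op A" "x \<in> eigenspace UNIV A g" "g \<in> eigenvalues UNIV A"
  shows "x \<in> op_fun_dom f A" "op_fun f A x = f (Re g) *\<^sub>R x"
proof -
  have "((\<lambda>h. f (Re h) *\<^sub>R eigenproj UNIV A h x) has_sum f (Re g) *\<^sub>R x) (eigenvalues UNIV A)"
    by (rule has_sum_finite_neutralI[of "{g}"])
      (use assms in \<open>auto simp: eigenproj_eigenspace[OF self_adjoint_positive_op[OF assms(1)] assms(2)]\<close>)
  then show "x \<in> op_fun_dom f A" "op_fun f A x = f (Re g) *\<^sub>R x"
    unfolding op_fun_dom_def op_fun_def by (auto simp: summable_on_def infsumI)
qed

subsection \<open>Diagonal operators\<close>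

text \<open>The operator sum q_k |u_k><u_k|. The pinched state, the optimal states and all |v><v|
  are brought into this form.\<close>

definition diag_op :: "('i \<Rightarrow> 'a::complex_hilbert_space) \<Rightarrow> ('i \<Rightarrow> real) \<Rightarrow> 'i set \<Rightarrow> 'a \<Rightarrow> 'a"
  where "diag_op u q K x = (\<Sum>\<^sub>\<infinity>k\<in>K. (of_real (q k) * cinner (u k) x) *\<^sub>C u k)"

text \<open>Positivity of \<open>q\<close> separates the \<open>u k\<close> from the kernel. Values
  of \<open>q\<close> may repeat, so an eigenspace can be spanned by many \<open>u k\<close>. The
  bound C makes the series converge and the operator bounded.\<close>

locale diagonal =
  fixes u :: "'i \<Rightarrow> 'a::complex_hilbert_space" and q :: "'i \<Rightarrow> real" and K :: "'i set" and C :: real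
  assumes on: "orthonormal u K" and q_pos: "\<And>k. k \<in> K \<Longrightarrow> q k > 0" and q_le: "\<And>k. k \<in> K \<Longrightarrow> q k \<le> C"
begin

abbreviation "T \<equiv> diag_op u q K"

lemma q_nonneg: "k \<in> K \<Longrightarrow> q k \<ge> 0"
  using q_pos by force

lemma norm_term:
  assumes "k \<in> K"
  shows "(norm ((of_real (q k) * cinner (u k) x) *\<^sub>C u k))\<^sup>2 = (q k)\<^sup>2 * (cmod (cinner (u k) x))\<^sup>2"
  using orthonormal_norm[OF on assms] by (simp add: norm_scaleC norm_mult power_mult_distrib)

lemma term_le:
  assumes "k \<in> K"
  shows "(q k)\<^sup>2 * (cmod (cinner (u k) x))\<^sup>2 \<le> C\<^sup>2 * (cmod (cinner (u k) x))\<^sup>2"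
  using q_pos[OF assms] q_le[OF assms] by (intro mult_right_mono power_mono) auto

lemma has_sum_diag_op: "((\<lambda>k. (of_real (q k) * cinner (u k) x) *\<^sub>C u k) has_sum T x) K"
proof -
  have "(\<lambda>k. (norm ((of_real (q k) * cinner (u k) x) *\<^sub>C u k))\<^sup>2) summable_on K"
  proof (rule summable_on_comparison_test)
    show "(\<lambda>k. C\<^sup>2 * (cmod (cinner (u k) x))\<^sup>2) summable_on K"
      by (intro summable_on_cmult_right orthonormal_bessel(1)[OF on])
  qed (auto simp: norm_term term_le)
  then have "(\<lambda>k. (of_real (q k) * cinner (u k) x) *\<^sub>C u k) summable_on K"
    by (rule summable_on_orth_family[OF orthonormal_orth_family[OF on]])
  then show ?thesis unfolding diag_op_def by (rule has_sum_infsum)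
qed

lemma cinner_diag_op:
  assumes "k \<in> K"
  shows "cinner (u k) (T x) = of_real (q k) * cinner (u k) x"
  by (rule has_sum_cinner_orthonormal[OF on has_sum_diag_op assms])

lemma norm_diag_op_le: "norm (T x) \<le> norm x * \<bar>C\<bar>"
proof -
  have "((\<lambda>k. (q k)\<^sup>2 * (cmod (cinner (u k) x))\<^sup>2) has_sum (norm (T x))\<^sup>2) K"
    using has_sum_norm_orth_family[OF orthonormal_orth_family[OF on] has_sum_diag_op]
    by (subst (asm) has_sum_cong[OF norm_term])
  moreover have "((\<lambda>k. C\<^sup>2 * (cmod (cinner (u k) x))\<^sup>2) has_sum C\<^sup>2 * (\<Sum>\<^sub>\<infinity>k\<in>K. (cmod (cinner (u k) x))\<^sup>2)) K"
    by (intro has_sum_cmult_right has_sum_infsum orthonormal_bessel(1)[OF on])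
  ultimately have "(norm (T x))\<^sup>2 \<le> C\<^sup>2 * (\<Sum>\<^sub>\<infinity>k\<in>K. (cmod (cinner (u k) x))\<^sup>2)"
    by (rule has_sum_mono) (rule term_le)
  also have "\<dots> \<le> C\<^sup>2 * (norm x)\<^sup>2"
    by (intro mult_left_mono orthonormal_bessel(3)[OF on]) simp
  also have "\<dots> = (norm x * \<bar>C\<bar>)\<^sup>2" by (simp add: power_mult_distrib)
  finally show ?thesis by (simp add: power2_le_iff_abs_le)
qed

lemma bounded_op_diag_op: "bounded_op T"
proof -
  have add: "T (x + y) = T x + T y" for x y
  proof (rule has_sum_unique[OF has_sum_diag_op])
    show "((\<lambda>k. (of_real (q k) * cinner (u k) (x + y)) *\<^sub>C u k) has_sum T x + T y) K"
      using has_sum_add[OF has_sum_diag_op[of x] has_sum_diag_op[of y]]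
      by (simp add: cinner_add_right distrib_left scaleC_add_left)
  qed
  have scale: "T (c *\<^sub>C x) = c *\<^sub>C T x" for c x
  proof (rule has_sum_unique[OF has_sum_diag_op])
    show "((\<lambda>k. (of_real (q k) * cinner (u k) (c *\<^sub>C x)) *\<^sub>C u k) has_sum c *\<^sub>C T x) K"
      using has_sum_scaleC[OF has_sum_diag_op[of x], of c]
      by (simp add: cinner_scaleC_right scaleC_scaleC mult_ac)
  qed
  have "bounded_linear T"
    by (rule bounded_linear_intro[OF add _ norm_diag_op_le]) (simp add: scaleR_scaleC scale)
  then show ?thesis using scale by (simp add: bounded_op_def)
qed

lemma has_sum_cinner_diag_op:
  "((\<lambda>k. of_real (q k) * cinner x (u k) * cinner (u k) y) has_sum cinner x (T y)) K"
  using has_sum_cinner_right[OF has_sum_diag_op, of x y]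
  by (simp add: cinner_scaleC_right mult_ac)

lemma has_sum_quadratic_diag_op:
  "((\<lambda>k. q k * (cmod (cinner (u k) x))\<^sup>2) has_sum Re (cinner x (T x))) K"
  using has_sum_Re[OF has_sum_cinner_diag_op[of x x]]
  by (simp add: mult.assoc cinner_cnj_mult cmod_cinner_commute)

lemma positive_op_diag_op: "positive_op T"
  unfolding positive_op_def
proof (intro conjI allI bounded_op_diag_op)
  fix x
  have "((\<lambda>k. of_real (q k * (cmod (cinner (u k) x))\<^sup>2)) has_sum cinner x (T x)) K"
    using has_sum_cinner_diag_op[of x x]
    by (simp add: mult.assoc cinner_cnj_mult cmod_cinner_commute)
  moreover have "((\<lambda>k. of_real (q k * (cmod (cinner (u k) x))\<^sup>2)) has_sum complex_of_real (Re (cinner x (T x)))) K"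
    by (rule has_sum_of_real[OF has_sum_quadratic_diag_op])
  ultimately have "cinner x (T x) = of_real (Re (cinner x (T x)))"
    by (rule has_sum_unique)
  moreover have "Re (cinner x (T x)) \<ge> 0"
    by (rule has_sum_nonneg[OF has_sum_quadratic_diag_op]) (simp add: q_nonneg)
  ultimately show "cinner x (T x) \<in> \<real>\<^sub>\<ge>\<^sub>0"
    by (metis nonneg_Reals_of_real_iff)
qed

text \<open>After the interchange of the sums, Parseval turns the inner sum into the squared norm of
  \<open>u k\<close>, which is 1.\<close>

lemma infsum_basis_fourier:
  assumes "\<And>k. k \<in> K \<Longrightarrow> w k \<ge> 0"
  shows "(\<Sum>\<^sub>\<infinity>e\<in>(SOME B. orthonormal_basis (B :: 'a set)). \<Sum>\<^sub>\<infinity>k\<in>K. ennreal (w k * (cmod (cinner (u k) e))\<^sup>2))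
    = (\<Sum>\<^sub>\<infinity>k\<in>K. ennreal (w k))"
proof (subst infsum_swap_ennreal, rule infsum_cong)
  fix k assume k: "k \<in> K"
  have "((\<lambda>e. w k * (cmod (cinner (u k) e))\<^sup>2) has_sum w k * (norm (u k))\<^sup>2) (SOME B. orthonormal_basis (B :: 'a set))"
    unfolding cmod_cinner_commute[of "u k"]
    by (intro has_sum_cmult_right parseval orthonormal_basis_some)
  from has_sum_ennreal[OF this]
  show "(\<Sum>\<^sub>\<infinity>e\<in>(SOME B. orthonormal_basis (B :: 'a set)). ennreal (w k * (cmod (cinner (u k) e))\<^sup>2)) = ennreal (w k)"
    using assms[OF k] orthonormal_norm[OF on k] by simp
qed

lemma op_trace_diag_op: "op_trace T = (\<Sum>\<^sub>\<infinity>k\<in>K. ennreal (q k))"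
proof -
  have "ennreal (Re (cinner e (T e))) = (\<Sum>\<^sub>\<infinity>k\<in>K. ennreal (q k * (cmod (cinner (u k) e))\<^sup>2))" for e
    by (rule has_sum_ennreal[OF has_sum_quadratic_diag_op, symmetric]) (simp add: q_nonneg)
  then show ?thesis
    unfolding op_trace_def using infsum_basis_fourier[of q] q_nonneg by simp
qed

lemma diag_op_u:
  assumes "k \<in> K"
  shows "T (u k) = of_real (q k) *\<^sub>C u k"
proof (rule has_sum_unique[OF has_sum_diag_op])
  show "((\<lambda>l. (of_real (q l) * cinner (u l) (u k)) *\<^sub>C u l) has_sum of_real (q k) *\<^sub>C u k) K"
    by (rule has_sum_finite_neutralI[of "{k}"]) (use on assms in \<open>auto simp: orthonormal_def\<close>)
qed

lemma diag_eigenvalue: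
  assumes "k \<in> K"
  shows "of_real (q k) \<in> eigenvalues UNIV T"
proof -
  have "u k \<noteq> 0" using orthonormal_norm[OF on assms] by auto
  then show ?thesis
    unfolding eigenvalues_def using diag_op_u[OF assms] by (auto simp: eigenspace_iff intro!: bexI[of _ "u k"])
qed

text \<open>An eigenvector z for c is orthogonal to every \<open>u k\<close> whose
  \<open>q k\<close> differs from c, and z = T z / c lies in the closed span of all
  \<open>u k\<close>. So the \<open>u k\<close> with \<open>q k\<close> equal to c form an
  orthonormal basis of the eigenspace. The division excludes the kernel.\<close>

lemma eigenproj_diag_op:
  assumes "c \<noteq> 0"
  shows "eigenproj UNIV T c x = orthonormal_expansion u {k \<in> K. of_real (q k) = c} x"
  unfolding eigenproj_def
proof (rule orth_proj_unique)
  let ?K = "{k \<in> K. of_real (q k) = c}"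
  have onK: "orthonormal u ?K" by (rule orthonormal_subset[OF on]) auto
  note sa = self_adjoint_positive_op[OF positive_op_diag_op]
  show cl: "closed_csubspace (eigenspace UNIV T c)"
    by (rule closed_csubspace_eigenspace[OF sa])
  show "orthonormal_expansion u ?K x \<in> eigenspace UNIV T c"
    by (rule closed_csubspace_has_sum[OF cl has_sum_orthonormal_expansion[OF onK]])
      (auto intro!: closed_csubspaceD(4)[OF cl] simp: eigenspace_iff diag_op_u bounded_opD(4)[OF bounded_op_diag_op] scaleC_scaleC mult.commute)
  fix z assume z: "z \<in> eigenspace UNIV T c"
  have zk: "cinner (u k) z = 0" if "k \<in> K - ?K" for k
  proof -
    have "of_real (q k) * cinner (u k) z = c * cinner (u k) z"
      using cinner_diag_op[of k z] z that unfolding eigenspace_iff by (metis DiffD1 cinner_scaleC_right)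
    then show ?thesis using that by (metis (mono_tags, lifting) DiffD1 DiffD2 mem_Collect_eq mult_cancel_right)
  qed
  have "((\<lambda>k. (of_real (q k) * cinner (u k) z) *\<^sub>C u k) has_sum T z) ?K"
    using has_sum_diag_op[of z] by (rule has_sum_cong_neutral[THEN iffD1, rotated -1]) (use zk in auto)
  then have "((\<lambda>k. (1 / c) *\<^sub>C (of_real (q k) * cinner (u k) z) *\<^sub>C u k) has_sum (1 / c) *\<^sub>C T z) ?K"
    by (rule has_sum_scaleC)
  also have "?this \<longleftrightarrow> ((\<lambda>k. cinner (u k) z *\<^sub>C u k) has_sum (1 / c) *\<^sub>C T z) ?K"
  proof (rule has_sum_cong)
    show "(1 / c) *\<^sub>C (of_real (q k) * cinner (u k) z) *\<^sub>C u k = cinner (u k) z *\<^sub>C u k" if "k \<in> ?K" for k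
      using that assms by (auto simp: scaleC_scaleC)
  qed
  also have "(1 / c) *\<^sub>C T z = z"
    using z assms by (simp add: eigenspace_iff scaleC_scaleC)
  finally have zs: "((\<lambda>k. cinner (u k) z *\<^sub>C u k) has_sum z) ?K" .
  show "cinner z (x - orthonormal_expansion u ?K x) = 0"
  proof (rule has_sum_unique[OF has_sum_cinner_left[OF zs]])
    show "((\<lambda>k. cinner (cinner (u k) z *\<^sub>C u k) (x - orthonormal_expansion u ?K x)) has_sum 0) ?K"
      using cinner_orthonormal_expansion[OF onK] by (intro has_sum_0) (auto simp: cinner_scaleC_left)
  qed
qed

lemma norm_eigenproj_diag_op:
  assumes "c \<noteq> 0"
  shows "ennreal ((norm (eigenproj UNIV T c x))\<^sup>2) =
    (\<Sum>\<^sub>\<infinity>k\<in>K. if of_real (q k) = c then ennreal ((cmod (cinner (u k) x))\<^sup>2) else 0)"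
proof -
  let ?K = "{k \<in> K. of_real (q k) = c}"
  have onK: "orthonormal u ?K" by (rule orthonormal_subset[OF on]) auto
  have "((\<lambda>k. (norm (cinner (u k) x *\<^sub>C u k))\<^sup>2) has_sum (norm (eigenproj UNIV T c x))\<^sup>2) ?K"
    unfolding eigenproj_diag_op[OF assms]
    by (rule has_sum_norm_orth_family[OF orthonormal_orth_family[OF onK] has_sum_orthonormal_expansion[OF onK]])
  then have "ennreal ((norm (eigenproj UNIV T c x))\<^sup>2) = (\<Sum>\<^sub>\<infinity>k\<in>?K. ennreal ((norm (cinner (u k) x *\<^sub>C u k))\<^sup>2))"
    by (subst has_sum_ennreal) auto
  also have "\<dots> = (\<Sum>\<^sub>\<infinity>k\<in>K. if of_real (q k) = c then ennreal ((cmod (cinner (u k) x))\<^sup>2) else 0)"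
    by (rule infsum_cong_neutral) (auto simp: norm_scaleC orthonormal_norm[OF onK])
  finally show ?thesis .
qed

lemma eigenvalues_diag_op:
  assumes "c \<in> eigenvalues UNIV T"
  shows "c = 0 \<or> (\<exists>k\<in>K. c = of_real (q k))"
proof (rule ccontr)
  assume n: "\<not> ?thesis"
  obtain z where z: "z \<in> eigenspace UNIV T c" "z \<noteq> 0"
    using assms by (auto simp: eigenvalues_def)
  have "{k \<in> K. of_real (q k) = c} = {}" using n by auto
  note empty = this
  have "c \<noteq> 0" using n by blast
  have "eigenproj UNIV T c z = 0"
    unfolding eigenproj_diag_op[OF \<open>c \<noteq> 0\<close>] empty by (simp add: orthonormal_expansion_def)
  then show False
    using z eigenproj_eigenspace[OF self_adjoint_positive_op[OF positive_op_diag_op] z(1), of c] by simp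
qed

text \<open>Regroups a sum over distinct eigenvalues into a sum over indices: both equal a double
  sum over pairs with c = q k, in which each k meets exactly one eigenvalue. The kernel drops out
  through \<open>f 0 = 0\<close>.\<close>

lemma infsum_eigenvalues_diag_op:
  assumes "f 0 = 0" "\<And>k. k \<in> K \<Longrightarrow> f (q k) \<ge> 0"
  shows "(\<Sum>\<^sub>\<infinity>c\<in>eigenvalues UNIV T. ennreal (f (Re c) * (norm (eigenproj UNIV T c x))\<^sup>2)) =
    (\<Sum>\<^sub>\<infinity>k\<in>K. ennreal (f (q k) * (cmod (cinner (u k) x))\<^sup>2))"
proof -
  have "ennreal (f (Re c) * (norm (eigenproj UNIV T c x))\<^sup>2) =
      (\<Sum>\<^sub>\<infinity>k\<in>K. if c = of_real (q k) then ennreal (f (q k) * (cmod (cinner (u k) x))\<^sup>2) else 0)"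
    if c: "c \<in> eigenvalues UNIV T" for c
  proof (cases "c = 0")
    case True
    have "(\<Sum>\<^sub>\<infinity>k\<in>K. if c = of_real (q k) then ennreal (f (q k) * (cmod (cinner (u k) x))\<^sup>2) else 0) = 0"
      by (rule infsum_0) (use q_pos True in force)
    then show ?thesis using True assms(1) by simp
  next
    case False
    then obtain k0 where k0: "k0 \<in> K" "c = of_real (q k0)" using eigenvalues_diag_op[OF c] by blast
    have "ennreal (f (Re c) * (norm (eigenproj UNIV T c x))\<^sup>2) =
      ennreal (f (Re c)) * (\<Sum>\<^sub>\<infinity>k\<in>K. if of_real (q k) = c then ennreal ((cmod (cinner (u k) x))\<^sup>2) else 0)"
      unfolding norm_eigenproj_diag_op[OF False, symmetric] using assms(2)[OF k0(1)] k0(2)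
      by (simp add: ennreal_mult)
    also have "\<dots> = (\<Sum>\<^sub>\<infinity>k\<in>K. ennreal (f (Re c)) * (if of_real (q k) = c then ennreal ((cmod (cinner (u k) x))\<^sup>2) else 0))"
      by (rule infsum_cmult_ennreal[symmetric])
    also have "\<dots> = (\<Sum>\<^sub>\<infinity>k\<in>K. if c = of_real (q k) then ennreal (f (q k) * (cmod (cinner (u k) x))\<^sup>2) else 0)"
      by (rule infsum_cong) (use assms(2) in \<open>auto simp: ennreal_mult\<close>)
    finally show ?thesis .
  qed
  then have "(\<Sum>\<^sub>\<infinity>c\<in>eigenvalues UNIV T. ennreal (f (Re c) * (norm (eigenproj UNIV T c x))\<^sup>2)) =
    (\<Sum>\<^sub>\<infinity>c\<in>eigenvalues UNIV T. \<Sum>\<^sub>\<infinity>k\<in>K. if c = of_real (q k) then ennreal (f (q k) * (cmod (cinner (u k) x))\<^sup>2) else 0)"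
    by (rule infsum_cong)
  also have "\<dots> = (\<Sum>\<^sub>\<infinity>k\<in>K. \<Sum>\<^sub>\<infinity>c\<in>eigenvalues UNIV T. if c = of_real (q k) then ennreal (f (q k) * (cmod (cinner (u k) x))\<^sup>2) else 0)"
    by (rule infsum_swap_ennreal)
  also have "\<dots> = (\<Sum>\<^sub>\<infinity>k\<in>K. ennreal (f (q k) * (cmod (cinner (u k) x))\<^sup>2))"
    by (intro infsum_cong infsum_single_ennreal diag_eigenvalue)
  finally show ?thesis .
qed

lemma op_trace_op_fun_diag_op:
  assumes "f 0 = 0" "\<And>k. k \<in> K \<Longrightarrow> f (q k) \<ge> 0" "\<And>k. k \<in> K \<Longrightarrow> f (q k) \<le> M"
  shows "op_trace (op_fun f T) = (\<Sum>\<^sub>\<infinity>k\<in>K. ennreal (f (q k)))"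
proof -
  have bd: "0 \<le> f (Re c) \<and> f (Re c) \<le> \<bar>M\<bar>" if "c \<in> eigenvalues UNIV T" for c
    using eigenvalues_diag_op[OF that] assms by fastforce
  then have dom: "x \<in> op_fun_dom f T" for x
    by (intro op_fun_dom_bounded[OF positive_op_diag_op, of f "\<bar>M\<bar>"]) fastforce
  have "ennreal (Re (cinner x (op_fun f T x))) = (\<Sum>\<^sub>\<infinity>k\<in>K. ennreal (f (q k) * (cmod (cinner (u k) x))\<^sup>2))" for x
    using has_sum_ennreal[OF has_sum_cinner_op_fun[OF positive_op_diag_op dom, of x]]
      infsum_eigenvalues_diag_op[OF assms(1,2), of x] bd by simp
  then show ?thesis
    unfolding op_trace_def using infsum_basis_fourier[of "\<lambda>k. f (q k)"] assms(2) by simp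
qed

lemma diag_op_eq_0:
  assumes "T y = 0" "k \<in> K"
  shows "cinner (u k) y = 0"
  using cinner_diag_op[OF assms(2), of y] q_pos[OF assms(2)] assms(1) by simp

end

section \<open>Rank-one operators as diagonal operators\<close>

lemma ketbra_eq_diag_op:
  fixes v :: "'a::complex_hilbert_space"
  assumes "v \<noteq> 0"
  shows "diagonal (\<lambda>_. (1 / norm v) *\<^sub>R v) (\<lambda>_. (norm v)\<^sup>2) {()} ((norm v)\<^sup>2)"
    "ketbra v v = diag_op (\<lambda>_. (1 / norm v) *\<^sub>R v) (\<lambda>_. (norm v)\<^sup>2) {()}"
proof -
  show "diagonal (\<lambda>_. (1 / norm v) *\<^sub>R v) (\<lambda>_. (norm v)\<^sup>2) {()} ((norm v)\<^sup>2)"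
    by standard (use assms in \<open>auto simp: orthonormal_def cinner_scaleR_left cinner_scaleR_right cinner_self power2_eq_square\<close>)
  show "ketbra v v = diag_op (\<lambda>_. (1 / norm v) *\<^sub>R v) (\<lambda>_. (norm v)\<^sup>2) {()}"
    using assms by (auto simp: ketbra_def diag_op_def fun_eq_iff cinner_scaleC_left scaleR_scaleC scaleC_scaleC power2_eq_square)
qed

text \<open>Since \<open>diagonal\<close> asks for positive entries, the zero operator is
  represented by the empty index set.\<close>

lemma ketbra_zero_eq_diag_op:
  "diagonal (\<lambda>_. 0 :: 'a::complex_hilbert_space) (\<lambda>_. 0) ({} :: unit set) 0"
  "ketbra 0 (0 :: 'a) = diag_op (\<lambda>_. 0) (\<lambda>_. 0) ({} :: unit set)"
  by (simp add: diagonal_def orthonormal_def) (simp add: ketbra_def diag_op_def fun_eq_iff)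

lemma ketbra_trace:
  fixes v :: "'a::complex_hilbert_space"
  shows "positive_op (ketbra v v)" "discrete_spectrum UNIV (ketbra v v)"
    "\<alpha> > 0 \<Longrightarrow> op_trace (op_powr (ketbra v v) \<alpha>) = ennreal ((norm v)\<^sup>2 powr \<alpha>)"
proof -
  have "positive_op (ketbra v v) \<and> op_trace (ketbra v v) < \<infinity> \<and>
      (\<alpha> > 0 \<longrightarrow> op_trace (op_powr (ketbra v v) \<alpha>) = ennreal ((norm v)\<^sup>2 powr \<alpha>))"
  proof (cases "v = 0")
    case True
    show ?thesis
      unfolding True ketbra_zero_eq_diag_op(2) op_powr_def
      using diagonal.positive_op_diag_op[OF ketbra_zero_eq_diag_op(1)[where 'a = 'a]]
        diagonal.op_trace_diag_op[OF ketbra_zero_eq_diag_op(1)[where 'a = 'a]]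
        diagonal.op_trace_op_fun_diag_op[OF ketbra_zero_eq_diag_op(1)[where 'a = 'a], of "\<lambda>t. t powr \<alpha>"] by simp
  next
    case False
    show ?thesis
      unfolding ketbra_eq_diag_op(2)[OF False] op_powr_def
      using diagonal.positive_op_diag_op[OF ketbra_eq_diag_op(1)[OF False]]
        diagonal.op_trace_diag_op[OF ketbra_eq_diag_op(1)[OF False]]
        diagonal.op_trace_op_fun_diag_op[OF ketbra_eq_diag_op(1)[OF False], of "\<lambda>t. t powr \<alpha>" "(norm v)\<^sup>2 powr \<alpha>"] by simp
  qed
  then show "positive_op (ketbra v v)" "discrete_spectrum UNIV (ketbra v v)"
    "\<alpha> > 0 \<Longrightarrow> op_trace (op_powr (ketbra v v) \<alpha>) = ennreal ((norm v)\<^sup>2 powr \<alpha>)"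
    using positive_op_discrete_spectrum by blast+
qed

subsection \<open>Sandwiched Renyi divergence of a pure state\<close>

text \<open>The eigenvalue \<open>0\<close> does not contribute, not even for \<open>t = 0\<close>, because \<open>0 powr 0 = 0\<close>. So the
  moment of order \<open>0\<close> is the squared norm of the part of \<open>\<psi>\<close> in the support of \<open>\<sigma>\<close>.\<close>

definition spectral_moment :: "('a::complex_hilbert_space \<Rightarrow> 'a) \<Rightarrow> 'a \<Rightarrow> real \<Rightarrow> ennreal"
  where "spectral_moment \<sigma> \<psi> t =
    (\<Sum>\<^sub>\<infinity>g\<in>eigenvalues UNIV \<sigma>. ennreal (Re g powr t * (norm (eigenproj UNIV \<sigma> g \<psi>))\<^sup>2))"

text \<open>Pythagoras over the orthogonal eigencomponents, with
  \<open>(x powr s)\<^sup>2 = x powr (2 * s)\<close>. It replaces operator powers and their domains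
  by scalar sums.\<close>

lemma op_powr_spectral_moment:
  assumes "positive_op \<sigma>"
  shows "\<psi> \<in> op_powr_dom \<sigma> s \<longleftrightarrow> spectral_moment \<sigma> \<psi> (2 * s) < \<infinity>"
    "\<psi> \<in> op_powr_dom \<sigma> s \<Longrightarrow> spectral_moment \<sigma> \<psi> (2 * s) = ennreal ((norm (op_powr \<sigma> s \<psi>))\<^sup>2)"
proof -
  have sq: "(x powr s)\<^sup>2 = x powr (2 * s)" for x :: real
    by (simp add: power2_eq_square powr_add[symmetric])
  show eq: "spectral_moment \<sigma> \<psi> (2 * s) = ennreal ((norm (op_powr \<sigma> s \<psi>))\<^sup>2)" if "\<psi> \<in> op_powr_dom \<sigma> s"
    using has_sum_norm_op_fun[OF assms that[unfolded op_powr_dom_def]]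
    unfolding spectral_moment_def op_powr_def sq by (rule has_sum_ennreal) simp
  show "\<psi> \<in> op_powr_dom \<sigma> s \<longleftrightarrow> spectral_moment \<sigma> \<psi> (2 * s) < \<infinity>"
  proof
    assume "spectral_moment \<sigma> \<psi> (2 * s) < \<infinity>"
    then show "\<psi> \<in> op_powr_dom \<sigma> s"
      unfolding op_powr_dom_def op_fun_dom_iff[OF assms] sq spectral_moment_def
      by (rule summable_on_infsum_ennreal_finite) simp
  qed (simp add: eq)
qed

text \<open>With v = \<sigma>^s \<psi> the product is |v><v| by symmetry of \<sigma>^s. Uniqueness
  of the bounded extension, on which the \<open>THE\<close> in \<open>sandwiched_trace\<close>
  depends, holds because the domain contains the eigenvectors of \<sigma> and every vector is a sum
  of those.\<close>

lemma is_sandwich_pure: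
  assumes "positive_op \<sigma>" "discrete_spectrum UNIV \<sigma>" "\<psi> \<in> op_powr_dom \<sigma> s"
  shows "is_sandwich s (ketbra \<psi> \<psi>) \<sigma> X \<longleftrightarrow> X = ketbra (op_powr \<sigma> s \<psi>) (op_powr \<sigma> s \<psi>)"
proof -
  let ?v = "op_powr \<sigma> s \<psi>"
  note sa = self_adjoint_positive_op[OF assms(1)]
  have scale: "c *\<^sub>C \<psi> \<in> op_powr_dom \<sigma> s" "op_powr \<sigma> s (c *\<^sub>C \<psi>) = c *\<^sub>C ?v" for c
  proof -
    have "((\<lambda>g. c *\<^sub>C (Re g powr s *\<^sub>R eigenproj UNIV \<sigma> g \<psi>)) has_sum c *\<^sub>C ?v) (eigenvalues UNIV \<sigma>)"
      using assms(3) unfolding op_powr_dom_def op_powr_def by (intro has_sum_scaleC has_sum_op_fun)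
    moreover have "c *\<^sub>C (Re g powr s *\<^sub>R eigenproj UNIV \<sigma> g \<psi>) = Re g powr s *\<^sub>R eigenproj UNIV \<sigma> g (c *\<^sub>C \<psi>)" for g
      unfolding eigenproj_def
      by (simp add: orth_proj_scaleC[OF closed_csubspace_eigenspace[OF sa]] scaleR_scaleC scaleC_scaleC mult.commute)
    ultimately have "((\<lambda>g. Re g powr s *\<^sub>R eigenproj UNIV \<sigma> g (c *\<^sub>C \<psi>)) has_sum c *\<^sub>C ?v) (eigenvalues UNIV \<sigma>)"
      by simp
    then show "c *\<^sub>C \<psi> \<in> op_powr_dom \<sigma> s" "op_powr \<sigma> s (c *\<^sub>C \<psi>) = c *\<^sub>C ?v"
      unfolding op_powr_dom_def op_powr_def op_fun_dom_def op_fun_def by (auto simp: summable_on_def infsumI)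
  qed
  have on_dom: "ketbra \<psi> \<psi> (op_powr \<sigma> s x) \<in> op_powr_dom \<sigma> s \<and>
      op_powr \<sigma> s (ketbra \<psi> \<psi> (op_powr \<sigma> s x)) = ketbra ?v ?v x" if "x \<in> op_powr_dom \<sigma> s" for x
    using op_fun_symmetric[OF assms(1) assms(3)[unfolded op_powr_dom_def] that[unfolded op_powr_dom_def]] scale
    by (simp add: ketbra_def op_powr_def)
  have b: "bounded_op (ketbra ?v ?v)"
    by (rule positive_opD(1)[OF ketbra_trace(1)])
  show ?thesis
  proof
    assume X: "is_sandwich s (ketbra \<psi> \<psi>) \<sigma> X"
    show "X = ketbra ?v ?v"
    proof
      fix x
      have sum: "((\<lambda>g. eigenproj UNIV \<sigma> g x) has_sum x) (eigenvalues UNIV \<sigma>)"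
        using assms(2) unfolding discrete_spectrum_def by blast
      have eq: "X (eigenproj UNIV \<sigma> g x) = ketbra ?v ?v (eigenproj UNIV \<sigma> g x)"
        if "g \<in> eigenvalues UNIV \<sigma>" for g
        using X on_dom op_fun_eigenvector(1)[OF assms(1) eigenproj_in[OF sa] that]
        unfolding is_sandwich_def op_powr_dom_def by metis
      have "((\<lambda>g. X (eigenproj UNIV \<sigma> g x)) has_sum X x) (eigenvalues UNIV \<sigma>)"
        using X unfolding is_sandwich_def by (intro has_sum_bounded_linear[OF bounded_opD(1) sum]) blast
      moreover have "((\<lambda>g. X (eigenproj UNIV \<sigma> g x)) has_sum ketbra ?v ?v x) (eigenvalues UNIV \<sigma>)"
        using has_sum_bounded_linear[OF bounded_opD(1)[OF b] sum] eq by (simp cong: has_sum_cong)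
      ultimately show "X x = ketbra ?v ?v x" by (rule has_sum_unique)
    qed
  next
    assume "X = ketbra ?v ?v"
    then show "is_sandwich s (ketbra \<psi> \<psi>) \<sigma> X"
      unfolding is_sandwich_def using b on_dom by simp
  qed
qed

text \<open>If some component \<open>x\<close> of \<open>\<psi>\<close> has a positive eigenvalue, then \<open>\<rho> \<sigma>\<^sup>s x\<close> is a nonzero multiple of \<open>\<psi>\<close>,
  so \<open>\<psi>\<close> lies in the domain of \<open>\<sigma>\<^sup>s\<close>.\<close>

lemma is_sandwich_pure_imp_dom:
  assumes "positive_op \<sigma>" "is_sandwich s (ketbra \<psi> \<psi>) \<sigma> X"
  shows "\<psi> \<in> op_powr_dom \<sigma> s"
proof (cases "\<exists>g\<in>eigenvalues UNIV \<sigma>. Re g > 0 \<and> eigenproj UNIV \<sigma> g \<psi> \<noteq> 0")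
  case True
  note sa = self_adjoint_positive_op[OF assms(1)]
  obtain g where g: "g \<in> eigenvalues UNIV \<sigma>" "Re g > 0" "eigenproj UNIV \<sigma> g \<psi> \<noteq> 0"
    using True by blast
  let ?x = "eigenproj UNIV \<sigma> g \<psi>"
  note e = op_fun_eigenvector[OF assms(1) eigenproj_in[OF sa, of g \<psi>] g(1), where f = "\<lambda>t. t powr s"]
  define c where "c = cinner \<psi> (op_powr \<sigma> s ?x)"
  have "c = of_real (Re g powr s) * of_real ((norm ?x)\<^sup>2)"
    unfolding c_def op_powr_def e(2) cinner_scaleR_right
    using cinner_orth_proj_self(1)[OF closed_csubspace_eigenspace[OF sa]] by (simp add: eigenproj_def)
  then have "c \<noteq> 0" using g by simp
  have "c *\<^sub>C \<psi> \<in> op_powr_dom \<sigma> s"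
    using assms(2) e(1) unfolding is_sandwich_def op_powr_dom_def c_def ketbra_def by blast
  then have "(\<lambda>g. (1 / c) *\<^sub>C (Re g powr s *\<^sub>R eigenproj UNIV \<sigma> g (c *\<^sub>C \<psi>))) summable_on eigenvalues UNIV \<sigma>"
    unfolding op_powr_dom_def op_fun_dom_def
    using summable_on_bounded_linear[OF bounded_linear_scaleC_right] by blast
  moreover have "(1 / c) *\<^sub>C (Re h powr s *\<^sub>R eigenproj UNIV \<sigma> h (c *\<^sub>C \<psi>)) = Re h powr s *\<^sub>R eigenproj UNIV \<sigma> h \<psi>" for h
    using \<open>c \<noteq> 0\<close> unfolding eigenproj_def
    by (simp add: orth_proj_scaleC[OF closed_csubspace_eigenspace[OF sa]] scaleR_scaleC scaleC_scaleC)
  ultimately show ?thesis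
    unfolding op_powr_dom_def op_fun_dom_def by simp
next
  case False
  \<comment> \<open>Only the eigenvalue 0 can have a nonzero component here, and
    \<open>0 powr s = 0\<close> annihilates it.\<close>
  then have "Re g powr s *\<^sub>R eigenproj UNIV \<sigma> g \<psi> = 0" if "g \<in> eigenvalues UNIV \<sigma>" for g
    using that eigenvalue_nonneg[OF assms(1) that] by (cases "Re g = 0") force+
  then show ?thesis
    unfolding op_powr_dom_def op_fun_dom_def by (simp add: summable_on_0)
qed

lemma elog_powr:
  assumes "r \<ge> 0" "\<alpha> > 0"
  shows "elog b (ennreal (r powr \<alpha>)) = ereal \<alpha> * elog b (ennreal r)"
  using assms by (cases "r = 0") (auto simp: elog_def log_powr)

text \<open>|v><v| has at most the one nonzero eigenvalue \<open>(norm v)\<^sup>2\<close>, so the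
  power \<alpha> comes out of the logarithm as a factor. If \<psi> is outside the domain of
  \<sigma>^s, both sides are infinite.\<close>

lemma elog_sandwiched_trace_pure:
  assumes "positive_op \<sigma>" "discrete_spectrum UNIV \<sigma>" "\<alpha> > 0"
  shows "elog b (sandwiched_trace \<alpha> (ketbra \<psi> \<psi>) \<sigma>) =
    ereal \<alpha> * elog b (spectral_moment \<sigma> \<psi> ((1 - \<alpha>) / \<alpha>))"
proof -
  define s where "s = (1 - \<alpha>) / (2 * \<alpha>)"
  have s2: "2 * s = (1 - \<alpha>) / \<alpha>" using assms(3) by (simp add: s_def field_simps)
  show ?thesis
  proof (cases "\<psi> \<in> op_powr_dom \<sigma> s")
    case True
    note sw = is_sandwich_pure[OF assms(1,2) True]
    let ?v = "op_powr \<sigma> s \<psi>"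
    have "sandwiched_trace \<alpha> (ketbra \<psi> \<psi>) \<sigma> = ennreal ((norm ?v)\<^sup>2 powr \<alpha>)"
      unfolding sandwiched_trace_def s_def[symmetric] Let_def sw using ketbra_trace(2)[of ?v] ketbra_trace(3)[of \<alpha> ?v] assms(3) by simp
    then show ?thesis
      using op_powr_spectral_moment(2)[OF assms(1) True] elog_powr[of "(norm ?v)\<^sup>2" \<alpha> b] assms(3) by (simp add: s2)
  next
    case False
    then have "\<not> (\<exists>X. is_sandwich s (ketbra \<psi> \<psi>) \<sigma> X)"
      using is_sandwich_pure_imp_dom[OF assms(1)] by blast
    then have "sandwiched_trace \<alpha> (ketbra \<psi> \<psi>) \<sigma> = \<infinity>"
      unfolding sandwiched_trace_def s_def[symmetric] Let_def by auto
    moreover have "spectral_moment \<sigma> \<psi> ((1 - \<alpha>) / \<alpha>) = \<infinity>"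
      using False op_powr_spectral_moment(1)[OF assms(1), of \<psi> s] unfolding s2 by (metis infinity_ennreal_def top.not_eq_extremum)
    ultimately show ?thesis using assms(3) by (simp add: elog_def)
  qed
qed

text \<open>The support of |psi><psi| consists of the vectors orthogonal to everything orthogonal to
  \<psi>, so the inclusion only has to be tested on \<psi>.\<close>

lemma support_ketbra_subset_iff:
  assumes "norm \<psi> = 1"
  shows "support (ketbra \<psi> \<psi>) \<subseteq> support \<sigma> \<longleftrightarrow> (\<forall>y. \<sigma> y = 0 \<longrightarrow> cinner y \<psi> = 0)"
proof
  have "\<psi> \<noteq> 0" using assms by auto
  have "ketbra \<psi> \<psi> y = 0 \<longleftrightarrow> cinner y \<psi> = 0" for y
  proof -
    have "ketbra \<psi> \<psi> y = 0 \<longleftrightarrow> norm (ketbra \<psi> \<psi> y) = 0" by simp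
    also have "\<dots> \<longleftrightarrow> cmod (cinner y \<psi>) = 0"
      using assms cmod_cinner_commute[of y \<psi>] by (simp add: ketbra_def norm_scaleC del: norm_eq_zero)
    finally show ?thesis by simp
  qed
  then have ker: "support (ketbra \<psi> \<psi>) = {x. \<forall>y. cinner y \<psi> = 0 \<longrightarrow> cinner y x = 0}"
    by (simp add: support_def)
  show "\<forall>y. \<sigma> y = 0 \<longrightarrow> cinner y \<psi> = 0" if "support (ketbra \<psi> \<psi>) \<subseteq> support \<sigma>"
    using subsetD[OF that, of \<psi>] unfolding ker by (simp add: support_def)
  show "support (ketbra \<psi> \<psi>) \<subseteq> support \<sigma>" if *: "\<forall>y. \<sigma> y = 0 \<longrightarrow> cinner y \<psi> = 0"
    unfolding ker unfolding support_def using * by auto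
qed

lemma spectral_moment_0:
  assumes "positive_op \<sigma>" "discrete_spectrum UNIV \<sigma>"
  shows "spectral_moment \<sigma> \<psi> 0 \<le> ennreal ((norm \<psi>)\<^sup>2)"
    "(\<And>y. \<sigma> y = 0 \<Longrightarrow> cinner y \<psi> = 0) \<Longrightarrow> spectral_moment \<sigma> \<psi> 0 = ennreal ((norm \<psi>)\<^sup>2)"
proof -
  note sa = self_adjoint_positive_op[OF assms(1)]
  have "((\<lambda>g. eigenproj UNIV \<sigma> g \<psi>) has_sum \<psi>) (eigenvalues UNIV \<sigma>)"
    using assms(2) unfolding discrete_spectrum_def by blast
  then have "((\<lambda>g. (norm (eigenproj UNIV \<sigma> g \<psi>))\<^sup>2) has_sum (norm \<psi>)\<^sup>2) (eigenvalues UNIV \<sigma>)"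
    using has_sum_norm_orth_family orth_family_eigenproj[OF sa, of "\<lambda>_. 1" \<psi>] by fastforce
  then have sum: "(\<Sum>\<^sub>\<infinity>g\<in>eigenvalues UNIV \<sigma>. ennreal ((norm (eigenproj UNIV \<sigma> g \<psi>))\<^sup>2)) = ennreal ((norm \<psi>)\<^sup>2)"
    by (rule has_sum_ennreal) simp
  show "spectral_moment \<sigma> \<psi> 0 \<le> ennreal ((norm \<psi>)\<^sup>2)"
    unfolding sum[symmetric] spectral_moment_def
    by (rule infsum_mono_ennreal) (auto intro!: ennreal_leI)
  assume ker: "\<And>y. \<sigma> y = 0 \<Longrightarrow> cinner y \<psi> = 0"
  show "spectral_moment \<sigma> \<psi> 0 = ennreal ((norm \<psi>)\<^sup>2)"
    unfolding sum[symmetric] spectral_moment_def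
  proof (rule infsum_cong)
    fix g assume g: "g \<in> eigenvalues UNIV \<sigma>"
    show "ennreal (Re g powr 0 * (norm (eigenproj UNIV \<sigma> g \<psi>))\<^sup>2) = ennreal ((norm (eigenproj UNIV \<sigma> g \<psi>))\<^sup>2)"
    proof (cases "Re g = 0")
      case True
      then have "g = 0" using eigenvalue_real[OF sa g] by simp
      then have "\<sigma> (eigenproj UNIV \<sigma> g \<psi>) = 0"
        using eigenproj_in[OF sa, of g \<psi>] by (simp add: eigenspace_iff)
      then have "cinner (eigenproj UNIV \<sigma> g \<psi>) \<psi> = 0" by (rule ker)
      then have "norm (eigenproj UNIV \<sigma> g \<psi>) = 0"
        using cinner_orth_proj_self(2)[OF closed_csubspace_eigenspace[OF sa], of g \<psi>]
        by (simp add: eigenproj_def)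
      then show ?thesis by simp
    qed (simp add: powr_def)
  qed
qed

subsection \<open>Tangent-line estimates for spectral moments\<close>

text \<open>The concave function x^t lies below its tangent at r. This is Young's inequality for x
  and r, multiplied by \<open>r powr (t - 1)\<close>.\<close>

lemma powr_tangent_ge:
  fixes x r t :: real
  assumes "x > 0" "r > 0" "0 \<le> t" "t \<le> 1"
  shows "x powr t \<le> t * r powr (t - 1) * x + (1 - t) * r powr t"
proof -
  have "x powr t * r powr (1 - t) \<le> t * x + (1 - t) * r"
    using Youngs_inequality_0[of t "1 - t" x r] assms by simp
  then have "x powr t * r powr (1 - t) * r powr (t - 1) \<le> (t * x + (1 - t) * r) * r powr (t - 1)"
    by (rule mult_right_mono) simp
  moreover have "x powr t * r powr (1 - t) * r powr (t - 1) = x powr t"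
    using assms by (simp add: mult.assoc powr_add[symmetric])
  moreover have "r powr t = r * r powr (t - 1)"
    using assms powr_add[of r 1 "t - 1"] by simp
  then have "(t * x + (1 - t) * r) * r powr (t - 1) = t * r powr (t - 1) * x + (1 - t) * r powr t"
    by (simp add: algebra_simps)
  ultimately show ?thesis by simp
qed

text \<open>Convexity of x^t for t \<le> 0, from ln y \<le> y - 1 and 1 + w \<le> exp w. The linear
  term of the tangent has coefficient \<le> 0 and is moved to the right, so that both sides are
  nonnegative and can be read in \<open>ennreal\<close>.\<close>

lemma powr_tangent_le:
  fixes x r t :: real
  assumes "x > 0" "r > 0" "t \<le> 0"
  shows "(1 - t) * r powr t \<le> x powr t + (- t) * r powr (t - 1) * x"
proof -
  have "t * (x / r - 1) \<le> t * ln (x / r)"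
    using ln_le_minus_one[of "x / r"] assms by (intro mult_left_mono_neg) auto
  then have "1 + t * (x / r - 1) \<le> exp (t * ln (x / r))"
    using exp_ge_add_one_self[of "t * ln (x / r)"] by linarith
  also have "\<dots> = x powr t / r powr t"
    using assms by (simp add: powr_def ln_div exp_diff[symmetric] algebra_simps)
  finally have "(1 + t * (x / r - 1)) * r powr t \<le> x powr t / r powr t * r powr t"
    by (rule mult_right_mono) simp
  moreover have "r powr t = r * r powr (t - 1)"
    using assms powr_add[of r 1 "t - 1"] by simp
  moreover have "(1 + t * (x / r - 1)) * (r * s) = (1 - t) * (r * s) + t * s * x" for s
    using assms by (simp add: field_simps)
  ultimately show ?thesis using assms by simp
qed

lemma infsum_cmult_ennreal_real:
  assumes "c \<ge> 0" "\<And>i. i \<in> A \<Longrightarrow> h i \<ge> 0"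
  shows "(\<Sum>\<^sub>\<infinity>i\<in>A. ennreal (c * h i)) = ennreal c * (\<Sum>\<^sub>\<infinity>i\<in>A. ennreal (h i))"
  unfolding infsum_cmult_ennreal[symmetric]
  by (rule infsum_cong) (use assms in \<open>simp add: ennreal_mult\<close>)

lemma has_sum_expectation:
  assumes "positive_op \<sigma>" "discrete_spectrum UNIV \<sigma>"
  shows "((\<lambda>g. Re g * (norm (eigenproj UNIV \<sigma> g x))\<^sup>2) has_sum Re (cinner x (\<sigma> x))) (eigenvalues UNIV \<sigma>)"
proof -
  note sa = self_adjoint_positive_op[OF assms(1)]
  have "((\<lambda>g. g *\<^sub>C eigenproj UNIV \<sigma> g x) has_sum \<sigma> x) (eigenvalues UNIV \<sigma>)"
    using assms(2) unfolding discrete_spectrum_def by blast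
  from has_sum_Re[OF has_sum_cinner_right[OF this, of x]]
  show ?thesis
    using cinner_orth_proj_self(1)[OF closed_csubspace_eigenspace[OF sa]]
    by (simp add: cinner_scaleC_right eigenproj_def)
qed

lemma infsum_expectation:
  assumes "positive_op \<sigma>" "discrete_spectrum UNIV \<sigma>"
  shows "(\<Sum>\<^sub>\<infinity>g\<in>eigenvalues UNIV \<sigma>. ennreal (Re g * (norm (eigenproj UNIV \<sigma> g x))\<^sup>2)) = ennreal (Re (cinner x (\<sigma> x)))"
  by (rule has_sum_ennreal[OF has_sum_expectation[OF assms]]) (use eigenvalue_nonneg[OF assms(1)] in simp)

lemma spectral_moment_le:
  assumes "positive_op \<sigma>" "discrete_spectrum UNIV \<sigma>" "r > 0" "0 \<le> t" "t \<le> 1"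
  shows "spectral_moment \<sigma> x t \<le>
    ennreal (t * r powr (t - 1) * Re (cinner x (\<sigma> x)) + (1 - t) * r powr t * (norm x)\<^sup>2)"
proof -
  let ?E = "eigenvalues UNIV \<sigma>" and ?w = "\<lambda>g. (norm (eigenproj UNIV \<sigma> g x))\<^sup>2"
  \<comment> \<open>The factor \<open>Re g powr 0\<close> restricts the constant term of the tangent
    to nonzero eigenvalues; at the eigenvalue 0 both sides vanish.\<close>
  have "Re g powr t * ?w g \<le> t * r powr (t - 1) * (Re g * ?w g) + (1 - t) * r powr t * (Re g powr 0 * ?w g)"
    if "g \<in> ?E" for g
  proof (cases "Re g = 0")
    case False
    then have "Re g > 0" using eigenvalue_nonneg[OF assms(1) that] by simp
    from mult_right_mono[OF powr_tangent_ge[OF this assms(3-5)], of "?w g"] show ?thesis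
      using False by (simp add: algebra_simps)
  qed simp
  then have "spectral_moment \<sigma> x t \<le> (\<Sum>\<^sub>\<infinity>g\<in>?E. ennreal (t * r powr (t - 1) * (Re g * ?w g)) + ennreal ((1 - t) * r powr t * (Re g powr 0 * ?w g)))"
    unfolding spectral_moment_def using assms eigenvalue_nonneg[OF assms(1)]
    by (intro infsum_mono_ennreal) (simp add: ennreal_leI flip: ennreal_plus)
  also have "\<dots> = ennreal (t * r powr (t - 1)) * ennreal (Re (cinner x (\<sigma> x))) + ennreal ((1 - t) * r powr t) * spectral_moment \<sigma> x 0"
    unfolding infsum_add_ennreal spectral_moment_def infsum_expectation[OF assms(1,2), symmetric]
    using assms eigenvalue_nonneg[OF assms(1)] by (intro arg_cong2[where f = "(+)"] infsum_cmult_ennreal_real) auto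
  also have "\<dots> \<le> ennreal (t * r powr (t - 1)) * ennreal (Re (cinner x (\<sigma> x))) + ennreal ((1 - t) * r powr t) * ennreal ((norm x)\<^sup>2)"
    by (intro add_left_mono mult_left_mono spectral_moment_0(1)[OF assms(1,2)]) simp
  also have "\<dots> = ennreal (t * r powr (t - 1) * Re (cinner x (\<sigma> x)) + (1 - t) * r powr t * (norm x)\<^sup>2)"
    using assms positive_opD(2)[OF assms(1)] by (simp add: ennreal_mult[symmetric] ennreal_plus[symmetric] del: ennreal_plus)
  finally show ?thesis .
qed

text \<open>The kernel condition turns the moment of order 0 into the full squared norm; otherwise
  the constant term of the tangent would miss the part of x in the kernel of \<sigma>.\<close>

lemma spectral_moment_ge:
  assumes "positive_op \<sigma>" "discrete_spectrum UNIV \<sigma>" "r > 0" "t \<le> 0" "\<And>y. \<sigma> y = 0 \<Longrightarrow> cinner y x = 0"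
  shows "ennreal ((1 - t) * r powr t * (norm x)\<^sup>2) \<le>
    spectral_moment \<sigma> x t + ennreal ((- t) * r powr (t - 1) * Re (cinner x (\<sigma> x)))"
proof -
  let ?E = "eigenvalues UNIV \<sigma>" and ?w = "\<lambda>g. (norm (eigenproj UNIV \<sigma> g x))\<^sup>2"
  have pt: "(1 - t) * r powr t * (Re g powr 0 * ?w g) \<le> Re g powr t * ?w g + (- t) * r powr (t - 1) * (Re g * ?w g)"
    if "g \<in> ?E" for g
  proof (cases "Re g = 0")
    case False
    then have "Re g > 0" using eigenvalue_nonneg[OF assms(1) that] by simp
    from mult_right_mono[OF powr_tangent_le[OF this assms(3,4)], of "?w g"] show ?thesis
      using False by (simp add: algebra_simps)
  qed simp
  have "ennreal ((1 - t) * r powr t * (norm x)\<^sup>2) = ennreal ((1 - t) * r powr t) * spectral_moment \<sigma> x 0"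
    using spectral_moment_0(2)[OF assms(1,2,5)] assms(4) by (simp add: ennreal_mult)
  also have "\<dots> = (\<Sum>\<^sub>\<infinity>g\<in>?E. ennreal ((1 - t) * r powr t * (Re g powr 0 * ?w g)))"
    unfolding spectral_moment_def using assms(4) by (intro infsum_cmult_ennreal_real[symmetric]) auto
  also have "\<dots> \<le> (\<Sum>\<^sub>\<infinity>g\<in>?E. ennreal (Re g powr t * ?w g) + ennreal ((- t) * r powr (t - 1) * (Re g * ?w g)))"
  proof (rule infsum_mono_ennreal)
    fix g assume g: "g \<in> ?E"
    have "0 \<le> (- t) * r powr (t - 1) * (Re g * ?w g)"
      using assms(4) eigenvalue_nonneg[OF assms(1) g] by (intro mult_nonneg_nonneg) auto
    then show "ennreal ((1 - t) * r powr t * (Re g powr 0 * ?w g)) \<le> ennreal (Re g powr t * ?w g) + ennreal ((- t) * r powr (t - 1) * (Re g * ?w g))"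
      using ennreal_leI[OF pt[OF g]] ennreal_plus[of "Re g powr t * ?w g" "(- t) * r powr (t - 1) * (Re g * ?w g)"] by (metis mult_nonneg_nonneg powr_ge_zero zero_le_power2)
  qed
  also have "\<dots> = spectral_moment \<sigma> x t + ennreal ((- t) * r powr (t - 1)) * ennreal (Re (cinner x (\<sigma> x)))"
    unfolding infsum_add_ennreal spectral_moment_def infsum_expectation[OF assms(1,2), symmetric]
    using assms(4) eigenvalue_nonneg[OF assms(1)] by (intro arg_cong2[where f = "(+)"] infsum_cmult_ennreal_real) (auto intro: mult_nonpos_nonneg)
  also have "ennreal ((- t) * r powr (t - 1)) * ennreal (Re (cinner x (\<sigma> x))) = ennreal ((- t) * r powr (t - 1) * Re (cinner x (\<sigma> x)))"
    using assms(4) positive_opD(2)[OF assms(1)] by (intro ennreal_mult[symmetric]) (auto intro: mult_nonpos_nonneg)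
  finally show ?thesis .
qed

section \<open>Monotonicity of the divergence in t\<close>

lemma elog_ennreal: "r > 0 \<Longrightarrow> elog b (ennreal r) = ereal (log b r)"
  by (simp add: elog_def)

lemma elog_mono:
  assumes "b > 1" "x \<le> y"
  shows "elog b x \<le> elog b y"
proof (cases "x = 0 \<or> y = \<infinity>")
  case True
  then show ?thesis using assms by (auto simp: elog_def)
next
  case False
  then obtain r s where "r \<ge> 0" "s \<ge> 0" "x = ennreal r" "y = ennreal s"
    using assms(2) by (cases x; cases y) (auto simp: top_unique)
  then have "0 < r" "0 < s" "r \<le> s" "x = ennreal r" "y = ennreal s" using False assms(2) by auto
  then show ?thesis using assms(1) by (simp add: elog_ennreal)
qed

text \<open>Jensen's inequality for y^\<theta>, with weights on the nonzero eigenvalues of total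
  mass at most 1. The tangent is taken at the moment r of order t itself, where its two terms add up
  to \<open>r powr \<theta>\<close>.\<close>

lemma elog_spectral_moment_mult:
  assumes "positive_op \<sigma>" "spectral_moment \<sigma> \<psi> 0 \<le> 1" "0 < \<theta>" "\<theta> \<le> 1" "b > 1"
  shows "elog b (spectral_moment \<sigma> \<psi> (\<theta> * t)) \<le> ereal \<theta> * elog b (spectral_moment \<sigma> \<psi> t)"
proof (cases "spectral_moment \<sigma> \<psi> t")
  case top
  then show ?thesis using assms(3) by (simp add: elog_def)
next
  case (real r)
  let ?E = "eigenvalues UNIV \<sigma>" and ?w = "\<lambda>g. (norm (eigenproj UNIV \<sigma> g \<psi>))\<^sup>2"
  show ?thesis
  proof (cases "r = 0")
    case True
    \<comment> \<open>There is no tangent at r = 0, but then every term of the moment vanishes at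
      every order.\<close>
    have "Re g powr (\<theta> * t) * ?w g = 0" if "g \<in> ?E" for g
    proof -
      have "ennreal (Re g powr t * ?w g) \<le> spectral_moment \<sigma> \<psi> t"
        unfolding spectral_moment_def
        using sum_le_infsum_ennreal[of "{g}" ?E "\<lambda>g. ennreal (Re g powr t * ?w g)"] that by simp
      then have "Re g powr t * ?w g \<le> 0" using real True by (simp add: ennreal_eq_0_iff)
      then show ?thesis by (auto simp: mult_le_0_iff)
    qed
    then have "spectral_moment \<sigma> \<psi> (\<theta> * t) = 0"
      unfolding spectral_moment_def by (intro infsum_0) simp
    then show ?thesis by (simp add: elog_def)
  next
    case False
    then have "r > 0" using real by simp
    have pt: "Re g powr (\<theta> * t) * ?w g \<le> \<theta> * r powr (\<theta> - 1) * (Re g powr t * ?w g) + (1 - \<theta>) * r powr \<theta> * (Re g powr 0 * ?w g)"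
      if "g \<in> ?E" for g
    proof (cases "Re g = 0")
      case False
      then have "Re g > 0" using eigenvalue_nonneg[OF assms(1) that] by simp
      then have "Re g powr t > 0" by simp
      from mult_right_mono[OF powr_tangent_ge[OF this \<open>r > 0\<close>], of \<theta> "?w g"] show ?thesis
        using False assms(3,4) by (simp add: algebra_simps powr_powr)
    qed simp
    have "spectral_moment \<sigma> \<psi> (\<theta> * t) \<le> (\<Sum>\<^sub>\<infinity>g\<in>?E. ennreal (\<theta> * r powr (\<theta> - 1) * (Re g powr t * ?w g)) + ennreal ((1 - \<theta>) * r powr \<theta> * (Re g powr 0 * ?w g)))"
      unfolding spectral_moment_def
    proof (rule infsum_mono_ennreal)
      fix g assume g: "g \<in> ?E"
      have "0 \<le> \<theta> * r powr (\<theta> - 1) * (Re g powr t * ?w g)" "0 \<le> (1 - \<theta>) * r powr \<theta> * (Re g powr 0 * ?w g)"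
        using assms(3,4) by (auto intro!: mult_nonneg_nonneg)
      then show "ennreal (Re g powr (\<theta> * t) * ?w g) \<le> ennreal (\<theta> * r powr (\<theta> - 1) * (Re g powr t * ?w g)) + ennreal ((1 - \<theta>) * r powr \<theta> * (Re g powr 0 * ?w g))"
        using ennreal_leI[OF pt[OF g]] ennreal_plus by metis
    qed
    also have "\<dots> = ennreal (\<theta> * r powr (\<theta> - 1)) * spectral_moment \<sigma> \<psi> t + ennreal ((1 - \<theta>) * r powr \<theta>) * spectral_moment \<sigma> \<psi> 0"
      unfolding infsum_add_ennreal spectral_moment_def
      using assms by (intro arg_cong2[where f = "(+)"] infsum_cmult_ennreal_real) auto
    also have "\<dots> \<le> ennreal (\<theta> * r powr (\<theta> - 1)) * ennreal r + ennreal ((1 - \<theta>) * r powr \<theta>) * 1"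
      unfolding real(2) by (intro add_left_mono mult_left_mono assms) simp
    also have "\<dots> = ennreal (\<theta> * r powr (\<theta> - 1) * r + (1 - \<theta>) * r powr \<theta>)"
      using assms real by (simp add: ennreal_mult[symmetric] ennreal_plus[symmetric] del: ennreal_plus)
    also have "\<theta> * r powr (\<theta> - 1) * r + (1 - \<theta>) * r powr \<theta> = r powr \<theta>"
      using powr_add[of r "\<theta> - 1" 1] \<open>r > 0\<close> by (simp add: algebra_simps)
    finally have "elog b (spectral_moment \<sigma> \<psi> (\<theta> * t)) \<le> elog b (ennreal (r powr \<theta>))"
      by (rule elog_mono[OF assms(5)])
    also have "\<dots> = ereal \<theta> * elog b (ennreal r)"
      using elog_powr[of r \<theta> b] \<open>r > 0\<close> assms(3) by simp
    finally show ?thesis using real by simp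
  qed
qed

text \<open>The sandwiched divergence of a pure state at order \<alpha> = 1 / (1 + t), as long as
  the support condition is not violated.\<close>

definition moment_divergence :: "real \<Rightarrow> ('a::complex_hilbert_space \<Rightarrow> 'a) \<Rightarrow> 'a \<Rightarrow> real \<Rightarrow> ereal"
  where "moment_divergence b \<sigma> \<psi> t = ereal (- 1 / t) * elog b (spectral_moment \<sigma> \<psi> t)"

text \<open>The prefactor - 1 / t changes sign at 0, so the comparison is made on each side of 0
  separately, by contracting t towards 0.\<close>

lemma moment_divergence_mult:
  assumes "positive_op \<sigma>" "spectral_moment \<sigma> \<psi> 0 \<le> 1" "0 < \<theta>" "\<theta> \<le> 1" "b > 1"
  shows "t > 0 \<Longrightarrow> moment_divergence b \<sigma> \<psi> t \<le> moment_divergence b \<sigma> \<psi> (\<theta> * t)"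
    "t < 0 \<Longrightarrow> moment_divergence b \<sigma> \<psi> (\<theta> * t) \<le> moment_divergence b \<sigma> \<psi> t"
proof -
  let ?X = "elog b (spectral_moment \<sigma> \<psi> (\<theta> * t))" and ?Y = "elog b (spectral_moment \<sigma> \<psi> t)"
  note le = elog_spectral_moment_mult[OF assms, of t]
  have eq: "ereal (1 / (\<theta> * t)) * (ereal \<theta> * ?Y) = ereal (1 / t) * ?Y"
    unfolding mult.assoc[symmetric] using assms(3) by simp
  show "moment_divergence b \<sigma> \<psi> t \<le> moment_divergence b \<sigma> \<psi> (\<theta> * t)" if "t > 0"
  proof -
    have "ereal (1 / (\<theta> * t)) * ?X \<le> ereal (1 / t) * ?Y"
      unfolding eq[symmetric] by (intro ereal_mult_left_mono le) (use that assms(3) in simp)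
    then have "- (ereal (1 / t) * ?Y) \<le> - (ereal (1 / (\<theta> * t)) * ?X)"
      by (simp only: ereal_minus_le_minus)
    then show ?thesis
      by (simp add: moment_divergence_def flip: ereal_mult_minus_left)
  qed
  show "moment_divergence b \<sigma> \<psi> (\<theta> * t) \<le> moment_divergence b \<sigma> \<psi> t" if "t < 0"
  proof -
    have "ereal (- 1 / (\<theta> * t)) * ?X \<le> ereal (- 1 / (\<theta> * t)) * (ereal \<theta> * ?Y)"
      by (intro ereal_mult_left_mono le) (use that assms(3) in \<open>simp add: field_simps mult_le_0_iff\<close>)
    also have "\<dots> = ereal (- 1 / t) * ?Y"
      unfolding mult.assoc[symmetric] using assms(3) by simp
    finally show ?thesis by (simp add: moment_divergence_def)
  qed
qed

text \<open>The sign of the prefactor - 1 / t turns an upper bound on the moment for t > 0 and a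
  lower bound for t < 0 into the same lower bound on the divergence.\<close>

lemma moment_divergence_le:
  assumes "b > 1" "t \<noteq> 0" "c > 0"
  shows "t > 0 \<Longrightarrow> spectral_moment \<sigma> \<psi> t \<le> ennreal c \<Longrightarrow> ereal (- log b c / t) \<le> moment_divergence b \<sigma> \<psi> t"
    "t < 0 \<Longrightarrow> ennreal c \<le> spectral_moment \<sigma> \<psi> t \<Longrightarrow> ereal (- log b c / t) \<le> moment_divergence b \<sigma> \<psi> t"
    "spectral_moment \<sigma> \<psi> t = ennreal c \<Longrightarrow> moment_divergence b \<sigma> \<psi> t = ereal (- log b c / t)"
proof -
  show "spectral_moment \<sigma> \<psi> t = ennreal c \<Longrightarrow> moment_divergence b \<sigma> \<psi> t = ereal (- log b c / t)"
    using assms(3) by (simp add: moment_divergence_def elog_ennreal)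
  show "ereal (- log b c / t) \<le> moment_divergence b \<sigma> \<psi> t" if t: "t > 0" and le: "spectral_moment \<sigma> \<psi> t \<le> ennreal c"
  proof -
    have "ereal (1 / t) * elog b (spectral_moment \<sigma> \<psi> t) \<le> ereal (1 / t) * ereal (log b c)"
      using elog_mono[OF assms(1) le] t assms(3) by (intro ereal_mult_left_mono) (simp_all add: elog_ennreal)
    then have "- (ereal (1 / t) * ereal (log b c)) \<le> - (ereal (1 / t) * elog b (spectral_moment \<sigma> \<psi> t))"
      by (simp only: ereal_minus_le_minus)
    then show ?thesis
      by (simp add: moment_divergence_def flip: ereal_mult_minus_left)
  qed
  show "ereal (- log b c / t) \<le> moment_divergence b \<sigma> \<psi> t" if t: "t < 0" and le: "ennreal c \<le> spectral_moment \<sigma> \<psi> t"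
  proof -
    have "ereal (- 1 / t) * ereal (log b c) \<le> ereal (- 1 / t) * elog b (spectral_moment \<sigma> \<psi> t)"
      using elog_mono[OF assms(1) le] t assms(3) by (intro ereal_mult_left_mono) (simp_all add: elog_ennreal)
    then show ?thesis by (simp add: moment_divergence_def)
  qed
qed

lemma renyi_divergence_real_pure:
  assumes "positive_op \<sigma>" "discrete_spectrum UNIV \<sigma>" "norm \<psi> = 1" "\<alpha> > 0" "\<alpha> \<noteq> 1"
  shows "renyi_divergence_real b \<alpha> (ketbra \<psi> \<psi>) \<sigma> =
    (if \<alpha> \<ge> 1 \<and> \<not> (\<forall>y. \<sigma> y = 0 \<longrightarrow> cinner y \<psi> = 0) then \<infinity>
     else moment_divergence b \<sigma> \<psi> ((1 - \<alpha>) / \<alpha>))"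
proof -
  have "ereal (1 / (\<alpha> - 1)) * (ereal \<alpha> * X) = ereal (- 1 / ((1 - \<alpha>) / \<alpha>)) * X" for X
    unfolding mult.assoc[symmetric] using assms(4,5) by (simp add: minus_divide_right)
  then show ?thesis
    unfolding renyi_divergence_real_def moment_divergence_def support_ketbra_subset_iff[OF assms(3)]
      elog_sandwiched_trace_pure[OF assms(1,2,4)] by auto
qed

subsection \<open>Limits of monotone functions\<close>

lemma tendsto_SUP_at_left:
  fixes f :: "real \<Rightarrow> ereal"
  assumes "c < a" "\<And>x y. c < x \<Longrightarrow> x \<le> y \<Longrightarrow> y < a \<Longrightarrow> f x \<le> f y"
  shows "(f \<longlongrightarrow> (SUP x\<in>{c<..<a}. f x)) (at_left a)"
proof (rule order_tendstoI)
  fix l assume "l < (SUP x\<in>{c<..<a}. f x)"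
  then obtain x where x: "c < x" "x < a" "l < f x" by (auto simp: less_SUP_iff)
  have "\<forall>\<^sub>F y in at_left a. y \<in> {x<..<a}" by (rule eventually_at_left_real[OF x(2)])
  then show "\<forall>\<^sub>F y in at_left a. l < f y"
    by eventually_elim (use x assms(2) in \<open>auto intro: less_le_trans\<close>)
next
  fix l assume l: "(SUP x\<in>{c<..<a}. f x) < l"
  have "\<forall>\<^sub>F y in at_left a. y \<in> {c<..<a}" by (rule eventually_at_left_real[OF assms(1)])
  then show "\<forall>\<^sub>F y in at_left a. f y < l"
    by eventually_elim (rule le_less_trans[OF SUP_upper l])
qed

lemma tendsto_SUP_at_top:
  fixes f :: "real \<Rightarrow> ereal"
  assumes "\<And>x y. c < x \<Longrightarrow> x \<le> y \<Longrightarrow> f x \<le> f y"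
  shows "(f \<longlongrightarrow> (SUP x\<in>{c<..}. f x)) at_top"
proof (rule order_tendstoI)
  fix l assume "l < (SUP x\<in>{c<..}. f x)"
  then obtain x where x: "c < x" "l < f x" by (auto simp: less_SUP_iff)
  have "\<forall>\<^sub>F y in at_top. x \<le> y" by (rule eventually_ge_at_top)
  then show "\<forall>\<^sub>F y in at_top. l < f y"
    by eventually_elim (use x assms in \<open>auto intro: less_le_trans\<close>)
next
  fix l assume l: "(SUP x\<in>{c<..}. f x) < l"
  have "\<forall>\<^sub>F y in at_top. c < y" by (rule eventually_gt_at_top)
  then show "\<forall>\<^sub>F y in at_top. f y < l"
    by eventually_elim (rule le_less_trans[OF SUP_upper l], simp)
qed

subsection \<open>Operators commuting with \<open>G\<close>\<close>

lemma bounded_linear_orth_proj: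
  assumes "closed_csubspace M"
  shows "bounded_linear (orth_proj M)"
proof (rule bounded_linear_intro[where K = 1])
  show "orth_proj M (r *\<^sub>R x) = r *\<^sub>R orth_proj M x" for r x
    by (simp add: scaleR_scaleC orth_proj_scaleC[OF assms])
  show "norm (orth_proj M x) \<le> norm x * 1" for x
  proof (cases "norm (orth_proj M x) = 0")
    case False
    have "(norm (orth_proj M x))\<^sup>2 = cmod (cinner x (orth_proj M x))"
      unfolding cinner_orth_proj_self(1)[OF assms] norm_of_real by simp
    also have "\<dots> \<le> norm x * norm (orth_proj M x)"
      by (rule cinner_bound)
    finally show ?thesis using False by (simp add: power2_eq_square)
  qed simp
qed (rule orth_proj_add[OF assms])

text \<open>By symmetry of \<sigma>, invariance of M passes to its orthogonal complement.\<close>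

lemma orth_proj_commute:
  assumes "positive_op \<sigma>" "closed_csubspace M" "\<And>x. x \<in> M \<Longrightarrow> \<sigma> x \<in> M"
  shows "\<sigma> (orth_proj M x) = orth_proj M (\<sigma> x)"
proof (rule orth_proj_unique[OF assms(2), symmetric])
  show "\<sigma> (orth_proj M x) \<in> M" by (intro assms(3) orth_proj_in assms(2))
  fix z assume z: "z \<in> M"
  have "cinner z (\<sigma> x - \<sigma> (orth_proj M x)) = cinner (\<sigma> z) (x - orth_proj M x)"
    using positive_op_symmetric[OF assms(1)] bounded_opD(3)[OF positive_opD(1)[OF assms(1)]] by metis
  also have "\<dots> = 0" by (rule cinner_orth_proj[OF assms(2) assms(3)[OF z]])
  finally show "cinner z (\<sigma> x - \<sigma> (orth_proj M x)) = 0" .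
qed

text \<open>Let y be the projection of x onto the eigenspace and z that of y onto M. As \<sigma>
  commutes with the projection onto M, z is in the eigenspace again, so y - z is orthogonal to x -
  y. It is also orthogonal to M, which contains x and z, hence to itself.\<close>

lemma eigenproj_invariant:
  assumes "positive_op \<sigma>" "closed_csubspace M" "\<And>x. x \<in> M \<Longrightarrow> \<sigma> x \<in> M" "x \<in> M"
  shows "eigenproj UNIV \<sigma> g x \<in> M"
proof -
  let ?N = "eigenspace UNIV \<sigma> g"
  have N: "closed_csubspace ?N"
    by (rule closed_csubspace_eigenspace[OF self_adjoint_positive_op[OF assms(1)]])
  define y where "y = orth_proj ?N x"
  define z where "z = orth_proj M y"
  have y: "y \<in> ?N" unfolding y_def by (rule orth_proj_in[OF N])
  then have "\<sigma> z = g *\<^sub>C z"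
    using orth_proj_commute[OF assms(1-3), where x = y] orth_proj_scaleC[OF assms(2), of g y]
    by (simp add: z_def eigenspace_iff)
  then have "y - z \<in> ?N"
    using y closed_csubspaceD(5)[OF N] by (simp add: eigenspace_iff)
  then have 1: "cinner (y - z) (x - y) = 0"
    unfolding y_def by (rule cinner_orth_proj[OF N])
  have 2: "cinner (y - z) w = 0" if "w \<in> M" for w
    using cinner_orth_proj[OF assms(2) that, of y] cinner_commute[of "y - z" w] by (simp add: z_def)
  have "z \<in> M" unfolding z_def by (rule orth_proj_in[OF assms(2)])
  then have "cinner (y - z) (y - z) = 0"
    using 1 2[of z] 2[OF assms(4)] by (simp add: cinner_diff_right)
  then have "y = z" by simp
  then show ?thesis using \<open>z \<in> M\<close> by (simp add: y_def eigenproj_def)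
qed

subsection \<open>The eigencomponents of a pure state\<close>

locale pure_state =
  fixes G :: "'a::complex_hilbert_space \<Rightarrow> 'a" and D :: "'a set" and \<psi> :: 'a and b :: real
  assumes b: "b > 1" and sa: "self_adjoint D G" and ds: "discrete_spectrum D G" and unit: "norm \<psi> = 1"
begin

definition component :: "complex \<Rightarrow> 'a" where "component k = eigenproj D G k \<psi>"
text \<open>Leaving out the vanishing components makes \<open>p\<close> positive, so that negative
  powers of the weights are harmless, and makes every \<open>u k\<close> a unit vector.\<close>

definition K :: "complex set" where "K = {k \<in> eigenvalues D G. component k \<noteq> 0}"
definition p :: "complex \<Rightarrow> real" where "p k = (norm (component k))\<^sup>2"
definition u :: "complex \<Rightarrow> 'a" where "u k = (1 / norm (component k)) *\<^sub>R component k"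

lemma component_in: "component k \<in> eigenspace D G k"
  unfolding component_def by (rule eigenproj_in[OF sa])

lemma closed_eigenspace: "closed_csubspace (eigenspace D G k)"
  by (rule closed_csubspace_eigenspace[OF sa])

lemma u_in: "u k \<in> eigenspace D G k"
  unfolding u_def by (rule closed_csubspaceD(6)[OF closed_eigenspace component_in])

lemma component_eq: "component k = norm (component k) *\<^sub>R u k"
  by (simp add: u_def)

lemma p_pos: "k \<in> K \<Longrightarrow> p k > 0"
  by (simp add: K_def p_def)

lemma p_nonneg: "p k \<ge> 0"
  by (simp add: p_def)

lemma orthonormal_u: "orthonormal u K"
  unfolding orthonormal_def
proof (intro ballI)
  fix k l assume "k \<in> K" "l \<in> K"
  then show "cinner (u k) (u l) = (if k = l then 1 else 0)"
    using eigenspace_orthogonal[OF sa u_in u_in, of k l]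
    by (auto simp: u_def cinner_scaleR_left cinner_scaleR_right cinner_self K_def power2_eq_square)
qed

lemma has_sum_component: "(component has_sum \<psi>) K"
proof -
  have "(component has_sum \<psi>) (eigenvalues D G)"
    using ds unfolding discrete_spectrum_def component_def by blast
  then show ?thesis
    by (rule has_sum_cong_neutral[THEN iffD1, rotated -1]) (auto simp: K_def)
qed

lemma orth_family_component: "orth_family component I"
  using orth_family_eigenproj[OF sa, of "\<lambda>_. 1" \<psi>] by (simp add: component_def[abs_def])

lemma has_sum_p: "(p has_sum 1) K"
  using has_sum_norm_orth_family[OF orth_family_component has_sum_component] unit by (simp add: p_def[abs_def])

lemma sum_p_le:
  assumes "finite F" "F \<subseteq> K"
  shows "sum p F \<le> 1"
  by (rule finite_sum_le_has_sum[OF has_sum_p assms]) (simp add: p_nonneg)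

lemma p_le: "k \<in> K \<Longrightarrow> p k \<le> 1"
  using sum_p_le[of "{k}"] by simp

lemma K_nonempty: "K \<noteq> {}"
  using has_sum_p has_sum_unique[OF has_sum_empty, of p 1] by auto

lemma cinner_u_psi: "k \<in> K \<Longrightarrow> (cmod (cinner (u k) \<psi>))\<^sup>2 = p k"
  using cinner_orth_proj_self(2)[OF closed_eigenspace, of k \<psi>]
  by (simp add: u_def cinner_scaleR_left component_def[symmetric] eigenproj_def[symmetric] p_def K_def
      norm_mult norm_divide power2_eq_square)

lemma diagonal_p: "diagonal u p K 1"
  by standard (auto simp: orthonormal_u p_pos p_le)

text \<open>Projecting |psi><psi| on both sides by P_k leaves the rank-one operator of the component
  psi_k, that is p_k |u_k><u_k|. This exhibits the nonzero spectrum of the pinched state.\<close>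

lemma pinching_eq: "pinching D G (ketbra \<psi> \<psi>) = diag_op u p K"
proof
  fix x
  have "eigenproj D G k (ketbra \<psi> \<psi> (eigenproj D G k x)) = cinner (component k) x *\<^sub>C component k" for k
    using orth_proj_symmetric[OF closed_eigenspace, of k \<psi> x] orth_proj_scaleC[OF closed_eigenspace]
    by (simp add: ketbra_def eigenproj_def component_def)
  moreover have "cinner (component k) x *\<^sub>C component k = (of_real (p k) * cinner (u k) x) *\<^sub>C u k" if "k \<in> K" for k
    using that by (simp add: p_def u_def K_def cinner_scaleR_left scaleR_scaleC scaleC_scaleC cinner_scaleC_left power2_eq_square)
  ultimately show "pinching D G (ketbra \<psi> \<psi>) x = diag_op u p K x"
    unfolding pinching_def diag_op_def by (intro infsum_cong_neutral) (auto simp: K_def)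
qed

text \<open>The \<open>u k\<close> are eigenvectors of G with real eigenvalues, so the series for <G
  y, T x> and <y, T G x> agree term by term for y in D. Self-adjointness of G then yields both
  \<open>T x \<in> D\<close> and the value of \<open>G (T x)\<close>.\<close>

lemma commutes_diag_op:
  assumes "diagonal u q L C"
  shows "commutes (diag_op u q L) D G"
  unfolding commutes_def
proof
  interpret diagonal u q L C by fact
  fix x assume x: "x \<in> D"
  have "cinner (G y) (T x) = cinner y (T (G x))" if y: "y \<in> D" for y
  proof (rule has_sum_unique[OF has_sum_cinner_diag_op])
    have "of_real (q k) * cinner (G y) (u k) * cinner (u k) x = of_real (q k) * cinner y (u k) * cinner (u k) (G x)" if "k \<in> L" for k
    proof -
      have uk: "u k \<in> D" "G (u k) = k *\<^sub>C u k" using u_in by (auto simp: eigenspace_iff)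
      have "u k \<noteq> 0" using orthonormal_norm[OF on that] by auto
      then have "cnj k = k"
        using u_in by (intro eigenvalue_real(2)[OF sa]) (auto simp: eigenvalues_def)
      then have "cinner (u k) (G x) = k * cinner (u k) x"
        using self_adjoint_symmetric[OF sa uk(1) x] uk by (simp add: cinner_scaleC_left)
      moreover have "cinner (G y) (u k) = k * cinner y (u k)"
        using self_adjoint_symmetric[OF sa y uk(1)] uk by (simp add: cinner_scaleC_right)
      ultimately show ?thesis by simp
    qed
    then show "((\<lambda>k. of_real (q k) * cinner (G y) (u k) * cinner (u k) x) has_sum cinner y (T (G x))) L"
      using has_sum_cinner_diag_op[of y "G x"] by (subst has_sum_cong) auto
  qed
  then show "T x \<in> D \<and> G (T x) = T (G x)"
    using self_adjointD(6)[OF sa, of "T x" "T (G x)"] by auto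
qed

lemma density_op_diag_op:
  assumes "diagonal u q L C" "(q has_sum 1) L"
  shows "density_op (diag_op u q L)"
proof -
  interpret diagonal u q L C by fact
  have "op_trace T = ennreal 1"
    unfolding op_trace_diag_op by (rule has_sum_ennreal[OF assms(2) q_nonneg])
  then show ?thesis
    using positive_op_diag_op unfolding density_op_def positive_op_def by simp
qed

lemma spectral_moment_diag_op:
  assumes "diagonal u q L C" "L \<subseteq> K"
  shows "spectral_moment (diag_op u q L) \<psi> t = (\<Sum>\<^sub>\<infinity>k\<in>L. ennreal (q k powr t * p k))"
  unfolding spectral_moment_def diagonal.infsum_eigenvalues_diag_op[OF assms(1), of "\<lambda>x. x powr t", simplified]
  by (rule infsum_cong) (use assms(2) cinner_u_psi in auto)

lemma kernel_diag_op:
  assumes "diagonal u q K C" "diag_op u q K y = 0"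
  shows "cinner y \<psi> = 0"
proof (rule has_sum_unique[OF has_sum_cinner_right[OF has_sum_component]])
  have "cinner y (component k) = 0" if "k \<in> K" for k
    using diagonal.diag_op_eq_0[OF assms that] cinner_commute[of y "u k"]
    by (subst component_eq) (simp add: cinner_scaleR_right)
  then show "((\<lambda>k. cinner y (component k)) has_sum 0) K" by (rule has_sum_0)
qed

section \<open>States commuting with G and their spectral moments\<close>

definition admissible :: "('a \<Rightarrow> 'a) \<Rightarrow> bool"
  where "admissible \<sigma> \<longleftrightarrow> density_op \<sigma> \<and> commutes \<sigma> D G"

text \<open>The support condition of the divergence, by
  \<open>support_ketbra_subset_iff\<close>.\<close>

definition kernel_orth :: "('a \<Rightarrow> 'a) \<Rightarrow> bool"
  where "kernel_orth \<sigma> \<longleftrightarrow> (\<forall>y. \<sigma> y = 0 \<longrightarrow> cinner y \<psi> = 0)"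

lemma admissibleD:
  assumes "admissible \<sigma>"
  shows "positive_op \<sigma>" "discrete_spectrum UNIV \<sigma>" "op_trace \<sigma> = 1"
    "x \<in> eigenspace D G k \<Longrightarrow> \<sigma> x \<in> eigenspace D G k"
proof -
  show pos: "positive_op \<sigma>" "op_trace \<sigma> = 1"
    using assms by (auto simp: admissible_def density_op_def positive_op_def)
  then show "discrete_spectrum UNIV \<sigma>"
    by (intro positive_op_discrete_spectrum) auto
  show "x \<in> eigenspace D G k \<Longrightarrow> \<sigma> x \<in> eigenspace D G k"
    using assms bounded_opD(4)[OF positive_opD(1)[OF pos(1)]]
    by (auto simp: admissible_def commutes_def eigenspace_iff)
qed

lemma sum_diagonal_le:
  assumes "admissible \<sigma>" "finite F" "F \<subseteq> K"
  shows "(\<Sum>k\<in>F. Re (cinner (u k) (\<sigma> (u k)))) \<le> 1"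
proof -
  have "ennreal (\<Sum>k\<in>F. Re (cinner (u k) (\<sigma> (u k)))) \<le> 1"
    using sum_le_op_trace[OF admissibleD(1)[OF assms(1)] orthonormal_subset[OF orthonormal_u assms(3)] assms(2)]
      admissibleD(3)[OF assms(1)] by simp
  then show ?thesis by simp
qed

lemma expectation_component:
  assumes "admissible \<sigma>"
  shows "Re (cinner (component k) (\<sigma> (component k))) = p k * Re (cinner (u k) (\<sigma> (u k)))"
  using bounded_opD(5)[OF positive_opD(1)[OF admissibleD(1)[OF assms]], of "norm (component k)" "u k"]
  by (subst (1 2) component_eq) (simp add: cinner_scaleR_left cinner_scaleR_right p_def power2_eq_square)

text \<open>The spectral projections of \<sigma> leave the eigenspaces of G invariant, so the
  vectors P_g psi_k are orthogonal for different k and Pythagoras applies to each eigenvalue g of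
  \<sigma>.\<close>

lemma spectral_moment_split:
  assumes "admissible \<sigma>"
  shows "spectral_moment \<sigma> \<psi> t = (\<Sum>\<^sub>\<infinity>k\<in>K. spectral_moment \<sigma> (component k) t)"
proof -
  note pos = admissibleD(1)[OF assms]
  let ?P = "eigenproj UNIV \<sigma>"
  have "ennreal (Re g powr t * (norm (?P g \<psi>))\<^sup>2) = (\<Sum>\<^sub>\<infinity>k\<in>K. ennreal (Re g powr t * (norm (?P g (component k)))\<^sup>2))" for g
  proof (rule has_sum_ennreal[symmetric])
    have "orth_family (\<lambda>k. ?P g (component k)) K"
      unfolding orth_family_def
      using eigenspace_orthogonal[OF sa eigenproj_invariant[OF pos closed_eigenspace admissibleD(4)[OF assms] component_in]
          eigenproj_invariant[OF pos closed_eigenspace admissibleD(4)[OF assms] component_in]] by blast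
    moreover have "((\<lambda>k. ?P g (component k)) has_sum ?P g \<psi>) K"
      unfolding eigenproj_def[of UNIV]
      by (intro has_sum_bounded_linear[OF bounded_linear_orth_proj has_sum_component]
          closed_csubspace_eigenspace self_adjoint_positive_op pos)
    ultimately have "((\<lambda>k. (norm (?P g (component k)))\<^sup>2) has_sum (norm (?P g \<psi>))\<^sup>2) K"
      by (rule has_sum_norm_orth_family)
    then show "((\<lambda>k. Re g powr t * (norm (?P g (component k)))\<^sup>2) has_sum Re g powr t * (norm (?P g \<psi>))\<^sup>2) K"
      by (rule has_sum_cmult_right)
  qed simp
  then show ?thesis
    unfolding spectral_moment_def by (simp add: infsum_swap_ennreal[of _ "eigenvalues UNIV \<sigma>"])
qed

text \<open>\<sigma> commutes with the eigenprojections of G, so these preserve its kernel and the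
  support condition for \<psi> passes to the components.\<close>

lemma kernel_orth_component:
  assumes "admissible \<sigma>" "kernel_orth \<sigma>" "\<sigma> y = 0"
  shows "cinner y (component k) = 0"
proof -
  have "\<sigma> (eigenproj D G k y) = eigenproj D G k (\<sigma> y)"
    unfolding eigenproj_def by (rule orth_proj_commute[OF admissibleD(1)[OF assms(1)] closed_eigenspace admissibleD(4)[OF assms(1)]])
  also have "\<dots> = 0"
    using eigenproj_eigenspace[OF sa closed_csubspaceD(2)[OF closed_eigenspace], of k k] assms(3) by simp
  finally have "cinner (eigenproj D G k y) \<psi> = 0"
    using assms(2) by (simp add: kernel_orth_def)
  then show ?thesis
    unfolding component_def eigenproj_def by (simp add: orth_proj_symmetric[OF closed_eigenspace])
qed

text \<open>The diagonal entries and the weights both sum to at most 1, so the tangents at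
  \<open>r k\<close> add up to at most c (t + (1 - t)). An inequality instead of an equality for c
  also covers t = 1, where the coefficients are the \<open>p k\<close> and c is the largest of
  them.\<close>

lemma spectral_moment_le_of_weights:
  assumes "admissible \<sigma>" "0 \<le> t" "t \<le> 1" "c \<ge> 0"
    and r: "\<And>k. k \<in> K \<Longrightarrow> r k > 0" "\<And>k. k \<in> K \<Longrightarrow> r k powr (t - 1) * p k \<le> c"
    and r1: "\<And>F. finite F \<Longrightarrow> F \<subseteq> K \<Longrightarrow> sum r F \<le> 1"
  shows "spectral_moment \<sigma> \<psi> t \<le> ennreal c"
  unfolding spectral_moment_split[OF assms(1)]
proof (rule infsum_ennreal_le)
  fix F assume F: "finite F" "F \<subseteq> K"
  note pos = admissibleD(1,2)[OF assms(1)]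
  let ?q = "\<lambda>k. Re (cinner (u k) (\<sigma> (u k)))"
  have q0: "?q k \<ge> 0" for k by (rule positive_opD(2)[OF pos(1)])
  have "spectral_moment \<sigma> (component k) t \<le> ennreal (c * (t * ?q k + (1 - t) * r k))" if "k \<in> F" for k
  proof -
    have k: "k \<in> K" using that F by blast
    have "spectral_moment \<sigma> (component k) t \<le>
        ennreal (t * r k powr (t - 1) * (p k * ?q k) + (1 - t) * r k powr t * p k)"
      using spectral_moment_le[OF pos r(1)[OF k] assms(2,3), of "component k"]
      by (simp only: expectation_component[OF assms(1)] p_def[symmetric])
    also have "t * r k powr (t - 1) * (p k * ?q k) + (1 - t) * r k powr t * p k =
        (r k powr (t - 1) * p k) * (t * ?q k + (1 - t) * r k)"
      using powr_add[of "r k" "t - 1" 1] r(1)[OF k] by (simp add: algebra_simps)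
    also have "ennreal \<dots> \<le> ennreal (c * (t * ?q k + (1 - t) * r k))"
      using assms(2,3) q0 r(1)[OF k] by (intro ennreal_leI mult_right_mono r(2)[OF k] add_nonneg_nonneg mult_nonneg_nonneg) auto
    finally show ?thesis .
  qed
  then have "(\<Sum>k\<in>F. spectral_moment \<sigma> (component k) t) \<le> (\<Sum>k\<in>F. ennreal (c * (t * ?q k + (1 - t) * r k)))"
    by (rule sum_mono)
  also have "\<dots> = ennreal (\<Sum>k\<in>F. c * (t * ?q k + (1 - t) * r k))"
    using F assms(2-4) q0 r(1) by (intro sum_ennreal mult_nonneg_nonneg add_nonneg_nonneg) (auto intro: less_imp_le)
  also have "(\<Sum>k\<in>F. c * (t * ?q k + (1 - t) * r k)) = c * (t * sum ?q F + (1 - t) * sum r F)"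
    by (simp add: sum_distrib_left[symmetric] sum.distrib)
  also have "\<dots> \<le> c * (t * 1 + (1 - t) * 1)"
    using assms(2-4) by (intro mult_left_mono add_mono sum_diagonal_le[OF assms(1) F] r1[OF F]) auto
  finally show "(\<Sum>k\<in>F. spectral_moment \<sigma> (component k) t) \<le> ennreal c"
    by (simp add: ennreal_leI)
qed

text \<open>The components outside F only add to the moment, and a finite F admits weights of sum 1
  even where the full normalising sum diverges. The sum must be exactly 1, because the weights now
  stand on the smaller side of the estimate.\<close>

lemma spectral_moment_ge_of_weights:
  assumes "admissible \<sigma>" "kernel_orth \<sigma>" "t < 0" "c \<ge> 0" "finite F" "F \<subseteq> K"
    and r: "\<And>k. k \<in> F \<Longrightarrow> r k > 0" "\<And>k. k \<in> F \<Longrightarrow> r k powr (t - 1) * p k = c"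
    and r1: "sum r F = 1"
  shows "ennreal c \<le> spectral_moment \<sigma> \<psi> t"
proof -
  note pos = admissibleD(1,2)[OF assms(1)]
  let ?q = "\<lambda>k. Re (cinner (u k) (\<sigma> (u k)))"
  have q0: "?q k \<ge> 0" for k by (rule positive_opD(2)[OF pos(1)])
  have "ennreal ((1 - t) * c * r k) \<le> spectral_moment \<sigma> (component k) t + ennreal ((- t) * c * ?q k)" if k: "k \<in> F" for k
  proof -
    have "(1 - t) * c * r k = (1 - t) * r k powr t * (norm (component k))\<^sup>2"
      using powr_add[of "r k" "t - 1" 1] r[OF k] by (simp add: p_def[symmetric] flip: r(2)[OF k])
    moreover have "(- t) * r k powr (t - 1) * Re (cinner (component k) (\<sigma> (component k))) = (- t) * c * ?q k"
      unfolding expectation_component[OF assms(1)] r(2)[OF k, symmetric] by simp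
    ultimately show ?thesis
      using spectral_moment_ge[OF pos r(1)[OF k] less_imp_le[OF assms(3)] kernel_orth_component[OF assms(1,2), of _ k]]
      by (simp only:)
  qed
  then have "(\<Sum>k\<in>F. ennreal ((1 - t) * c * r k)) \<le> (\<Sum>k\<in>F. spectral_moment \<sigma> (component k) t + ennreal ((- t) * c * ?q k))"
    by (rule sum_mono)
  also have "\<dots> = (\<Sum>k\<in>F. spectral_moment \<sigma> (component k) t) + (\<Sum>k\<in>F. ennreal ((- t) * c * ?q k))"
    by (rule sum.distrib)
  also have "\<dots> \<le> spectral_moment \<sigma> \<psi> t + ennreal ((- t) * c)"
  proof (rule add_mono)
    show "(\<Sum>k\<in>F. spectral_moment \<sigma> (component k) t) \<le> spectral_moment \<sigma> \<psi> t"
      unfolding spectral_moment_split[OF assms(1)] by (rule sum_le_infsum_ennreal[OF assms(5,6)])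
    have "(\<Sum>k\<in>F. ennreal ((- t) * c * ?q k)) = ennreal (\<Sum>k\<in>F. (- t) * c * ?q k)"
      using assms(3,4) q0 by (intro sum_ennreal mult_nonneg_nonneg) auto
    also have "(\<Sum>k\<in>F. (- t) * c * ?q k) = (- t) * c * sum ?q F"
      by (rule sum_distrib_left[symmetric])
    also have "\<dots> \<le> (- t) * c * 1"
      using assms(3,4) by (intro mult_left_mono sum_diagonal_le[OF assms(1,5,6)]) (auto intro: mult_nonpos_nonneg)
    finally show "(\<Sum>k\<in>F. ennreal ((- t) * c * ?q k)) \<le> ennreal ((- t) * c)"
      by (simp add: ennreal_leI)
  qed
  also have "(\<Sum>k\<in>F. ennreal ((1 - t) * c * r k)) = ennreal (\<Sum>k\<in>F. (1 - t) * c * r k)"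
    using assms(3,4) r(1) by (intro sum_ennreal mult_nonneg_nonneg) (auto intro: less_imp_le)
  also have "(\<Sum>k\<in>F. (1 - t) * c * r k) = c + (- t) * c"
    unfolding sum_distrib_left[symmetric] r1 by (simp add: algebra_simps)
  \<comment> \<open>Split so that the finite summand \<open>(- t) * c\<close> cancels against the
    bound on the diagonal terms.\<close>
  also have "ennreal (c + (- t) * c) = ennreal c + ennreal ((- t) * c)"
    using assms(3,4) by (intro ennreal_plus) (auto intro: mult_nonpos_nonneg)
  finally show ?thesis
    by (simp add: ennreal_add_left_cancel_le add.commute[of _ "ennreal ((- t) * c)"])
qed

end

context pure_state
begin

abbreviation "P \<equiv> pinching D G (ketbra \<psi> \<psi>)"

subsection \<open>Entropies of the pinched state\<close>

lemma renyi_entropy_real_pinching: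
  assumes "\<beta> > 0"
  shows "renyi_entropy_real b \<beta> P = ereal (1 / (1 - \<beta>)) * elog b (\<Sum>\<^sub>\<infinity>k\<in>K. ennreal (p k powr \<beta>))"
  unfolding renyi_entropy_real_def op_powr_def pinching_eq
  using diagonal.op_trace_op_fun_diag_op[OF diagonal_p, of "\<lambda>x. x powr \<beta>" 1] assms p_le p_nonneg
  by (simp add: powr_le1)

lemma has_sum_powr_pos:
  assumes "((\<lambda>k. p k powr \<beta>) has_sum z) K"
  shows "z > 0"
proof -
  obtain k where k: "k \<in> K" using K_nonempty by blast
  have "p k powr \<beta> \<le> z"
    using finite_sum_le_has_sum[OF assms, of "{k}"] k by simp
  then show ?thesis using p_pos[OF k] by (smt (verit) powr_gt_zero)
qed

lemma renyi_entropy_real_has_sum: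
  assumes "\<beta> > 0" "((\<lambda>k. p k powr \<beta>) has_sum z) K"
  shows "renyi_entropy_real b \<beta> P = ereal (1 / (1 - \<beta>) * log b z)"
  using has_sum_ennreal[OF assms(2)] has_sum_powr_pos[OF assms(2)]
  by (simp add: renyi_entropy_real_pinching[OF assms(1)] elog_ennreal)

lemma has_sum_p_powr_ge_1:
  assumes "\<beta> \<ge> 1"
  obtains z where "((\<lambda>k. p k powr \<beta>) has_sum z) K"
proof -
  have "(\<lambda>k. p k powr \<beta>) summable_on K"
  proof (rule summable_on_comparison_test)
    show "p summable_on K" using has_sum_p by (auto simp: summable_on_def)
    show "p k powr \<beta> \<le> p k" if "k \<in> K" for k
      using powr_le_one_le[OF p_pos[OF that] p_le[OF that] assms] .
  qed simp
  then show ?thesis using that has_sum_infsum by blast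
qed

text \<open>For \<beta> < 1 the prefactor is positive, so bounds on finite partial sums pass to the
  full sum. For finite X they show in particular that the full sum is finite.\<close>

lemma renyi_entropy_real_le:
  assumes "0 < \<beta>" "\<beta> < 1"
    and le: "\<And>F. finite F \<Longrightarrow> F \<subseteq> K \<Longrightarrow> F \<noteq> {} \<Longrightarrow> ereal (1 / (1 - \<beta>) * log b (\<Sum>k\<in>F. p k powr \<beta>)) \<le> X"
  shows "renyi_entropy_real b \<beta> P \<le> X"
proof (cases X)
  case PInf then show ?thesis by simp
next
  case MInf
  obtain k where "k \<in> K" using K_nonempty by blast
  then show ?thesis using le[of "{k}"] MInf by simp
next
  case (real x)
  have "(\<Sum>\<^sub>\<infinity>k\<in>K. ennreal (p k powr \<beta>)) \<le> ennreal (b powr ((1 - \<beta>) * x))"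
  proof (rule infsum_ennreal_le)
    fix F assume F: "finite F" "F \<subseteq> K"
    show "(\<Sum>k\<in>F. ennreal (p k powr \<beta>)) \<le> ennreal (b powr ((1 - \<beta>) * x))"
    proof (cases "F = {}")
      case False
      define z where "z = (\<Sum>k\<in>F. p k powr \<beta>)"
      have "z > 0" unfolding z_def using F False p_pos by (intro sum_pos) fastforce+
      have "log b z \<le> (1 - \<beta>) * x"
        using le[OF F False] assms(2) real by (simp add: z_def[symmetric] field_simps)
      then have "z \<le> b powr ((1 - \<beta>) * x)"
        using b \<open>z > 0\<close> by (simp add: log_le_iff)
      then show ?thesis by (simp add: z_def sum_ennreal ennreal_leI)
    qed simp
  qed
  then have "elog b (\<Sum>\<^sub>\<infinity>k\<in>K. ennreal (p k powr \<beta>)) \<le> ereal ((1 - \<beta>) * x)"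
    using elog_mono[OF b, of _ "ennreal (b powr ((1 - \<beta>) * x))"] b by (simp add: elog_ennreal)
  then have "ereal (1 / (1 - \<beta>)) * elog b (\<Sum>\<^sub>\<infinity>k\<in>K. ennreal (p k powr \<beta>)) \<le> ereal (1 / (1 - \<beta>)) * ereal ((1 - \<beta>) * x)"
    using assms(2) by (intro ereal_mult_left_mono) auto
  then show ?thesis
    using assms real by (simp add: renyi_entropy_real_pinching)
qed

lemma von_neumann_entropy_pinching:
  "von_neumann_entropy b P = enn2ereal (\<Sum>\<^sub>\<infinity>k\<in>K. ennreal (- (p k * log b (p k))))"
proof -
  have "0 \<le> - (p k * log b (p k)) \<and> - (p k * log b (p k)) \<le> 1 / ln b" if k: "k \<in> K" for k
  proof
    have "log b (p k) \<le> 0" using b p_pos[OF k] p_le[OF k] by simp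
    then show "0 \<le> - (p k * log b (p k))" using p_nonneg[of k] by (simp add: mult_nonneg_nonpos)
    \<comment> \<open>ln y \<le> y - 1 at y = 1 / p k leads to the upper bound on - p log p that
      \<open>op_trace_op_fun_diag_op\<close> asks for.\<close>
    have "- ln (p k) \<le> 1 / p k - 1"
      using ln_le_minus_one[of "1 / p k"] p_pos[OF k] by (simp add: ln_div)
    then have "p k * (- ln (p k)) \<le> p k * (1 / p k - 1)"
      using p_nonneg by (rule mult_left_mono)
    also have "\<dots> \<le> 1" using p_pos[OF k] by (simp add: algebra_simps)
    finally have "- (p k * ln (p k)) / ln b \<le> 1 / ln b"
      using b by (intro divide_right_mono) auto
    then show "- (p k * log b (p k)) \<le> 1 / ln b"
      by (simp add: log_def)
  qed
  then show ?thesis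
    unfolding von_neumann_entropy_def pinching_eq
    using diagonal.op_trace_op_fun_diag_op[OF diagonal_p, of "\<lambda>t. - (t * log b t)" "1 / ln b"] by simp
qed

text \<open>K may be infinite, but F carries all mass up to \<open>p k1\<close>, so no weight
  outside F exceeds \<open>p k1\<close>. A maximum over F and k1 is then a maximum over K.\<close>

lemma max_component:
  obtains k0 where "k0 \<in> K" "\<And>k. k \<in> K \<Longrightarrow> p k \<le> p k0"
proof -
  obtain k1 where k1: "k1 \<in> K" using K_nonempty by blast
  obtain F where F: "finite F" "F \<subseteq> K" "dist (sum p F) 1 \<le> p k1"
    using has_sum_finite_approximation[OF has_sum_p p_pos[OF k1]] by blast
  have out: "p k \<le> p k1" if "k \<in> K" "k \<notin> F" for k
    using sum_p_le[of "insert k F"] F that by (simp add: dist_real_def)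
  have fin: "finite (p ` insert k1 F)" "p ` insert k1 F \<noteq> {}" using F by auto
  obtain k0 where k0: "k0 \<in> insert k1 F" "p k0 = Max (p ` insert k1 F)"
    using Max_in[OF fin] by (metis imageE)
  then have in_F: "p k \<le> p k0" if "k \<in> insert k1 F" for k
    using Max_ge[OF fin(1), of "p k"] that k0(2) by (metis imageI)
  have "p k \<le> p k0" if "k \<in> K" for k
    using in_F[of k] in_F[of k1] out[OF that] by fastforce
  then show ?thesis using that k0(1) k1 F(2) by blast
qed

text \<open>Z lies between p_max^\<beta> and p_max^(\<beta> - 1), the latter because the p_k sum to
  1. This squeezes the entropy of order \<beta> between - log p_max and \<beta> / (\<beta> - 1)
  times that number.\<close>

lemma min_entropy:
  assumes "k0 \<in> K" and max: "\<And>k. k \<in> K \<Longrightarrow> p k \<le> p k0"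
  shows "renyi_entropy b \<infinity> P = ereal (- log b (p k0))"
proof -
  let ?m = "log b (p k0)"
  have bounds: "renyi_entropy_real b \<beta> P \<in> {ereal (- ?m) .. ereal (\<beta> / (\<beta> - 1) * (- ?m))}" if "\<beta> > 1" for \<beta>
  proof -
    obtain z where z: "((\<lambda>k. p k powr \<beta>) has_sum z) K"
      by (rule has_sum_p_powr_ge_1[of \<beta>]) (use \<open>\<beta> > 1\<close> in simp)
    have z0: "z > 0" by (rule has_sum_powr_pos[OF z])
    have pm: "p k0 > 0" by (rule p_pos[OF assms(1)])
    have "p k0 powr \<beta> \<le> z"
      using finite_sum_le_has_sum[OF z, of "{k0}"] assms(1) by simp
    then have "log b (p k0 powr \<beta>) \<le> log b z" using b pm z0 by simp
    then have lo: "\<beta> * ?m \<le> log b z" using pm by (simp add: log_powr)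
    have "z \<le> p k0 powr (\<beta> - 1) * 1"
    proof (rule has_sum_mono[OF z has_sum_cmult_right[OF has_sum_p]])
      fix k assume k: "k \<in> K"
      have "p k powr \<beta> = p k powr (\<beta> - 1) * p k"
        using powr_add[of "p k" "\<beta> - 1" 1] p_pos[OF k] by simp
      also have "\<dots> \<le> p k0 powr (\<beta> - 1) * p k"
        using that max[OF k] p_nonneg by (intro mult_right_mono powr_mono2) auto
      finally show "p k powr \<beta> \<le> p k0 powr (\<beta> - 1) * p k" .
    qed
    then have "log b z \<le> log b (p k0 powr (\<beta> - 1))" using b pm z0 by simp
    then have hi: "log b z \<le> (\<beta> - 1) * ?m" using pm by (simp add: log_powr)
    have "1 / (1 - \<beta>) * log b z = - log b z / (\<beta> - 1)"
      by (simp add: minus_divide_right)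
    moreover have "- ((\<beta> - 1) * ?m) / (\<beta> - 1) \<le> - log b z / (\<beta> - 1)"
      "- log b z / (\<beta> - 1) \<le> - (\<beta> * ?m) / (\<beta> - 1)"
      by (rule divide_right_mono; use that lo hi in simp)+
    ultimately show ?thesis
      using that by (simp add: renyi_entropy_real_has_sum[OF _ z])
  qed
  have ev: "\<forall>\<^sub>F \<beta> in at_top. (\<beta>::real) > 1" by (rule eventually_gt_at_top)
  have "((\<lambda>\<beta>::real. \<beta> / (\<beta> - 1) * (- ?m)) \<longlongrightarrow> - ?m) at_top"
  proof -
    have "((\<lambda>\<beta>::real. (1 + inverse (\<beta> - 1)) * (- ?m)) \<longlongrightarrow> (1 + 0) * (- ?m)) at_top"
      by (intro tendsto_intros tendsto_inverse_0_at_top filterlim_tendsto_add_at_top[of "\<lambda>_. - 1" "- 1", simplified] filterlim_ident)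
    moreover have "\<forall>\<^sub>F \<beta> in at_top. (1 + inverse (\<beta> - 1)) * (- ?m) = \<beta> / (\<beta> - 1) * (- ?m)"
      using ev by eventually_elim (simp add: field_simps)
    ultimately have "((\<lambda>\<beta>::real. \<beta> / (\<beta> - 1) * (- ?m)) \<longlongrightarrow> (1 + 0) * (- ?m)) at_top"
      by (rule Lim_transform_eventually)
    then show ?thesis by (simp only: add_0_right mult_1_left)
  qed
  then have "((\<lambda>\<beta>. ereal (\<beta> / (\<beta> - 1) * (- ?m))) \<longlongrightarrow> ereal (- ?m)) at_top"
    by (rule tendsto_ereal)
  then have "((\<lambda>\<beta>. renyi_entropy_real b \<beta> P) \<longlongrightarrow> ereal (- ?m)) at_top"
    by (rule tendsto_sandwich[rotated 3, where f = "\<lambda>_. ereal (- ?m)"])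
      (use bounds in \<open>auto intro!: eventually_mono[OF ev]\<close>)
  then show ?thesis
    unfolding renyi_entropy_def by (simp add: tendsto_Lim)
qed

subsection \<open>Bounds for states commuting with \<open>G\<close>\<close>

lemma renyi_divergence_real_admissible:
  assumes "admissible \<sigma>" "a > 0" "a \<noteq> 1"
  shows "renyi_divergence_real b a (ketbra \<psi> \<psi>) \<sigma> =
    (if a \<ge> 1 \<and> \<not> kernel_orth \<sigma> then \<infinity> else moment_divergence b \<sigma> \<psi> ((1 - a) / a))"
  unfolding kernel_orth_def
  by (rule renyi_divergence_real_pure[OF admissibleD(1,2)[OF assms(1)] unit assms(2,3)])

lemma moment_divergence_mono:
  assumes "admissible \<sigma>"
  shows "0 < t \<Longrightarrow> t \<le> t' \<Longrightarrow> moment_divergence b \<sigma> \<psi> t' \<le> moment_divergence b \<sigma> \<psi> t"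
    "t' < 0 \<Longrightarrow> t \<le> t' \<Longrightarrow> moment_divergence b \<sigma> \<psi> t' \<le> moment_divergence b \<sigma> \<psi> t"
proof -
  have m0: "spectral_moment \<sigma> \<psi> 0 \<le> 1"
    using spectral_moment_0(1)[OF admissibleD(1,2)[OF assms], of \<psi>] unit by simp
  show "moment_divergence b \<sigma> \<psi> t' \<le> moment_divergence b \<sigma> \<psi> t" if "0 < t" "t \<le> t'"
    using moment_divergence_mult(1)[OF admissibleD(1)[OF assms] m0 _ _ b, of "t / t'" t'] that by simp
  show "moment_divergence b \<sigma> \<psi> t' \<le> moment_divergence b \<sigma> \<psi> t" if "t' < 0" "t \<le> t'"
    using moment_divergence_mult(2)[OF admissibleD(1)[OF assms] m0 _ _ b, of "t' / t" t] that
    by (simp add: divide_simps)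
qed

section \<open>Conjugate orders and the optimal state\<close>

lemma weight_identity:
  fixes x z t \<beta> :: real
  assumes "x > 0" "z > 0" "t < 1" "\<beta> = 1 / (1 - t)"
  shows "(x powr \<beta> / z) powr (t - 1) * x = z powr (1 - t)"
    "(x powr \<beta> / z) powr t * x = z powr (- t) * x powr \<beta>"
proof -
  have "1 - t \<noteq> 0" using assms(3) by linarith
  \<comment> \<open>This determines \<beta>: in the power t - 1 of the weight
    \<open>x powr \<beta> / z\<close> the variable enters as 1 / x, which cancels the factor
    x.\<close>
  then have "\<beta> * (1 - t) = 1" using assms(4) by simp
  then have "\<beta> * (t - 1) = - 1" by (simp add: algebra_simps)
  then have "(x powr \<beta> / z) powr (t - 1) = x powr (- 1) * z powr (1 - t)"
    using assms(1,2) powr_minus_divide[of z "t - 1"] by (simp add: powr_divide powr_powr)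
  then show "(x powr \<beta> / z) powr (t - 1) * x = z powr (1 - t)"
    using assms(1) by (simp add: powr_minus)
  have "\<beta> * t + 1 = \<beta>" using assms(3,4) by (simp add: field_simps)
  then have "x powr (\<beta> * t) * x = x powr \<beta>"
    using powr_add[of x "\<beta> * t" 1] assms(1) by simp
  then show "(x powr \<beta> / z) powr t * x = z powr (- t) * x powr \<beta>"
    using assms(1,2) powr_minus[of z t] by (simp add: powr_divide powr_powr field_simps)
qed

text \<open>The logarithm of the bound Z^(1 - t) on the moment, divided by - t, is the entropy of
  order \<beta>, since (1 - t) / (- t) = 1 / (1 - \<beta>).\<close>

lemma conjugate_coefficient:
  fixes z t \<beta> :: real
  assumes "t < 1" "t \<noteq> 0" "\<beta> = 1 / (1 - t)" "z > 0"
  shows "- log b (z powr (1 - t)) / t = 1 / (1 - \<beta>) * log b z"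
proof -
  have "1 - \<beta> = - t / (1 - t)"
    using assms(1-3) by (simp add: field_simps)
  then have "1 / (1 - \<beta>) = 1 / (- t / (1 - t))" by (simp only:)
  also have "\<dots> = - (1 - t) / t" using assms(1,2) by (simp add: divide_simps)
  finally have "1 / (1 - \<beta>) = - (1 - t) / t" .
  moreover have "log b (z powr (1 - t)) = (1 - t) * log b z"
    using assms(4) by (simp add: log_powr)
  ultimately show ?thesis by (simp only: times_divide_eq_left minus_mult_left)
qed

lemma entropy_le_divergence_pos:
  assumes "admissible \<sigma>" "0 < t" "t < 1" "\<beta> = 1 / (1 - t)"
  shows "renyi_entropy_real b \<beta> P \<le> moment_divergence b \<sigma> \<psi> t"
proof -
  have "\<beta> \<ge> 1" using assms by simp
  obtain z where z: "((\<lambda>k. p k powr \<beta>) has_sum z) K"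
    using has_sum_p_powr_ge_1[OF \<open>\<beta> \<ge> 1\<close>] by blast
  have z0: "z > 0" by (rule has_sum_powr_pos[OF z])
  have "spectral_moment \<sigma> \<psi> t \<le> ennreal (z powr (1 - t))"
  proof (rule spectral_moment_le_of_weights[OF assms(1), where r = "\<lambda>k. p k powr \<beta> / z"])
    show "(p k powr \<beta> / z) powr (t - 1) * p k \<le> z powr (1 - t)" if "k \<in> K" for k
      using weight_identity(1)[OF p_pos[OF that] z0 assms(3,4)] by simp
    show "(\<Sum>k\<in>F. p k powr \<beta> / z) \<le> 1" if "finite F" "F \<subseteq> K" for F
      using finite_sum_le_has_sum[OF z that] z0 by (simp add: sum_divide_distrib[symmetric])
    show "p k powr \<beta> / z > 0" if "k \<in> K" for k
      using p_pos[OF that] z0 by simp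
  qed (use assms in auto)
  then have "ereal (- log b (z powr (1 - t)) / t) \<le> moment_divergence b \<sigma> \<psi> t"
    using assms(2) z0 by (intro moment_divergence_le[OF b]) auto
  then show ?thesis
    using conjugate_coefficient[OF assms(3) _ assms(4) z0] assms(2) \<open>\<beta> \<ge> 1\<close>
    by (simp add: renyi_entropy_real_has_sum[OF _ z])
qed

lemma finite_entropy_le_divergence_neg:
  assumes "admissible \<sigma>" "kernel_orth \<sigma>" "t < 0" "\<beta> = 1 / (1 - t)" "finite F" "F \<subseteq> K" "F \<noteq> {}"
  shows "ereal (1 / (1 - \<beta>) * log b (\<Sum>k\<in>F. p k powr \<beta>)) \<le> moment_divergence b \<sigma> \<psi> t"
proof -
  define z where "z = (\<Sum>k\<in>F. p k powr \<beta>)"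
  have t1: "t < 1" using assms(3) by simp
  have pF: "p k > 0" if "k \<in> F" for k using p_pos that assms(6) by blast
  have z0: "z > 0" unfolding z_def using assms(5,7) pF by (intro sum_pos) fastforce+
  have "ennreal (z powr (1 - t)) \<le> spectral_moment \<sigma> \<psi> t"
  proof (rule spectral_moment_ge_of_weights[OF assms(1-3) _ assms(5,6), where r = "\<lambda>k. p k powr \<beta> / z"])
    show "(p k powr \<beta> / z) powr (t - 1) * p k = z powr (1 - t)" if "k \<in> F" for k
      by (rule weight_identity(1)[OF pF[OF that] z0 t1 assms(4)])
    show "(\<Sum>k\<in>F. p k powr \<beta> / z) = 1"
      using z0 by (simp add: sum_divide_distrib[symmetric] z_def[symmetric])
    show "p k powr \<beta> / z > 0" if "k \<in> F" for k
      using pF[OF that] z0 by simp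
  qed simp
  then have "ereal (- log b (z powr (1 - t)) / t) \<le> moment_divergence b \<sigma> \<psi> t"
    using assms(3) z0 by (intro moment_divergence_le[OF b]) auto
  then show ?thesis
    using conjugate_coefficient[OF t1 _ assms(4) z0] assms(3) by (simp add: z_def)
qed

lemma optimal_state:
  assumes "t < 1" "\<beta> = 1 / (1 - t)" "((\<lambda>k. p k powr \<beta>) has_sum z) K"
  shows "admissible (diag_op u (\<lambda>k. p k powr \<beta> / z) K)"
    "kernel_orth (diag_op u (\<lambda>k. p k powr \<beta> / z) K)"
    "t \<noteq> 0 \<Longrightarrow> moment_divergence b (diag_op u (\<lambda>k. p k powr \<beta> / z) K) \<psi> t = renyi_entropy_real b \<beta> P"
proof -
  let ?q = "\<lambda>k. p k powr \<beta> / z"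
  have z0: "z > 0" by (rule has_sum_powr_pos[OF assms(3)])
  have q1: "(?q has_sum 1) K"
    using has_sum_cmult_left[OF assms(3), of "1 / z"] z0 by simp
  have diag: "diagonal u ?q K 1"
  proof
    show "?q k \<le> 1" if "k \<in> K" for k
      using finite_sum_le_has_sum[OF q1, of "{k}"] that z0 by simp
    show "?q k > 0" if "k \<in> K" for k
      using z0 p_pos[OF that] by simp
  qed (rule orthonormal_u)
  show "admissible (diag_op u ?q K)"
    unfolding admissible_def using density_op_diag_op[OF diag q1] commutes_diag_op[OF diag] by simp
  show "kernel_orth (diag_op u ?q K)"
    unfolding kernel_orth_def using kernel_diag_op[OF diag] by blast
  assume t0: "t \<noteq> 0"
  have "((\<lambda>k. ?q k powr t * p k) has_sum z powr (- t) * z) K"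
    using has_sum_cmult_right[OF assms(3), of "z powr (- t)"] weight_identity(2)[OF p_pos z0 assms(1,2)]
    by (subst has_sum_cong) auto
  also have "z powr (- t) * z = z powr (1 - t)"
    using powr_add[of z "- t" 1] z0 by simp
  finally have "spectral_moment (diag_op u ?q K) \<psi> t = ennreal (z powr (1 - t))"
    unfolding spectral_moment_diag_op[OF diag order_refl]
    by (rule has_sum_ennreal) (simp add: p_nonneg)
  then have "moment_divergence b (diag_op u ?q K) \<psi> t = ereal (- log b (z powr (1 - t)) / t)"
    using z0 t0 by (intro moment_divergence_le(3)[OF b]) auto
  also have "\<dots> = renyi_entropy_real b \<beta> P"
    unfolding conjugate_coefficient[OF assms(1) t0 assms(2) z0]
    using assms(1,2) by (intro renyi_entropy_real_has_sum[symmetric, OF _ assms(3)]) simp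
  finally show "moment_divergence b (diag_op u ?q K) \<psi> t = renyi_entropy_real b \<beta> P" .
qed

section \<open>The duality, order by order\<close>

lemma renyi_asymmetry_eqI:
  assumes "\<And>\<sigma>. admissible \<sigma> \<Longrightarrow> X \<le> renyi_divergence b \<alpha> (ketbra \<psi> \<psi>) \<sigma>"
    and "X \<noteq> \<infinity> \<Longrightarrow> \<exists>\<sigma>. admissible \<sigma> \<and> renyi_divergence b \<alpha> (ketbra \<psi> \<psi>) \<sigma> \<le> X"
  shows "renyi_asymmetry b \<alpha> D G (ketbra \<psi> \<psi>) = X"
  unfolding renyi_asymmetry_def
proof (rule antisym)
  show "(INF \<sigma>\<in>{\<sigma>. density_op \<sigma> \<and> commutes \<sigma> D G}. renyi_divergence b \<alpha> (ketbra \<psi> \<psi>) \<sigma>) \<le> X"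
  \<comment> \<open>An infinite X makes the upper bound trivial, so a minimising state is asked for
    only when X is not \<infinity>.\<close>
  proof (cases "X = \<infinity>")
    case False
    then show ?thesis using assms(2) by (auto simp: admissible_def intro: INF_lower2)
  qed simp
qed (rule INF_greatest, use assms(1) in \<open>auto simp: admissible_def\<close>)

text \<open>Here t = 1, and any weights give the coefficients p_k, bounded by the largest one. The
  pure state on that component attains the bound; its kernel need not be orthogonal to \<psi>, which
  is allowed for \<alpha> < 1.\<close>

lemma order_half:
  "renyi_asymmetry b (ereal (1 / 2)) D G (ketbra \<psi> \<psi>) = renyi_entropy b \<infinity> P"
proof -
  obtain k0 where k0: "k0 \<in> K" "\<And>k. k \<in> K \<Longrightarrow> p k \<le> p k0"
    using max_component by metis
  have pm: "p k0 > 0" by (rule p_pos[OF k0(1)])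
  have div: "renyi_divergence b (ereal (1 / 2)) (ketbra \<psi> \<psi>) \<sigma> = moment_divergence b \<sigma> \<psi> 1" if "admissible \<sigma>" for \<sigma>
    using renyi_divergence_real_admissible[OF that, of "1 / 2"] by (simp add: renyi_divergence_def one_ereal_def)
  have diag: "diagonal u (\<lambda>_. 1) {k0} 1"
    by standard (use orthonormal_subset[OF orthonormal_u, of "{k0}"] k0(1) in auto)
  have H: "renyi_entropy b \<infinity> P = ereal (- log b (p k0))"
    by (rule min_entropy[OF k0])
  show ?thesis
    unfolding H
  proof (rule renyi_asymmetry_eqI)
    fix \<sigma> assume adm: "admissible \<sigma>"
    have "spectral_moment \<sigma> \<psi> 1 \<le> ennreal (p k0)"
      by (rule spectral_moment_le_of_weights[OF adm, where r = p]) (auto simp: p_nonneg k0 p_pos sum_p_le)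
    then show "ereal (- log b (p k0)) \<le> renyi_divergence b (ereal (1 / 2)) (ketbra \<psi> \<psi>) \<sigma>"
      using moment_divergence_le(1)[OF b _ pm, of 1] by (simp add: div[OF adm])
  next
    let ?s = "diag_op u (\<lambda>_. 1) {k0}"
    have "((\<lambda>_. 1::real) has_sum 1) {k0}" by (rule has_sum_finiteI) auto
    then have adm: "admissible ?s"
      unfolding admissible_def
      using density_op_diag_op[OF diag] commutes_diag_op[OF diag] by simp
    have "spectral_moment ?s \<psi> 1 = ennreal (p k0)"
      using spectral_moment_diag_op[OF diag] k0(1) by simp
    then have "moment_divergence b ?s \<psi> 1 = ereal (- log b (p k0))"
      using moment_divergence_le(3)[OF b _ pm, of 1] by simp
    then show "\<exists>\<sigma>. admissible \<sigma> \<and> renyi_divergence b (ereal (1 / 2)) (ketbra \<psi> \<psi>) \<sigma> \<le> ereal (- log b (p k0))"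
      using adm div[OF adm] by auto
  qed
qed

lemma order_real:
  assumes "1 / 2 < a" "a \<noteq> 1" "1 / a + 1 / \<beta> = 2"
  shows "renyi_asymmetry b (ereal a) D G (ketbra \<psi> \<psi>) = renyi_entropy b (ereal \<beta>) P"
proof -
  define t where "t = (1 - a) / a"
  have a0: "a > 0" using assms(1) by simp
  have t: "t < 1" "t \<noteq> 0" "t > 0 \<longleftrightarrow> a < 1" "t < 0 \<longleftrightarrow> a > 1"
    using assms(1,2) a0 by (auto simp: t_def field_simps)
  have "1 / \<beta> = 1 - t" using assms(3) a0 by (simp add: t_def field_simps)
  then have beta: "\<beta> = 1 / (1 - t)" by (metis divide_divide_eq_right div_by_1 mult_1)
  have "\<beta> \<noteq> 1" "\<beta> > 0" using beta t by auto
  then have H: "renyi_entropy b (ereal \<beta>) P = renyi_entropy_real b \<beta> P"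
    by (simp add: renyi_entropy_def one_ereal_def)
  have div: "renyi_divergence b (ereal a) (ketbra \<psi> \<psi>) \<sigma> =
      (if a \<ge> 1 \<and> \<not> kernel_orth \<sigma> then \<infinity> else moment_divergence b \<sigma> \<psi> t)" if "admissible \<sigma>" for \<sigma>
    using renyi_divergence_real_admissible[OF that a0 assms(2)] assms(2)
    by (simp add: renyi_divergence_def one_ereal_def t_def)
  show ?thesis
    unfolding H
  proof (rule renyi_asymmetry_eqI)
    fix \<sigma> assume adm: "admissible \<sigma>"
    show "renyi_entropy_real b \<beta> P \<le> renyi_divergence b (ereal a) (ketbra \<psi> \<psi>) \<sigma>"
    proof (cases "t > 0")
      case True
      then show ?thesis
        using entropy_le_divergence_pos[OF adm True t(1) beta] t(3) by (simp add: div[OF adm])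
    next
      case False
      then have "t < 0" using t(2) by simp
      then have "\<beta> < 1" by (simp add: beta)
      show ?thesis
      \<comment> \<open>t < 0 means \<alpha> > 1, where a violated support condition makes the
        divergence infinite and the bound trivial.\<close>
      proof (cases "kernel_orth \<sigma>")
        case True
        show ?thesis
          using renyi_entropy_real_le[OF \<open>\<beta> > 0\<close> \<open>\<beta> < 1\<close> finite_entropy_le_divergence_neg[OF adm True \<open>t < 0\<close> beta]] True
          by (simp add: div[OF adm])
      qed (use \<open>t < 0\<close> t(4) in \<open>simp add: div[OF adm]\<close>)
    qed
  next
    assume fin: "renyi_entropy_real b \<beta> P \<noteq> \<infinity>"
    have "(\<lambda>k. p k powr \<beta>) summable_on K"
    proof (cases "\<beta> \<ge> 1")
      case True
      then show ?thesis using has_sum_p_powr_ge_1 by (metis summable_on_def)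
    next
      case False
      then have "(\<Sum>\<^sub>\<infinity>k\<in>K. ennreal (p k powr \<beta>)) \<noteq> \<infinity>"
        using fin by (auto simp: renyi_entropy_real_pinching[OF \<open>\<beta> > 0\<close>] elog_def)
      then show ?thesis
        by (intro summable_on_infsum_ennreal_finite) (auto simp: top.not_eq_extremum)
    qed
    then obtain z where z: "((\<lambda>k. p k powr \<beta>) has_sum z) K" by (auto simp: summable_on_def)
    show "\<exists>\<sigma>. admissible \<sigma> \<and> renyi_divergence b (ereal a) (ketbra \<psi> \<psi>) \<sigma> \<le> renyi_entropy_real b \<beta> P"
      using optimal_state[OF t(1) beta z] t(2) div by (metis order_refl)
  qed
qed

text \<open>The left endpoint 1/2 selects the orders with 0 < t < 1, for which the entropy bound
  \<open>entropy_le_divergence_pos\<close> is available.\<close>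

lemma renyi_divergence_one:
  assumes "admissible \<sigma>"
  shows "renyi_divergence b 1 (ketbra \<psi> \<psi>) \<sigma> = (SUP a\<in>{1 / 2<..<1}. moment_divergence b \<sigma> \<psi> ((1 - a) / a))"
proof -
  let ?f = "\<lambda>a. renyi_divergence_real b a (ketbra \<psi> \<psi>) \<sigma>"
  have eq: "?f a = moment_divergence b \<sigma> \<psi> ((1 - a) / a)" if "1 / 2 < a" "a < 1" for a
    using renyi_divergence_real_admissible[OF assms, of a] that by simp
  have "(?f \<longlongrightarrow> (SUP a\<in>{1 / 2<..<1}. ?f a)) (at_left 1)"
  proof (rule tendsto_SUP_at_left)
    fix x y :: real assume xy: "1 / 2 < x" "x \<le> y" "y < 1"
    then have "(1 - y) / y \<le> (1 - x) / x" by (intro frac_le) auto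
    then show "?f x \<le> ?f y"
      using moment_divergence_mono(1)[OF assms, of "(1 - y) / y" "(1 - x) / x"] xy eq[of x] eq[of y] by simp
  qed simp
  then have "renyi_divergence b 1 (ketbra \<psi> \<psi>) \<sigma> = (SUP a\<in>{1 / 2<..<1}. ?f a)"
    unfolding renyi_divergence_def by (simp add: tendsto_Lim)
  also have "\<dots> = (SUP a\<in>{1 / 2<..<1}. moment_divergence b \<sigma> \<psi> ((1 - a) / a))"
    by (rule SUP_cong) (use eq in auto)
  finally show ?thesis .
qed

lemma renyi_divergence_infinity:
  assumes "admissible \<sigma>"
  shows "renyi_divergence b \<infinity> (ketbra \<psi> \<psi>) \<sigma> =
    (if kernel_orth \<sigma> then SUP a\<in>{1<..}. moment_divergence b \<sigma> \<psi> ((1 - a) / a) else \<infinity>)"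
proof -
  let ?f = "\<lambda>a. renyi_divergence_real b a (ketbra \<psi> \<psi>) \<sigma>"
  have eq: "?f a = (if kernel_orth \<sigma> then moment_divergence b \<sigma> \<psi> ((1 - a) / a) else \<infinity>)" if "1 < a" for a
    using renyi_divergence_real_admissible[OF assms, of a] that by simp
  have "(?f \<longlongrightarrow> (SUP a\<in>{1<..}. ?f a)) at_top"
  proof (rule tendsto_SUP_at_top)
    fix x y :: real assume xy: "1 < x" "x \<le> y"
    then have "(1 - y) / y \<le> (1 - x) / x" "(1 - x) / x < 0" by (auto simp: field_simps)
    then show "?f x \<le> ?f y"
      using moment_divergence_mono(2)[OF assms, of "(1 - x) / x" "(1 - y) / y"] xy eq[of x] eq[of y] by simp
  qed
  then have "renyi_divergence b \<infinity> (ketbra \<psi> \<psi>) \<sigma> = (SUP a\<in>{1<..}. ?f a)"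
    unfolding renyi_divergence_def by (simp add: tendsto_Lim)
  also have "\<dots> = (SUP a\<in>{1<..}. if kernel_orth \<sigma> then moment_divergence b \<sigma> \<psi> ((1 - a) / a) else \<infinity>)"
    by (rule SUP_cong) (use eq in auto)
  finally show ?thesis by (simp add: greaterThan_non_empty)
qed

lemma order_infinity:
  "renyi_asymmetry b \<infinity> D G (ketbra \<psi> \<psi>) = renyi_entropy b (ereal (1 / 2)) P"
proof -
  have H: "renyi_entropy b (ereal (1 / 2)) P = renyi_entropy_real b (1 / 2) P"
    by (simp add: renyi_entropy_def one_ereal_def)
  show ?thesis
    unfolding H
  proof (rule renyi_asymmetry_eqI)
    fix \<sigma> assume adm: "admissible \<sigma>"
    show "renyi_entropy_real b (1 / 2) P \<le> renyi_divergence b \<infinity> (ketbra \<psi> \<psi>) \<sigma>"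
    proof (cases "kernel_orth \<sigma>")
      case True
      define L where "L = (SUP a\<in>{1<..}. moment_divergence b \<sigma> \<psi> ((1 - a) / a))"
      have "renyi_entropy_real b (1 / 2) P \<le> L"
      proof (rule renyi_entropy_real_le)
        fix F assume F: "finite F" "F \<subseteq> K" "F \<noteq> {}"
        define h where "h \<beta> = 1 / (1 - \<beta>) * log b (\<Sum>k\<in>F. p k powr \<beta>)" for \<beta>
        have pF: "p k > 0" if "k \<in> F" for k using p_pos that F(2) by blast
        have h_le: "ereal (h \<beta>) \<le> L" if beta: "1 / 2 < \<beta>" "\<beta> < 1" for \<beta>
        proof -
          \<comment> \<open>The solution of 1 / a + 1 / \<beta> = 2.\<close>
          define a where "a = \<beta> / (2 * \<beta> - 1)"
          have a: "a > 1" using beta by (simp add: a_def field_simps)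
          have "(1 - a) / a = 1 - 1 / \<beta>" using beta by (simp add: a_def field_simps)
          moreover have "1 - 1 / \<beta> < 0" using beta by simp
          ultimately have "ereal (h \<beta>) \<le> moment_divergence b \<sigma> \<psi> ((1 - a) / a)"
            unfolding h_def using finite_entropy_le_divergence_neg[OF adm True _ _ F, of "1 - 1 / \<beta>" \<beta>] by simp
          also have "\<dots> \<le> L" unfolding L_def by (rule SUP_upper) (use a in simp)
          finally show ?thesis .
        qed
        \<comment> \<open>Continuity in \<beta> is used for the finite sum only: the full sum may be
          finite for \<beta> > 1/2 and infinite at 1/2.\<close>
        have "(\<Sum>k\<in>F. p k powr (1 / 2)) > 0" using F pF by (intro sum_pos) fastforce+
        then have "(h \<longlongrightarrow> h (1 / 2)) (at (1 / 2))"
          unfolding h_def using b pF by (intro tendsto_intros) auto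
        then have "(h \<longlongrightarrow> h (1 / 2)) (at_right (1 / 2))"
          by (rule filterlim_mono) (auto simp: at_le)
        then have "((\<lambda>\<beta>. ereal (h \<beta>)) \<longlongrightarrow> ereal (h (1 / 2))) (at_right (1 / 2))"
          by (rule tendsto_ereal)
        moreover have "\<forall>\<^sub>F \<beta> in at_right (1 / 2). ereal (h \<beta>) \<le> L"
          using eventually_at_right_real[of "1 / 2" "1 :: real"] by (rule eventually_mono) (use h_le in auto)
        ultimately have "ereal (h (1 / 2)) \<le> L"
          by (rule tendsto_upperbound) simp
        then show "ereal (1 / (1 - 1 / 2) * log b (\<Sum>k\<in>F. p k powr (1 / 2))) \<le> L"
          by (simp add: h_def)
      qed auto
      then show ?thesis using True by (simp add: renyi_divergence_infinity[OF adm] L_def)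
    qed (simp add: renyi_divergence_infinity[OF adm])
  next
    assume "renyi_entropy_real b (1 / 2) P \<noteq> \<infinity>"
    then have "(\<Sum>\<^sub>\<infinity>k\<in>K. ennreal (p k powr (1 / 2))) \<noteq> \<infinity>"
      by (auto simp: renyi_entropy_real_pinching elog_def)
    then have "(\<lambda>k. p k powr (1 / 2)) summable_on K"
      by (intro summable_on_infsum_ennreal_finite) (auto simp: top.not_eq_extremum)
    then obtain z where z: "((\<lambda>k. p k powr (1 / 2)) has_sum z) K" by (auto simp: summable_on_def)
    let ?s = "diag_op u (\<lambda>k. p k powr (1 / 2) / z) K"
    have opt: "admissible ?s" "kernel_orth ?s" "moment_divergence b ?s \<psi> (- 1) = renyi_entropy_real b (1 / 2) P"
      using optimal_state[of "- 1" "1 / 2" z] z by auto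
    \<comment> \<open>The orders a > 1 have (1 - a) / a above -1, so by monotonicity none of them
      exceeds the value at -1, for which the state is optimal.\<close>
    have "moment_divergence b ?s \<psi> ((1 - a) / a) \<le> moment_divergence b ?s \<psi> (- 1)" if "a > 1" for a
      using that by (intro moment_divergence_mono(2)[OF opt(1)]) (auto simp: field_simps)
    then have "renyi_divergence b \<infinity> (ketbra \<psi> \<psi>) ?s \<le> renyi_entropy_real b (1 / 2) P"
      using opt(2,3) by (auto simp: renyi_divergence_infinity[OF opt(1)] intro: SUP_least)
    then show "\<exists>\<sigma>. admissible \<sigma> \<and> renyi_divergence b \<infinity> (ketbra \<psi> \<psi>) \<sigma> \<le> renyi_entropy_real b (1 / 2) P"
      using opt(1) by blast
  qed
qed

text \<open>The lower bound comes from the entropies of order 1 + \<epsilon>, compared on finite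
  sums. The infimum is attained by the pinched state itself, whose weights p_k are what p_k^\<beta>
  / Z becomes at \<beta> = 1.\<close>

lemma order_one:
  "renyi_asymmetry b 1 D G (ketbra \<psi> \<psi>) = renyi_entropy b 1 P"
proof -
  have ln_b: "ln b > 0" using b by simp
  define S where "S = (\<Sum>\<^sub>\<infinity>k\<in>K. ennreal (- (p k * log b (p k))))"
  have nonneg: "0 \<le> - (p k * log b (p k))" if "k \<in> K" for k
    using b p_pos[OF that] p_le[OF that] by (simp add: mult_nonneg_nonpos)
  have H: "renyi_entropy b 1 P = enn2ereal S"
    by (simp add: renyi_entropy_def von_neumann_entropy_pinching S_def)
  show ?thesis
    unfolding H
  proof (rule renyi_asymmetry_eqI)
    fix \<sigma> assume adm: "admissible \<sigma>"
    define L where "L = (SUP a\<in>{1 / 2<..<1}. moment_divergence b \<sigma> \<psi> ((1 - a) / a))"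
    have fin_le: "ereal (\<Sum>k\<in>F. - (p k * log b (p k))) \<le> L" if F: "finite F" "F \<subseteq> K" for F
    proof -
      \<comment> \<open>Up to sign and the factor 1 / ln b, the difference quotient of the sum of
        \<open>p k powr \<beta>\<close> over F at \<beta> = 1; its limit is the finite part of - sum
        p_k log p_k.\<close>
      define h where "h \<epsilon> = (\<Sum>k\<in>F. - ((p k powr (1 + \<epsilon>) - p k) / \<epsilon>)) / ln b" for \<epsilon>
      have h_le: "ereal (h \<epsilon>) \<le> L" if "\<epsilon> > 0" for \<epsilon>
      proof -
        \<comment> \<open>The exponent conjugate to \<beta> = 1 + \<epsilon>, that is 1 / (1 - t) =
          1 + \<epsilon>; next, a is the order with (1 - a) / a = t.\<close>
        define t where "t = \<epsilon> / (1 + \<epsilon>)"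
        define a where "a = 1 / (1 + t)"
        have t: "0 < t" "t < 1" "1 + \<epsilon> = 1 / (1 - t)"
          using that by (simp_all add: t_def field_simps)
        have a: "1 / 2 < a" "a < 1" "(1 - a) / a = t"
          using t by (simp_all add: a_def field_simps)
        obtain z where z: "((\<lambda>k. p k powr (1 + \<epsilon>)) has_sum z) K"
          by (rule has_sum_p_powr_ge_1[of "1 + \<epsilon>"]) (use \<open>\<epsilon> > 0\<close> in simp)
        have z0: "z > 0" by (rule has_sum_powr_pos[OF z])
        \<comment> \<open>Subtracting z from the total mass 1 leaves nonnegative terms, so the part
          of the sum over F is at most 1 - z \<le> - ln z.\<close>
        have "((\<lambda>k. p k - p k powr (1 + \<epsilon>)) has_sum (1 - z)) K"
          using has_sum_add[OF has_sum_p has_sum_uminusI[OF z]] by simp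
        then have "(\<Sum>k\<in>F. p k - p k powr (1 + \<epsilon>)) \<le> 1 - z"
        proof (rule finite_sum_le_has_sum[OF _ F])
          show "0 \<le> p k - p k powr (1 + \<epsilon>)" if "k \<in> K - F" for k
            using powr_le_one_le[of "p k" "1 + \<epsilon>"] p_pos[of k] p_le[of k] that \<open>\<epsilon> > 0\<close> by simp
        qed
        also have "\<dots> \<le> - ln z" using ln_le_minus_one[OF z0] by simp
        finally have "(\<Sum>k\<in>F. p k - p k powr (1 + \<epsilon>)) / \<epsilon> / ln b \<le> - ln z / \<epsilon> / ln b"
          using that ln_b by (intro divide_right_mono) auto
        moreover have "h \<epsilon> = (\<Sum>k\<in>F. p k - p k powr (1 + \<epsilon>)) / \<epsilon> / ln b"
          unfolding h_def sum_divide_distrib by (simp add: minus_divide_left)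
        ultimately have "h \<epsilon> \<le> 1 / (1 - (1 + \<epsilon>)) * log b z"
          by (simp add: log_def mult.commute)
        then have "ereal (h \<epsilon>) \<le> renyi_entropy_real b (1 + \<epsilon>) P"
          using that by (simp add: renyi_entropy_real_has_sum[OF _ z])
        also have "\<dots> \<le> moment_divergence b \<sigma> \<psi> ((1 - a) / a)"
          unfolding a(3) by (rule entropy_le_divergence_pos[OF adm t])
        also have "\<dots> \<le> L"
          unfolding L_def by (rule SUP_upper) (use a in simp)
        finally show ?thesis .
      qed
      have "((\<lambda>\<epsilon>. (p k powr (1 + \<epsilon>) - p k) / \<epsilon>) \<longlongrightarrow> p k * ln (p k)) (at_right 0)" if "k \<in> F" for k
      proof -
        have pk: "p k > 0" using p_pos that F(2) by blast
        have "((\<lambda>\<epsilon>. p k powr \<epsilon>) has_real_derivative p k powr 1 * ln (p k)) (at 1)"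
          using pk by (auto intro!: derivative_eq_intros)
        then have "((\<lambda>\<epsilon>. (p k powr (1 + \<epsilon>) - p k) / \<epsilon>) \<longlongrightarrow> p k * ln (p k)) (at 0)"
          using pk by (simp add: DERIV_def)
        then show ?thesis by (rule filterlim_mono) (auto simp: at_le)
      qed
      then have "(h \<longlongrightarrow> (\<Sum>k\<in>F. - (p k * ln (p k))) / ln b) (at_right 0)"
        unfolding h_def using ln_b by (intro tendsto_intros) auto
      also have "(\<Sum>k\<in>F. - (p k * ln (p k))) / ln b = (\<Sum>k\<in>F. - (p k * log b (p k)))"
        by (simp add: sum_divide_distrib log_def)
      finally have "((\<lambda>\<epsilon>. ereal (h \<epsilon>)) \<longlongrightarrow> ereal (\<Sum>k\<in>F. - (p k * log b (p k)))) (at_right 0)"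
        by (rule tendsto_ereal)
      moreover have "\<forall>\<^sub>F \<epsilon> in at_right 0. ereal (h \<epsilon>) \<le> L"
        using eventually_at_right_less[of "0 :: real"] by (rule eventually_mono) (use h_le in auto)
      ultimately show ?thesis by (rule tendsto_upperbound) simp
    qed
    have "enn2ereal S \<le> L"
    proof (cases L)
      case (real l)
      have "S \<le> ennreal l"
        unfolding S_def
      proof (rule infsum_ennreal_le)
        fix F assume F: "finite F" "F \<subseteq> K"
        have "(\<Sum>k\<in>F. ennreal (- (p k * log b (p k)))) = ennreal (\<Sum>k\<in>F. - (p k * log b (p k)))"
          using F nonneg by (intro sum_ennreal) blast
        then show "(\<Sum>k\<in>F. ennreal (- (p k * log b (p k)))) \<le> ennreal l"
          using fin_le[OF F] real by (simp add: ennreal_leI)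
      qed
      moreover have "l \<ge> 0" using fin_le[of "{}"] real by simp
      ultimately show ?thesis
        using real by (metis enn2ereal_ennreal less_eq_ennreal.rep_eq)
    \<comment> \<open>The empty F gives L \<ge> 0, which excludes L = - \<infinity>.\<close>
    qed (use fin_le[of "{}"] in auto)
    then show "enn2ereal S \<le> renyi_divergence b 1 (ketbra \<psi> \<psi>) \<sigma>"
      by (simp add: renyi_divergence_one[OF adm] L_def)
  next
    assume "enn2ereal S \<noteq> \<infinity>"
    then have "S < \<infinity>" by (cases S) auto
    then have "(\<lambda>k. - (p k * log b (p k))) summable_on K"
      unfolding S_def by (rule summable_on_infsum_ennreal_finite) (use nonneg in auto)
    then obtain s where s: "((\<lambda>k. - (p k * log b (p k))) has_sum s) K" by (auto simp: summable_on_def)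
    then have "s \<ge> 0" using nonneg by (rule has_sum_nonneg)
    have "S = ennreal s"
      unfolding S_def by (rule has_sum_ennreal[OF s nonneg])
    then have Ss: "enn2ereal S = ereal s"
      using \<open>s \<ge> 0\<close> by (simp add: enn2ereal_ennreal)
    let ?s = "diag_op u p K"
    have adm: "admissible ?s"
      unfolding admissible_def
      using density_op_diag_op[OF diagonal_p has_sum_p] commutes_diag_op[OF diagonal_p] by simp
    have "moment_divergence b ?s \<psi> t \<le> ereal s" if t: "t > 0" for t
    proof -
      obtain z where z: "((\<lambda>k. p k powr (1 + t)) has_sum z) K"
        by (rule has_sum_p_powr_ge_1[of "1 + t"]) (use t in simp)
      have z0: "z > 0" by (rule has_sum_powr_pos[OF z])
      have "p k powr t * p k = p k powr (1 + t)" if "k \<in> K" for k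
        using powr_add[of "p k" 1 t] p_pos[OF that] by simp
      then have "spectral_moment ?s \<psi> t = (\<Sum>\<^sub>\<infinity>k\<in>K. ennreal (p k powr (1 + t)))"
        unfolding spectral_moment_diag_op[OF diagonal_p order_refl] by (intro infsum_cong) simp
      also have "\<dots> = ennreal z" by (rule has_sum_ennreal[OF z]) simp
      finally have md: "moment_divergence b ?s \<psi> t = ereal (- log b z / t)"
        using z0 t by (intro moment_divergence_le(3)[OF b]) auto
      define m where "m = - (t * ln b * s)"
      text \<open>Jensen's inequality for \<open>exp\<close>, from its tangent line at the mean \<open>m\<close> of \<open>t ln p\<^sub>k\<close>.\<close>
      have "exp m * (1 - m) * 1 + exp m * (- (t * ln b)) * s \<le> z"
      proof (rule has_sum_mono[OF has_sum_add[OF has_sum_cmult_right[OF has_sum_p] has_sum_cmult_right[OF s]] z])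
        fix k assume k: "k \<in> K"
        define x where "x = t * ln (p k)"
        have "exp m * (1 + (x - m)) \<le> exp m * exp (x - m)"
          using exp_ge_add_one_self[of "x - m"] by (intro mult_left_mono) auto
        also have "\<dots> = exp x" by (simp add: exp_add[symmetric])
        finally have "p k * (exp m * (1 + (x - m))) \<le> p k * exp x"
          using p_nonneg by (rule mult_left_mono)
        also have "p k * exp x = p k powr (1 + t)"
          using p_pos[OF k] powr_add[of "p k" 1 t] by (simp add: x_def powr_def)
        also have "p k * (exp m * (1 + (x - m))) = exp m * (1 - m) * p k + exp m * (- (t * ln b)) * (- (p k * log b (p k)))"
          using ln_b by (simp add: x_def log_def algebra_simps)
        finally show "exp m * (1 - m) * p k + exp m * (- (t * ln b)) * (- (p k * log b (p k))) \<le> p k powr (1 + t)" .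
      qed
      then have "exp m \<le> z" by (simp add: m_def algebra_simps)
      then have "m \<le> ln z" using z0 by (simp add: ln_ge_iff)
      then have "- ln z / ln b / t \<le> - m / ln b / t"
        using ln_b t by (intro divide_right_mono) auto
      also have "- m / ln b / t = s" using ln_b t by (simp add: m_def)
      finally show ?thesis by (simp add: md log_def)
    qed
    then have "renyi_divergence b 1 (ketbra \<psi> \<psi>) ?s \<le> ereal s"
      unfolding renyi_divergence_one[OF adm] by (intro SUP_least) auto
    then show "\<exists>\<sigma>. admissible \<sigma> \<and> renyi_divergence b 1 (ketbra \<psi> \<psi>) \<sigma> \<le> enn2ereal S"
      using adm Ss by auto
  qed
qed

end

theorem mainTheorem17:
  fixes G :: "'a::complex_hilbert_space \<Rightarrow> 'a" and D :: "'a set"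
    and \<psi> :: 'a and \<alpha> \<beta> :: ereal and b :: real
  assumes "b > 1"
    and "self_adjoint D G"
    and "discrete_spectrum D G"
    and "norm \<psi> = 1"
    and "\<alpha> \<ge> ereal (1 / 2)" and "\<beta> \<ge> ereal (1 / 2)"
    and "1 / \<alpha> + 1 / \<beta> = 2"
  shows "renyi_asymmetry b \<alpha> D G (ketbra \<psi> \<psi>) =
         renyi_entropy b \<beta> (pinching D G (ketbra \<psi> \<psi>))"
proof -
  interpret pure_state G D \<psi> b
    by standard (rule assms)+
  show ?thesis
  \<comment> \<open>As 1 / \<infinity> = 0, the relation pairs 1/2 with \<infinity> in both
    directions and 1 with 1; in all other cases both orders are finite and above 1/2.\<close>
  proof (cases \<alpha>)
    case (real a)
    have a: "a \<ge> 1 / 2" using assms(5) real by simp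
    then have inv: "1 / \<alpha> = ereal (1 / a)" using real by (simp add: one_ereal_def)
    show ?thesis
    proof (cases \<beta>)
      case (real b')
      have b': "b' \<ge> 1 / 2" using assms(6) real by simp
      then have inv': "1 / \<beta> = ereal (1 / b')" using real by (simp add: one_ereal_def)
      have "ereal (1 / a + 1 / b') = ereal 2"
        using assms(7) unfolding inv inv' by simp
      then have sum: "1 / a + 1 / b' = 2" by (simp only: ereal.inject)
      show ?thesis
      proof (cases "a = 1")
        case True
        then have "b' = 1" using sum by (simp add: field_simps)
        then show ?thesis using order_one True real \<open>\<alpha> = ereal a\<close> by (simp add: one_ereal_def)
      next
        case False
        have "a \<noteq> 1 / 2"
        proof
          assume half: "a = 1 / 2"
          have "1 / a = 2" unfolding half by simp
          moreover have "1 / b' > 0" using b' by simp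
          ultimately show False using sum by linarith
        qed
        then show ?thesis
          using order_real[OF _ False sum] a real \<open>\<alpha> = ereal a\<close> by simp
      qed
    next
      case PInf
      then have "ereal (1 / a) = ereal 2" using assms(7) unfolding inv by simp
      then have "1 / a = 2" by (simp only: ereal.inject)
      then have "a = 1 / 2" by (metis inverse_eq_divide inverse_inverse_eq)
      then have "\<alpha> = ereal (1 / 2)" using real by (simp only:)
      then show ?thesis unfolding PInf using order_half by (simp only:)
    qed (use assms(6) in auto)
  next
    case PInf
    show ?thesis
    proof (cases \<beta>)
      case (real b')
      have "b' \<ge> 1 / 2" using assms(6) real by simp
      then have "1 / \<beta> = ereal (1 / b')" using real by (simp add: one_ereal_def)
      then have "ereal (1 / b') = ereal 2" using assms(7) PInf by simp
      then have "1 / b' = 2" by (simp only: ereal.inject)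
      then have "b' = 1 / 2" by (metis inverse_eq_divide inverse_inverse_eq)
      then have "\<beta> = ereal (1 / 2)" using real by (simp only:)
      then show ?thesis unfolding PInf using order_infinity by (simp only:)
    qed (use assms(6,7) PInf in auto)
  qed (use assms(5) in auto)
qed

end
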